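(* Notation: for real-valued smooth functions $W_\pm,X_\pm,Y_\pm,Z_\pm$ of $(u,v)$ put $\Delta_{\pm}=W_{\mp}X_{\pm}+Y_{\pm}Z_{\mp}$ and, where $\Delta_\pm\neq0$ (upper signs throughout or lower signs throughout), $$A_{\pm}=\mp\frac{1}{\Delta_{\pm}}\Big[-X_{\pm}\big((Y_{\pm})_v\mp(X_{\pm})_u\big)+Z_{\mp}\big((W_{\mp})_v\pm(Z_{\mp})_u\big)\Big],$$ $$B_{\mp}=-\frac{1}{\Delta_{\pm}}\Big[Y_{\pm}\big((Y_{\pm})_v\mp(X_{\pm})_u\big)+W_{\mp}\big((W_{\mp})_v\pm(Z_{\mp})_u\big)\Big].$$ (1) Let $N$ be an oriented $4$-dimensional Riemannian space form of constant sectional curvature $L_0\neq0$, $M$ a Riemann surface, and $F:M\to N$ a conformal immersion whose twistor lifts $\Theta_{\pm,1}$ are nondegenerate. Then for any local data $(u,v),\lambda,N_1,N_2$ as in the context (with $(T_1,T_2,N_1,N_2)$ positively oriented), the associated functions satisfy $\Delta_\pm\neq0$, $(A_{\pm},B_{\mp})=(\phi_{\pm},\psi_{\mp})$, and, with $f=L_0e^{2\lambda}$, $f_u=f(A_++A_-)$, $f_v=f(B_++B_-)$. (2) Conversely, let $L_0\neq0$ be a real number, $D\subset\mathbb{R}^2$ a simply connected domain with coordinates $(u,v)$, and $W_\pm,X_\pm,Y_\pm,Z_\pm$ real-valued smooth functions on $D$ with $W_++W_-=X_++X_-$, $Y_++Y_-=Z_++Z_-$, $\Delta_\pm\neq0$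 everywhere, and $\Delta_+-\Delta_-=(A_+-A_-)_u-(B_+-B_-)_v$. Suppose that $f:=\Delta_+-(A_+)_u-(B_-)_v$ $(=\Delta_--(A_-)_u-(B_+)_v)$ is nowhere zero, $f/L_0>0$, and $f_u=f(A_++A_-)$, $f_v=f(B_++B_-)$. Then these give a conformal immersion $F$ of $D$ into the $4$-dimensional Riemannian space form $N$ of constant sectional curvature $L_0$: namely $F$ has induced metric $e^{2\lambda}(du^2+dv^2)$ with $\lambda=\frac12\log(f/L_0)$, and for suitable normal fields $N_1,N_2$ as in the context and an orientation of $N$ making $(T_1,T_2,N_1,N_2)$ positively oriented, its associated functions $W_\pm,X_\pm,Y_\pm,Z_\pm$ are the given ones. The twistor lifts of $F$ are nondegenerate, and $F$ is unique up to an isometry of $N$.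
   Context: $N$ is realized as $\{x\in E^5:\langle x,x\rangle=1/L_0\}$ if $L_0>0$ and as $\{x\in E^5_1:\langle x,x\rangle=1/L_0\}$ if $L_0<0$; $h$ its metric, $\nabla$ its Levi-Civita connection. For a conformal immersion $F$ of a Riemann surface into $N$: take local isothermal coordinates $(u,v)$, induced metric $e^{2\lambda}(du^2+dv^2)$, $T_1=dF(\partial_u)$, $T_2=dF(\partial_v)$, and normal fields $N_1,N_2$ with $h(N_1,N_1)=h(N_2,N_2)=e^{2\lambda}$, $h(N_1,N_2)=0$. Define $\alpha_k,\beta_k,\mu_l$ by $\sigma(T_1,T_1)=\alpha_1N_1+\beta_1N_2$, $\sigma(T_1,T_2)=\alpha_2N_1+\beta_2N_2$, $\sigma(T_2,T_2)=\alpha_3N_1+\beta_3N_2$ ($\sigma$ the second fundamental form), $\nabla^\perp_{\partial_u}N_1=\lambda_uN_1+\mu_1N_2$, $\nabla^\perp_{\partial_v}N_1=\lambda_vN_1+\mu_2N_2$. Associated functions: $W_\pm=\alpha_2\pm\beta_1$, $X_\pm=\alpha_2\pm\beta_3$, $Y_\pm=\beta_2\pm\alpha_1$, $Z_\pm=\beta_2\pm\alpha_3$, $\phi_\pm=\lambda_u\mp\mu_2$, $\psi_\pm=\lambda_v\mp\mu_1$. With $e_1,\dots,e_4=e^{-\lambda}(T_1,T_2,N_1,N_2)$ and $(T_1,T_2,N_1,N_2)$ positively oriented, the twistor lifts are $\Theta_{\pm,1}=\frac1{\sqrt2}(e_1\wedge e_2\pm e_3\wedge e_4)$; they are nondegenerate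 if for each $\varepsilon\in\{+,-\}$, $\hat\nabla_{T_1}\Theta_{\varepsilon,1}$ and $\hat\nabla_{T_2}\Theta_{\varepsilon,1}$ are linearly independent at each point, $\hat\nabla$ being the connection on $\bigwedge^2F^*TN$ induced by $\nabla$. *)

theory Defs
  imports "HOL-Analysis.Analysis"
begin

type_synonym pt = "real \<times> real"

definition pdir :: "nat \<Rightarrow> (pt \<Rightarrow> 'a::real_normed_vector) \<Rightarrow> pt \<Rightarrow> 'a" where
  "pdir k f p = frechet_derivative f (at p) (if k = 1 then (1, 0) else (0, 1))"

abbreviation pu :: "(pt \<Rightarrow> 'a::real_normed_vector) \<Rightarrow> pt \<Rightarrow> 'a" where "pu \<equiv> pdir 1"
abbreviation pv :: "(pt \<Rightarrow> 'a::real_normed_vector) \<Rightarrow> pt \<Rightarrow> 'a" where "pv \<equiv> pdir 2"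

fun iter_pd :: "nat list \<Rightarrow> (pt \<Rightarrow> 'a::real_normed_vector) \<Rightarrow> pt \<Rightarrow> 'a" where
  "iter_pd [] f = f"
| "iter_pd (k # ks) f = pdir k (iter_pd ks f)"

definition smooth_on :: "pt set \<Rightarrow> (pt \<Rightarrow> 'a::real_normed_vector) \<Rightarrow> bool" where
  "smooth_on D f \<longleftrightarrow> open D \<and> (\<forall>ks. iter_pd ks f differentiable_on D)"

section \<open>The space form N of curvature L0 inside E^5 ori E^5_1\<close>

definition ip :: "real \<Rightarrow> real^5 \<Rightarrow> real^5 \<Rightarrow> real" where
  "ip L0 x y = (\<Sum>i\<in>UNIV. (if L0 < 0 \<and> i = 1 then -1 else 1) * (x $ i) * (y $ i))"

definition spform :: "real \<Rightarrow> (real^5) set" where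
  "spform L0 = {x. ip L0 x x = 1 / L0}"

text \<open>An orientation of N: a locally constant choice of sign of the volume form
  det(x, v1, v2, v3, v4) on T_x N.\<close>
definition orientation :: "real \<Rightarrow> (real^5 \<Rightarrow> real) \<Rightarrow> bool" where
  "orientation L0 ori \<longleftrightarrow> (\<forall>x\<in>spform L0. ori x \<in> {-1, 1}) \<and> continuous_on (spform L0) ori"

definition mat5 :: "real^5 \<Rightarrow> real^5 \<Rightarrow> real^5 \<Rightarrow> real^5 \<Rightarrow> real^5 \<Rightarrow> real^5^5" where
  "mat5 a b c d e = (\<chi> i. if i = 1 then a else if i = 2 then b else if i = 3 then c
                          else if i = 4 then d else e)"

definition pos_oriented :: "(real^5 \<Rightarrow> real) \<Rightarrow> (pt \<Rightarrow> real^5) \<Rightarrow> (pt \<Rightarrow> real^5) \<Rightarrow> (pt \<Rightarrow> real^5) \<Rightarrow> pt \<Rightarrow> bool" where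
  "pos_oriented ori F N1 N2 p \<longleftrightarrow> ori (F p) * det (mat5 (F p) (pu F p) (pv F p) (N1 p) (N2 p)) > 0"

definition isometry_N :: "real \<Rightarrow> (real^5 \<Rightarrow> real^5) \<Rightarrow> bool" where
  "isometry_N L0 \<Phi> \<longleftrightarrow> linear \<Phi> \<and> (\<forall>x y. ip L0 (\<Phi> x) (\<Phi> y) = ip L0 x y)"

text \<open>Levi-Civita connection of N along F: tangential projection of the ambient derivative.\<close>
definition covD :: "real \<Rightarrow> (pt \<Rightarrow> real^5) \<Rightarrow> nat \<Rightarrow> (pt \<Rightarrow> real^5) \<Rightarrow> pt \<Rightarrow> real^5" where
  "covD L0 F k V p = pdir k V p - (L0 * ip L0 (pdir k V p) (F p)) *\<^sub>R F p"

definition conf_frame :: "real \<Rightarrow> pt set \<Rightarrow> (pt \<Rightarrow> real^5) \<Rightarrow> (pt \<Rightarrow> real)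
    \<Rightarrow> (pt \<Rightarrow> real^5) \<Rightarrow> (pt \<Rightarrow> real^5) \<Rightarrow> (real^5 \<Rightarrow> real) \<Rightarrow> bool" where
  "conf_frame L0 D F lam N1 N2 ori \<longleftrightarrow>
     open D \<and> smooth_on D F \<and> smooth_on D N1 \<and> smooth_on D N2 \<and> orientation L0 ori \<and>
     (\<forall>p\<in>D. F p \<in> spform L0 \<and>
        ip L0 (pu F p) (pu F p) = exp (2 * lam p) \<and>
        ip L0 (pv F p) (pv F p) = exp (2 * lam p) \<and>
        ip L0 (pu F p) (pv F p) = 0 \<and>
        ip L0 (N1 p) (F p) = 0 \<and> ip L0 (N2 p) (F p) = 0 \<and>
        ip L0 (N1 p) (pu F p) = 0 \<and> ip L0 (N1 p) (pv F p) = 0 \<and>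
        ip L0 (N2 p) (pu F p) = 0 \<and> ip L0 (N2 p) (pv F p) = 0 \<and>
        ip L0 (N1 p) (N1 p) = exp (2 * lam p) \<and> ip L0 (N2 p) (N2 p) = exp (2 * lam p) \<and>
        ip L0 (N1 p) (N2 p) = 0 \<and>
        pos_oriented ori F N1 N2 p)"

definition ncoef :: "real \<Rightarrow> (pt \<Rightarrow> real^5) \<Rightarrow> pt \<Rightarrow> real^5 \<Rightarrow> real" where
  "ncoef L0 N p V = ip L0 V (N p) / ip L0 (N p) (N p)"

definition nproj :: "real \<Rightarrow> (pt \<Rightarrow> real^5) \<Rightarrow> (pt \<Rightarrow> real^5) \<Rightarrow> pt \<Rightarrow> real^5 \<Rightarrow> real^5" where
  "nproj L0 N1 N2 p V = ncoef L0 N1 p V *\<^sub>R N1 p + ncoef L0 N2 p V *\<^sub>R N2 p"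

definition sff :: "real \<Rightarrow> (pt \<Rightarrow> real^5) \<Rightarrow> (pt \<Rightarrow> real^5) \<Rightarrow> (pt \<Rightarrow> real^5) \<Rightarrow> nat \<Rightarrow> nat \<Rightarrow> pt \<Rightarrow> real^5" where
  "sff L0 F N1 N2 i j p = nproj L0 N1 N2 p (covD L0 F j (pdir i F) p)"

definition alpha :: "real \<Rightarrow> (pt \<Rightarrow> real^5) \<Rightarrow> (pt \<Rightarrow> real^5) \<Rightarrow> (pt \<Rightarrow> real^5) \<Rightarrow> nat \<Rightarrow> pt \<Rightarrow> real" where
  "alpha L0 F N1 N2 k p = (if k = 1 then ncoef L0 N1 p (sff L0 F N1 N2 1 1 p)
     else if k = 2 then ncoef L0 N1 p (sff L0 F N1 N2 1 2 p) else ncoef L0 N1 p (sff L0 F N1 N2 2 2 p))"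

definition beta :: "real \<Rightarrow> (pt \<Rightarrow> real^5) \<Rightarrow> (pt \<Rightarrow> real^5) \<Rightarrow> (pt \<Rightarrow> real^5) \<Rightarrow> nat \<Rightarrow> pt \<Rightarrow> real" where
  "beta L0 F N1 N2 k p = (if k = 1 then ncoef L0 N2 p (sff L0 F N1 N2 1 1 p)
     else if k = 2 then ncoef L0 N2 p (sff L0 F N1 N2 1 2 p) else ncoef L0 N2 p (sff L0 F N1 N2 2 2 p))"

definition mu :: "real \<Rightarrow> (pt \<Rightarrow> real^5) \<Rightarrow> (pt \<Rightarrow> real^5) \<Rightarrow> (pt \<Rightarrow> real^5) \<Rightarrow> nat \<Rightarrow> pt \<Rightarrow> real" where
  "mu L0 F N1 N2 l p = ncoef L0 N2 p (nproj L0 N1 N2 p (covD L0 F l N1 p))"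

definition sg :: "bool \<Rightarrow> real" where "sg s = (if s then 1 else -1)"

definition assocW where "assocW L0 F N1 N2 s p = alpha L0 F N1 N2 2 p + sg s * beta L0 F N1 N2 1 p"
definition assocX where "assocX L0 F N1 N2 s p = alpha L0 F N1 N2 2 p + sg s * beta L0 F N1 N2 3 p"
definition assocY where "assocY L0 F N1 N2 s p = beta L0 F N1 N2 2 p + sg s * alpha L0 F N1 N2 1 p"
definition assocZ where "assocZ L0 F N1 N2 s p = beta L0 F N1 N2 2 p + sg s * alpha L0 F N1 N2 3 p"
definition assocPhi where "assocPhi L0 F lam N1 N2 s p = pu lam p - sg s * mu L0 F N1 N2 2 p"
definition assocPsi where "assocPsi L0 F lam N1 N2 s p = pv lam p - sg s * mu L0 F N1 N2 1 p"

definition wedge :: "real^5 \<Rightarrow> real^5 \<Rightarrow> real^5^5" where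
  "wedge a b = (\<chi> i j. a $ i * b $ j - b $ i * a $ j)"

definition eframe :: "(pt \<Rightarrow> real^5) \<Rightarrow> (pt \<Rightarrow> real) \<Rightarrow> (pt \<Rightarrow> real^5) \<Rightarrow> (pt \<Rightarrow> real^5) \<Rightarrow> nat \<Rightarrow> pt \<Rightarrow> real^5" where
  "eframe F lam N1 N2 a p = exp (- lam p) *\<^sub>R
     (if a = 1 then pu F p else if a = 2 then pv F p else if a = 3 then N1 p else N2 p)"

text \<open>hat-nabla_{T_k} Theta_{eps,1}, computed by the Leibniz rule for the connection on
  the second exterior power induced by nabla.\<close>
definition twistor_cov :: "real \<Rightarrow> (pt \<Rightarrow> real^5) \<Rightarrow> (pt \<Rightarrow> real) \<Rightarrow> (pt \<Rightarrow> real^5) \<Rightarrow> (pt \<Rightarrow> real^5)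
    \<Rightarrow> bool \<Rightarrow> nat \<Rightarrow> pt \<Rightarrow> real^5^5" where
  "twistor_cov L0 F lam N1 N2 eps k p =
     (let e = eframe F lam N1 N2 in
      (1 / sqrt 2) *\<^sub>R
        (wedge (covD L0 F k (e 1) p) (e 2 p) + wedge (e 1 p) (covD L0 F k (e 2) p)
         + sg eps *\<^sub>R (wedge (covD L0 F k (e 3) p) (e 4 p) + wedge (e 3 p) (covD L0 F k (e 4) p))))"

definition twistor_nondeg :: "real \<Rightarrow> pt set \<Rightarrow> (pt \<Rightarrow> real^5) \<Rightarrow> (pt \<Rightarrow> real) \<Rightarrow> (pt \<Rightarrow> real^5) \<Rightarrow> (pt \<Rightarrow> real^5) \<Rightarrow> bool" where
  "twistor_nondeg L0 D F lam N1 N2 \<longleftrightarrow>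
     (\<forall>eps. \<forall>p\<in>D. \<forall>a b::real.
        a *\<^sub>R twistor_cov L0 F lam N1 N2 eps 1 p + b *\<^sub>R twistor_cov L0 F lam N1 N2 eps 2 p = 0
        \<longrightarrow> a = 0 \<and> b = 0)"

definition Dl :: "(bool \<Rightarrow> pt \<Rightarrow> real) \<Rightarrow> (bool \<Rightarrow> pt \<Rightarrow> real) \<Rightarrow> (bool \<Rightarrow> pt \<Rightarrow> real) \<Rightarrow> (bool \<Rightarrow> pt \<Rightarrow> real)
    \<Rightarrow> bool \<Rightarrow> pt \<Rightarrow> real" where
  "Dl W X Y Z s p = W (\<not> s) p * X s p + Y s p * Z (\<not> s) p"

definition Acoef :: "(bool \<Rightarrow> pt \<Rightarrow> real) \<Rightarrow> (bool \<Rightarrow> pt \<Rightarrow> real) \<Rightarrow> (bool \<Rightarrow> pt \<Rightarrow> real) \<Rightarrow> (bool \<Rightarrow> pt \<Rightarrow> real)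
    \<Rightarrow> bool \<Rightarrow> pt \<Rightarrow> real" where
  "Acoef W X Y Z s p = - sg s / Dl W X Y Z s p *
     (- X s p * (pv (Y s) p - sg s * pu (X s) p) + Z (\<not> s) p * (pv (W (\<not> s)) p + sg s * pu (Z (\<not> s)) p))"

text \<open>Bcoef .. t = B_t (built with Delta_{-t}).\<close>
definition Bcoef :: "(bool \<Rightarrow> pt \<Rightarrow> real) \<Rightarrow> (bool \<Rightarrow> pt \<Rightarrow> real) \<Rightarrow> (bool \<Rightarrow> pt \<Rightarrow> real) \<Rightarrow> (bool \<Rightarrow> pt \<Rightarrow> real)
    \<Rightarrow> bool \<Rightarrow> pt \<Rightarrow> real" where
  "Bcoef W X Y Z t p = - 1 / Dl W X Y Z (\<not> t) p *
     (Y (\<not> t) p * (pv (Y (\<not> t)) p - sg (\<not> t) * pu (X (\<not> t)) p)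
      + W t p * (pv (W t) p + sg (\<not> t) * pu (Z t) p))"

end

theory Submission
  imports Defs "HOL-Complex_Analysis.Riemann_Mapping"
begin

text \<open>Write T1, T2, N1, N2 and the position vector F as the rows of a 5x5 matrix function Psi. The structure equations of an
  immersed surface say that Psi solves a linear system Psi_u = M Psi, Psi_v = N Psi whose coefficients are the functions
  alpha, beta, mu, the first derivatives of lambda and f = L0 exp (2 lambda). Its integrability condition consists of the
  Codazzi, Gauss and Ricci equations. For each of the two signs, two combinations of the Codazzi equations form a linear
  system for phi and psi with determinant Delta, and Cramer's rule gives A and B; nondegeneracy of the twistor
  lifts says exactly that the two determinants do not vanish. Conversely, the hypotheses on f are the Gauss and Ricci equations together
  with f_u = 2 lambda_u f and f_v = 2 lambda_v f, so the system is integrable. On a simply connected domain it is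
  solved after pulling it back by a Riemann map to a convex domain, where one integrates along rays. The Gram matrix of the rows satisfies
  a linear system with unique solutions, which makes F an immersion with the prescribed data; uniqueness of solutions of the
  system for Psi gives rigidity.\<close>

section \<open>Integrable linear systems on simply connected plane domains\<close>

text \<open>Picard iteration along rays controls a solution only in the radial direction, so the
  crux of integrability is the derivative across rays. Differentiating the solution with respect to
  the ray would presuppose the regularity to be proved; instead the expected value of that
  derivative is integrated, and the discrepancy is shown to vanish. A holomorphic chart suits this
  method: its differential is multiplication by a complex number and its derivatives are again
  holomorphic, so pulled-back coefficients stay differentiable. The scalar hypotheses are organised
  by sign. Each sign gives one expression for f; the mean of the two is the Gauss equation and half
  their difference the Ricci equation, while the Codazzi equations are built into the definition of
  A and B. Connectedness of D is used for uniqueness of solutions and for the constant sign of the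
  determinant of the frame.\<close>

definition form :: "(complex \<Rightarrow> 'b::real_vector) \<Rightarrow> (complex \<Rightarrow> 'b) \<Rightarrow> complex \<Rightarrow> complex \<Rightarrow> 'b" where
  "form P Q z w = Re w *\<^sub>R P z + Im w *\<^sub>R Q z"

lemma norm_form_le:
  fixes P :: "complex \<Rightarrow> 'b::real_normed_vector"
  assumes "norm (P z) \<le> K" "norm (Q z) \<le> K"
  shows "norm (form P Q z w) \<le> 2 * K * cmod w"
proof -
  have "norm (form P Q z w) \<le> \<bar>Re w\<bar> * norm (P z) + \<bar>Im w\<bar> * norm (Q z)"
    unfolding form_def by (metis norm_triangle_ineq norm_scaleR)
  also have "\<dots> \<le> cmod w * K + cmod w * K"
    using assms abs_Re_le_cmod abs_Im_le_cmod by (intro add_mono mult_mono) auto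
  finally show ?thesis by (simp add: algebra_simps)
qed

lemma continuous_on_form [continuous_intros]:
  fixes P :: "complex \<Rightarrow> 'b::real_normed_vector"
  assumes "continuous_on U P" "continuous_on U Q" "continuous_on T g" "continuous_on T h" "g ` T \<subseteq> U"
  shows "continuous_on T (\<lambda>x. form P Q (g x) (h x))"
  unfolding form_def
  by (intro continuous_intros assms continuous_on_compose2[OF assms(1) assms(3)]
      continuous_on_compose2[OF assms(2) assms(3)])

text \<open>\<open>form P Q z w\<close> is the 1-form \<omega> = P du + Q dv at z on the tangent
  vector w. Here its coefficients are differentiated in the direction h while w stays fixed;
  \<open>Pu\<close>, \<open>Pv\<close>, \<open>Qu\<close>, \<open>Qv\<close> stand for the partial
  derivatives. Nothing is antisymmetrised, so this is not the exterior derivative.\<close>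

definition dform ::
  "(complex \<Rightarrow> 'b::real_vector) \<Rightarrow> (complex \<Rightarrow> 'b) \<Rightarrow> (complex \<Rightarrow> 'b) \<Rightarrow> (complex \<Rightarrow> 'b) \<Rightarrow>
     complex \<Rightarrow> complex \<Rightarrow> complex \<Rightarrow> 'b" where
  "dform Pu Pv Qu Qv z h w = Re w *\<^sub>R form Pu Pv z h + Im w *\<^sub>R form Qu Qv z h"

text \<open>For a solution x with value \<xi> at z, the two sides are the derivative of \<omega>(w)
  x along h and that of \<omega>(h) x along w. Their difference is alternating in h and w, so the
  hypothesis, which is the case of the two coordinate vectors, suffices. The version for arbitrary
  vectors is what survives reparametrisation by rays and by holomorphic maps.\<close>

lemma curvature:
  fixes P Q :: "complex \<Rightarrow> 'a::real_normed_vector \<Rightarrow>\<^sub>L 'a"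
  assumes "Pv z + (P z o\<^sub>L Q z) = Qu z + (Q z o\<^sub>L P z)"
  shows "dform Pu Pv Qu Qv z h w \<xi> + form P Q z w (form P Q z h \<xi>) =
    dform Pu Pv Qu Qv z w h \<xi> + form P Q z h (form P Q z w \<xi>)"
proof -
  have "blinfun_apply (Pv z + (P z o\<^sub>L Q z)) \<xi> = blinfun_apply (Qu z + (Q z o\<^sub>L P z)) \<xi>"
    using assms by simp
  then have eq: "Pv z \<xi> = Qu z \<xi> + Q z (P z \<xi>) - P z (Q z \<xi>)"
    by (simp add: blinfun.add_left algebra_simps)
  show ?thesis
    unfolding dform_def form_def blinfun.add_left blinfun.scaleR_left blinfun.add_right blinfun.scaleR_right eq
    by (simp add: algebra_simps)
qed

lemma has_derivative_form:
  fixes P Q :: "complex \<Rightarrow> 'b::real_normed_vector"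
  assumes "(P has_derivative form Pu Pv (g t)) (at (g t))" "(Q has_derivative form Qu Qv (g t)) (at (g t))"
    and g: "(g has_derivative g') (at t within T)" and h: "(h has_derivative h') (at t within T)"
  shows "((\<lambda>t. form P Q (g t) (h t)) has_derivative
    (\<lambda>v. dform Pu Pv Qu Qv (g t) (g' v) (h t) + form P Q (g t) (h' v))) (at t within T)"
proof -
  have P: "((\<lambda>t. P (g t)) has_derivative (\<lambda>v. form Pu Pv (g t) (g' v))) (at t within T)"
    and Q: "((\<lambda>t. Q (g t)) has_derivative (\<lambda>v. form Qu Qv (g t) (g' v))) (at t within T)"
    by (rule has_derivative_compose[OF g] assms)+
  have R: "((\<lambda>t. Re (h t)) has_derivative (\<lambda>v. Re (h' v))) (at t within T)"
    and I: "((\<lambda>t. Im (h t)) has_derivative (\<lambda>v. Im (h' v))) (at t within T)"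
    using bounded_linear.has_derivative[OF bounded_linear_Re h]
      bounded_linear.has_derivative[OF bounded_linear_Im h] by auto
  show ?thesis
    unfolding form_def[of P Q] dform_def
    by (rule has_derivative_eq_rhs[OF has_derivative_add[OF has_derivative_scaleR[OF R P] has_derivative_scaleR[OF I Q]]])
       (simp add: fun_eq_iff algebra_simps)
qed

lemma has_vector_derivative_form:
  fixes P Q :: "complex \<Rightarrow> 'b::real_normed_vector"
  assumes "(P has_derivative form Pu Pv (g t)) (at (g t))" "(Q has_derivative form Qu Qv (g t)) (at (g t))"
    and "(g has_vector_derivative g') (at t within T)" "(h has_vector_derivative h') (at t within T)"
  shows "((\<lambda>t. form P Q (g t) (h t)) has_vector_derivative
    dform Pu Pv Qu Qv (g t) g' (h t) + form P Q (g t) h') (at t within T)"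
  unfolding has_vector_derivative_def
  by (rule has_derivative_eq_rhs[OF has_derivative_form[OF assms[unfolded has_vector_derivative_def]]])
     (simp add: fun_eq_iff dform_def form_def algebra_simps)

lemma continuous_on_dform:
  fixes Pu :: "complex \<Rightarrow> 'b::real_normed_vector"
  assumes "continuous_on U Pu" "continuous_on U Pv" "continuous_on U Qu" "continuous_on U Qv"
    and "continuous_on T g" "continuous_on T h" "continuous_on T k" "g ` T \<subseteq> U"
  shows "continuous_on T (\<lambda>x. dform Pu Pv Qu Qv (g x) (h x) (k x))"
  unfolding dform_def
  by (intro continuous_intros continuous_on_form[OF assms(1,2)] continuous_on_form[OF assms(3,4)] assms)

text \<open>Each integration of t ^ n contributes a factor 1 / (n + 1); iterated, these factors
  become the n! in the bound for the Picard terms.\<close>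

lemma norm_integral_power_bound:
  fixes f :: "real \<Rightarrow> 'a::banach"
  assumes "continuous_on {0..1} f" "\<And>t. t \<in> {0..1} \<Longrightarrow> norm (f t) \<le> B * t ^ n"
  shows "norm (integral {0..1} f) \<le> B / (Suc n)"
proof -
  have i: "((\<lambda>t. B * t ^ n) has_integral B / Suc n) {0..1}"
  proof -
    have "((\<lambda>t. B * t ^ n) has_integral (B * 1 ^ Suc n / Suc n - B * 0 ^ Suc n / Suc n)) {0..1::real}"
      by (rule fundamental_theorem_of_calculus)
         (auto simp: has_real_derivative_iff_has_vector_derivative[symmetric] simp del: of_nat_Suc power_Suc
               intro!: derivative_eq_intros)
    then show ?thesis by simp
  qed
  have "norm (integral {0..1} f) \<le> integral {0..1} (\<lambda>t. B * t ^ n)"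
    using assms i by (intro integral_norm_bound_integral) (auto intro: integrable_continuous_real)
  then show ?thesis unfolding integral_unique[OF i] .
qed

text \<open>A Gronwall argument for a whole family: \<open>d' t s\<close> may depend on
  \<open>d t \<sigma>\<close> for all \<sigma> in S, as happens when the equation contains an
  integral over \<sigma>. By induction the bound B improves to B (K t)^n / n!, which tends to
  0.\<close>

lemma gronwall_zero:
  fixes d d' :: "real \<Rightarrow> 'i \<Rightarrow> 'a::real_normed_vector"
  assumes d: "\<And>s t. s \<in> S \<Longrightarrow> t \<in> {0..1} \<Longrightarrow>
      ((\<lambda>t. d t s) has_vector_derivative d' t s) (at t within {0..1})"
    and d0: "\<And>s. s \<in> S \<Longrightarrow> d 0 s = 0"
    and bnd: "\<And>s t. s \<in> S \<Longrightarrow> t \<in> {0..1} \<Longrightarrow> norm (d t s) \<le> B"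
    and d': "\<And>t s M. s \<in> S \<Longrightarrow> t \<in> {0..1} \<Longrightarrow> (\<And>\<sigma>. \<sigma> \<in> S \<Longrightarrow> norm (d t \<sigma>) \<le> M) \<Longrightarrow> norm (d' t s) \<le> K * M"
    and "s \<in> S" "t \<in> {0..1}"
  shows "d t s = 0"
proof -
  have *: "norm (d t s) \<le> B * (K * t) ^ n / fact n" if "s \<in> S" "t \<in> {0..1}" for n s t
    using that
  proof (induction n arbitrary: s t)
    case 0
    then show ?case using bnd by simp
  next
    case (Suc n)
    show ?case
    proof (cases "t = 0")
      case True
      then show ?thesis using Suc d0 by simp
    next
      case False
      then have t: "0 < t" "t \<le> 1" using Suc by auto
      define \<phi> where "\<phi> t = B * (K * t) ^ Suc n / fact (Suc n)" for t
      have "norm (d t s - d 0 s) \<le> \<phi> t - \<phi> 0"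
      proof (rule differentiable_bound_general[OF t(1)])
        show "continuous_on {0..t} \<phi>" unfolding \<phi>_def by (intro continuous_intros) auto
        have "continuous_on {0..1} (\<lambda>t. d t s)"
          using d[OF Suc(2)] has_vector_derivative_continuous by (fastforce simp: continuous_on_eq_continuous_within)
        then show "continuous_on {0..t} (\<lambda>t. d t s)" using t by (auto intro: continuous_on_subset)
        fix \<tau> assume \<tau>: "0 < \<tau>" "\<tau> < t"
        have "(\<phi> has_real_derivative K * (B * (K * \<tau>) ^ n / fact n)) (at \<tau>)"
          unfolding \<phi>_def by (rule derivative_eq_intros refl | simp)+
        then show "(\<phi> has_vector_derivative K * (B * (K * \<tau>) ^ n / fact n)) (at \<tau>)"
          by (simp add: has_real_derivative_iff_has_vector_derivative)
        have "((\<lambda>t. d t s) has_vector_derivative d' \<tau> s) (at \<tau> within {0..1})" using d Suc \<tau> t by simp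
        moreover have "at \<tau> within {0..1} = at \<tau>" using \<tau> t by (intro at_within_interior) (simp add: interior_atLeastAtMost_real)
        ultimately show "((\<lambda>t. d t s) has_vector_derivative d' \<tau> s) (at \<tau>)" by simp
        show "norm (d' \<tau> s) \<le> K * (B * (K * \<tau>) ^ n / fact n)"
          by (rule d') (use Suc \<tau> t in auto)
      qed
      then show ?thesis using d0 Suc by (simp add: \<phi>_def)
    qed
  qed
  have "(\<lambda>n. B * ((K * t) ^ n / fact n)) \<longlonglongrightarrow> B * 0"
    by (intro tendsto_intros summable_LIMSEQ_zero) (use summable_exp[of "K*t"] in \<open>simp add: field_simps\<close>)
  then have "norm (d t s) \<le> 0"
    using * assms(5,6) by (intro LIMSEQ_le_const) auto
  then show ?thesis by simp
qed

section \<open>Picard series along the rays of a convex domain\<close>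

context
  fixes U :: "complex set" and P Q :: "complex \<Rightarrow> 'a::banach \<Rightarrow>\<^sub>L 'a" and x0 :: 'a
  assumes U: "open U" "convex U" "0 \<in> U"
    and contPQ: "continuous_on U P" "continuous_on U Q"
begin

lemma scale_mem: "z \<in> U \<Longrightarrow> t \<in> {0..1} \<Longrightarrow> of_real t * z \<in> U"
  using U(2,3) convexD_alt[of U 0 z t] by (simp add: scaleR_conv_of_real)

text \<open>The summands of the Picard series for the equation along the ray from 0 to z. Every ray
  is rescaled to the unit interval, so z is only a parameter and continuity in z follows from that
  of parametric integrals.\<close>

primrec picard_term :: "nat \<Rightarrow> complex \<Rightarrow> 'a" where
  "picard_term 0 z = x0"
| "picard_term (Suc n) z = integral {0..1} (\<lambda>t. form P Q (of_real t * z) z (picard_term n (of_real t * z)))"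

lemma continuous_on_picard_term: "continuous_on U (picard_term n)"
proof (induction n)
  case (Suc n)
  have "continuous_on (U \<times> cbox 0 1) (\<lambda>(z, t). form P Q (of_real t * z) z (picard_term n (of_real t * z)))"
    unfolding split_beta
    by (intro blinfun.continuous_on continuous_on_form[OF contPQ] continuous_on_compose2[OF Suc] continuous_intros)
       (auto intro: scale_mem)
  from integral_continuous_on_param[OF this] show ?case by simp
qed auto

lemma continuous_on_radial:
  assumes "continuous_on U g" "z \<in> U"
  shows "continuous_on {0..1} (\<lambda>t. form P Q (of_real t * z) z (g (of_real t * z)))"
  by (intro blinfun.continuous_on continuous_on_form[OF contPQ] continuous_on_compose2[OF assms(1)] continuous_intros)
     (use assms scale_mem in auto)

text \<open>The operator norm of \<omega>(z) supplies the factor 2 K |z|. At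
  \<open>of_real t * z\<close> the inductive bound carries a factor t ^ n, which integrates to the
  missing 1 / (n + 1).\<close>

lemma picard_term_bound:
  assumes C: "C \<subseteq> U" "\<And>z t. z \<in> C \<Longrightarrow> t \<in> {0..1} \<Longrightarrow> of_real t * z \<in> C"
    and K: "\<And>z. z \<in> C \<Longrightarrow> norm (P z) \<le> K \<and> norm (Q z) \<le> K" and z: "z \<in> C"
  shows "norm (picard_term n z) \<le> norm x0 * (2 * K * cmod z) ^ n / fact n"
  using z
proof (induction n arbitrary: z)
  case (Suc n)
  have "norm (picard_term (Suc n) z) \<le> (norm x0 * (2 * K * cmod z) ^ Suc n / fact n) / Suc n"
    unfolding picard_term.simps
  proof (rule norm_integral_power_bound)
    show "continuous_on {0..1} (\<lambda>t. form P Q (of_real t * z) z (picard_term n (of_real t * z)))"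
      using continuous_on_radial continuous_on_picard_term Suc C by auto
    fix t :: real assume t: "t \<in> {0..1}"
    then have tz: "of_real t * z \<in> C" using C Suc by auto
    have "norm (form P Q (of_real t * z) z (picard_term n (of_real t * z)))
       \<le> norm (form P Q (of_real t * z) z) * norm (picard_term n (of_real t * z))"
      by (rule norm_blinfun)
    also have "\<dots> \<le> (2 * K * cmod z) * (norm x0 * (2 * K * cmod (of_real t * z)) ^ n / fact n)"
      using K[OF tz] Suc.IH[OF tz] order_trans[OF norm_ge_zero, of "P (of_real t * z)" K] by (intro mult_mono norm_form_le) auto
    also have "\<dots> = (norm x0 * (2 * K * cmod z) ^ Suc n / fact n) * t ^ n"
      using t by (simp add: norm_mult power_mult_distrib field_simps)
    finally show "norm (form P Q (of_real t * z) z (picard_term n (of_real t * z)))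
       \<le> (norm x0 * (2 * K * cmod z) ^ Suc n / fact n) * t ^ n" .
  qed
  then show ?case by (simp add: field_simps)
qed auto

text \<open>\<open>picard_term\<close> at z reads values on the whole segment from 0 to z, so
  locally uniform estimates need a compact set closed under shrinking towards 0. The convex hull of
  0 and a small ball is one.\<close>

lemma compact_star_nbhd:
  assumes "z \<in> U"
  obtains C where "compact C" "C \<subseteq> U" "\<And>z t. z \<in> C \<Longrightarrow> t \<in> {0..1} \<Longrightarrow> of_real t * z \<in> C" "z \<in> interior C"
proof -
  obtain r where r: "r > 0" "cball z r \<subseteq> U" using U(1) assms open_contains_cball by blast
  define C where "C = convex hull (insert 0 (cball z r))"
  have "C \<subseteq> U" unfolding C_def using r U by (intro hull_minimal) auto
  moreover have "compact C" unfolding C_def by (intro compact_convex_hull compact_insert compact_cball)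
  moreover have "of_real t * w \<in> C" if "w \<in> C" "t \<in> {0..1}" for w and t :: real
  proof -
    have "convex C" "0 \<in> C" by (auto simp: C_def convex_convex_hull hull_inc)
    from convexD_alt[OF this(1,2) \<open>w \<in> C\<close>] that show ?thesis by (simp add: scaleR_conv_of_real)
  qed
  moreover have "z \<in> interior C"
  proof -
    have "ball z r \<subseteq> C" unfolding C_def using ball_subset_cball hull_subset by fastforce
    then show ?thesis using r(1) by (auto simp: mem_interior)
  qed
  ultimately show thesis using that by blast
qed

definition radial_sol :: "complex \<Rightarrow> 'a" where
  "radial_sol z = (\<Sum>n. picard_term n z)"

lemma uniform_limit_picard:
  assumes C: "compact C" "C \<subseteq> U" "\<And>z t. z \<in> C \<Longrightarrow> t \<in> {0..1} \<Longrightarrow> of_real t * z \<in> C"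
  shows "uniform_limit C (\<lambda>n z. \<Sum>i<n. picard_term i z) radial_sol sequentially"
proof -
  \<comment> \<open>Bounding the triple gives one K for P, Q and |z| alike, so the series is
    dominated by the exponential series at 2 K K.\<close>
  have "bounded ((\<lambda>z. (P z, Q z, z)) ` C)"
    using C contPQ by (intro compact_imp_bounded compact_continuous_image continuous_intros) (auto intro: continuous_on_subset)
  then obtain K where K: "\<And>z. z \<in> C \<Longrightarrow> norm (P z, Q z, z) \<le> K"
    unfolding bounded_iff by auto
  have *: "norm (P z) \<le> K \<and> norm (Q z) \<le> K" "cmod z \<le> K" if "z \<in> C" for z
    using K[OF that] norm_fst_le[of "P z" "(Q z, z)"] norm_snd_le[of "(Q z, z)" "P z"]
      norm_fst_le[of "Q z" z] norm_snd_le[of z "Q z"] by linarith+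
  show ?thesis
    unfolding radial_sol_def
  proof (rule Weierstrass_m_test)
    fix n z assume z: "z \<in> C"
    then have "0 \<le> K" using *(2) norm_ge_zero order_trans by blast
    have "norm (picard_term n z) \<le> norm x0 * (2 * K * cmod z) ^ n / fact n"
      by (rule picard_term_bound[OF C(2,3) *(1) z]) auto
    also have "\<dots> \<le> norm x0 * (2 * K * K) ^ n / fact n"
      using z * \<open>0 \<le> K\<close> by (intro divide_right_mono mult_left_mono power_mono) auto
    finally show "norm (picard_term n z) \<le> norm x0 * ((2 * K * K) ^ n / fact n)" by simp
  next
    show "summable (\<lambda>n. norm x0 * ((2 * K * K) ^ n / fact n))"
      using summable_exp[of "2*K*K"] by (intro summable_mult) (simp add: field_simps)
  qed
qed

lemma continuous_on_radial_sol: "continuous_on U radial_sol"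
proof (rule continuous_at_imp_continuous_on, rule ballI)
  fix z assume "z \<in> U"
  then obtain C where C: "compact C" "C \<subseteq> U" "\<And>z t. z \<in> C \<Longrightarrow> t \<in> {0..1} \<Longrightarrow> of_real t * z \<in> C" "z \<in> interior C"
    using compact_star_nbhd by metis
  have "continuous_on C radial_sol"
    by (rule uniform_limit_theorem[OF _ uniform_limit_picard[OF C(1-3)]])
       (auto intro!: always_eventually continuous_intros intro: continuous_on_subset[OF continuous_on_picard_term C(2)])
  then show "isCont radial_sol z" using C(4) continuous_on_interior by blast
qed

text \<open>The next partial sum is x0 plus the integral of \<omega> applied to the present one;
  uniform convergence on a compact star-shaped set carries this recursion to the limit.\<close>

lemma radial_sol_integral:
  assumes "z \<in> U"
  shows "radial_sol z = x0 + integral {0..1} (\<lambda>t. form P Q (of_real t * z) z (radial_sol (of_real t * z)))"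
proof -
  obtain C where C: "compact C" "C \<subseteq> U" "\<And>z t. z \<in> C \<Longrightarrow> t \<in> {0..1} \<Longrightarrow> of_real t * z \<in> C" "z \<in> interior C"
    using compact_star_nbhd[OF assms] by metis
  have zC: "z \<in> C" using C(4) interior_subset by auto
  let ?I = "\<lambda>g. integral {0..1} (\<lambda>t. form P Q (of_real t * z) z (g (of_real t * z)))"
  have lim: "(\<lambda>n. \<Sum>i<n. picard_term i z) \<longlonglongrightarrow> radial_sol z"
    by (rule tendsto_uniform_limitI[OF uniform_limit_picard[OF C(1-3)] zC])
  have step: "(\<Sum>i<Suc n. picard_term i z) = x0 + ?I (\<lambda>w. \<Sum>i<n. picard_term i w)" for n
  proof -
    have "(\<Sum>i<Suc n. picard_term i z) = x0 + (\<Sum>i<n. ?I (picard_term i))"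
      by (subst sum.lessThan_Suc_shift) simp
    also have "(\<Sum>i<n. ?I (picard_term i)) = ?I (\<lambda>w. \<Sum>i<n. picard_term i w)"
      by (subst integral_sum[symmetric])
         (auto simp: blinfun.sum_right intro!: integrable_continuous_real continuous_on_radial continuous_on_picard_term assms)
    finally show ?thesis .
  qed
  have b: "bounded ((\<lambda>t. form P Q (of_real t * z) z) ` {0..1})"
    using scale_mem[OF assms]
    by (intro compact_imp_bounded compact_continuous_image continuous_on_form[OF contPQ] continuous_intros) auto
  have ul: "uniform_limit (cbox 0 1) (\<lambda>n t. form P Q (of_real t * z) z (\<Sum>i<n. picard_term i (of_real t * z)))
        (\<lambda>t. form P Q (of_real t * z) z (radial_sol (of_real t * z))) sequentially"
  proof (rule bounded_bilinear.bounded_uniform_limit[OF bounded_bilinear_blinfun_apply])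
    show "uniform_limit (cbox 0 1) (\<lambda>n t. form P Q (of_real t * z) z) (\<lambda>t. form P Q (of_real t * z) z) sequentially"
      by (simp add: uniform_limit_const)
    show "uniform_limit (cbox 0 1) (\<lambda>n t. \<Sum>i<n. picard_term i (of_real t * z)) (\<lambda>t. radial_sol (of_real t * z)) sequentially"
      by (rule uniform_limit_compose'[OF uniform_limit_picard[OF C(1-3)]]) (use C zC in auto)
    show "bounded ((\<lambda>t. form P Q (of_real t * z) z) ` cbox 0 1)" using b by simp
    show "bounded ((\<lambda>t. radial_sol (of_real t * z)) ` cbox 0 1)"
      using scale_mem[OF assms]
      by (intro compact_imp_bounded compact_continuous_image continuous_intros
          continuous_on_compose2[OF continuous_on_radial_sol]) auto
  qed
  have "(\<lambda>n. ?I (\<lambda>w. \<Sum>i<n. picard_term i w)) \<longlonglongrightarrow> ?I radial_sol"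
  proof (rule uniform_limit_integral_cbox[OF ul])
    show "continuous_on (cbox 0 1) (\<lambda>t. form P Q (of_real t * z) z (\<Sum>i<n. picard_term i (of_real t * z)))" for n
      unfolding cbox_interval
      by (intro continuous_on_radial continuous_on_sum continuous_on_picard_term assms)
  next
    fix I J
    assume I: "\<And>n. ((\<lambda>t. form P Q (of_real t * z) z (\<Sum>i<n. picard_term i (of_real t * z))) has_integral I n) (cbox 0 1)"
      and J: "((\<lambda>t. form P Q (of_real t * z) z (radial_sol (of_real t * z))) has_integral J) (cbox 0 1)"
      and "(I \<longlongrightarrow> J) sequentially"
    moreover have "I = (\<lambda>n. ?I (\<lambda>w. \<Sum>i<n. picard_term i w))" "J = ?I radial_sol"
      using integral_unique[OF I] integral_unique[OF J] by (simp_all add: fun_eq_iff)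
    ultimately show ?thesis by simp
  qed simp
  then have "(\<lambda>n. x0 + ?I (\<lambda>w. \<Sum>i<n. picard_term i w)) \<longlonglongrightarrow> x0 + ?I radial_sol"
    by (intro tendsto_intros)
  moreover have "(\<lambda>n. \<Sum>i<Suc n. picard_term i z) \<longlonglongrightarrow> radial_sol z"
    using lim by (rule LIMSEQ_Suc)
  ultimately show ?thesis using step LIMSEQ_unique by simp
qed

lemma radial_sol_0: "radial_sol 0 = x0"
  using radial_sol_integral[OF U(3)] by (simp add: form_def)

text \<open>The integral equation at the point t z runs over the ray to t z. Replacing the parameter
  \<tau> by t \<tau> makes it an integral from 0 to t along the ray to z; the factor t is absorbed
  because the form is linear in the tangent vector.\<close>

lemma radial_sol_derivative:
  assumes "z \<in> U" "t \<in> {0..1}"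
  shows "((\<lambda>t. radial_sol (of_real t * z)) has_vector_derivative
            form P Q (of_real t * z) z (radial_sol (of_real t * z))) (at t within {0..1})"
proof -
  let ?g = "\<lambda>t. form P Q (of_real t * z) z (radial_sol (of_real t * z))"
  have cont: "continuous_on {0..1} ?g"
    by (rule continuous_on_radial[OF continuous_on_radial_sol assms(1)])
  have eq: "radial_sol (of_real t * z) = x0 + integral {0..t} ?g" if t: "t \<in> {0..1}" for t
  proof (cases "t = 0")
    case False
    then have tp: "0 < t" "t \<le> 1" using t by auto
    have "(?g has_integral integral {0..t} ?g) {0..t}"
      using cont tp by (intro integrable_integral integrable_continuous_real) (auto intro: continuous_on_subset)
    from has_integral_affinity[OF this[unfolded box_real(2)[symmetric]], of t 0] False tp
    have "((\<lambda>\<tau>. ?g (t * \<tau>)) has_integral (1 / t) *\<^sub>R integral {0..t} ?g) {0..1}"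
      by (simp add: field_simps)
    then have "((\<lambda>\<tau>. t *\<^sub>R ?g (t * \<tau>)) has_integral integral {0..t} ?g) {0..1}"
      using tp by (auto dest: has_integral_cmul[of _ _ _ t])
    moreover have "t *\<^sub>R ?g (t * \<tau>) = form P Q (of_real \<tau> * (of_real t * z)) (of_real t * z)
        (radial_sol (of_real \<tau> * (of_real t * z)))" for \<tau>
      by (simp add: form_def blinfun.scaleR_left blinfun.add_left algebra_simps)
    ultimately show ?thesis
      using radial_sol_integral[OF scale_mem[OF assms(1) t]] by (simp add: integral_unique)
  qed (simp add: radial_sol_0)
  have "((\<lambda>t. x0 + integral {0..t} ?g) has_vector_derivative 0 + ?g t) (at t within {0..1})"
    by (intro has_vector_derivative_add has_vector_derivative_const
        integral_has_vector_derivative[OF cont assms(2)])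
  then show ?thesis
    using has_vector_derivative_transform[OF assms(2), of "\<lambda>t. radial_sol (of_real t * z)"] eq by simp
qed

section \<open>Flatness and differentiability across the rays\<close>

context
  fixes Pu Pv Qu Qv :: "complex \<Rightarrow> 'a \<Rightarrow>\<^sub>L 'a"
  assumes dP: "\<And>z. z \<in> U \<Longrightarrow> (P has_derivative form Pu Pv z) (at z)"
    and dQ: "\<And>z. z \<in> U \<Longrightarrow> (Q has_derivative form Qu Qv z) (at z)"
    and cont': "continuous_on U Pu" "continuous_on U Pv" "continuous_on U Qu" "continuous_on U Qv"
    and flat: "\<And>z. z \<in> U \<Longrightarrow> Pv z + (P z o\<^sub>L Q z) = Qu z + (Q z o\<^sub>L P z)"
begin

lemmas curvature_U = curvature[where P = P and Q = Q and Pu = Pu and Pv = Pv and Qu = Qu and Qv = Qv, OF flat]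
  and has_vector_derivative_form_U = has_vector_derivative_form[OF dP dQ]
  and continuous_on_dform_U = continuous_on_dform[OF cont']

text \<open>Compare y t s, the solution along the ray through z + s w, with yh t s, obtained from y t 0 by integrating the form along
  the segment from t z to t (z + s w). By flatness their difference d satisfies
  d_t = A d - (integral of A_s d from 0 to s) with d = 0 at t = 0, hence vanishes.\<close>

lemma radial_sol_segment:
  assumes z: "z \<in> U" "z + w \<in> U" and s: "s \<in> {0..1}"
  shows "radial_sol (z + of_real s * w) =
    radial_sol z + integral {0..s} (\<lambda>\<sigma>. form P Q (z + of_real \<sigma> * w) w (radial_sol (z + of_real \<sigma> * w)))"
proof -
  define \<zeta> where "\<zeta> s = z + of_real s * w" for s :: real
  define y where "y t s = radial_sol (of_real t * \<zeta> s)" for t s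
  \<comment> \<open>\<open>A\<close> is the form in the ray direction, \<open>A'\<close> its
    s-derivative, and \<open>C\<close> the form on the displacement t w of the point t \<zeta>(s).
    Thus \<open>V\<close> is the value that the s-derivative of y ought to have.\<close>
  define A where "A t s = form P Q (of_real t * \<zeta> s) (\<zeta> s)" for t s
  define A' where "A' t s = dform Pu Pv Qu Qv (of_real t * \<zeta> s) (of_real t * w) (\<zeta> s) + form P Q (of_real t * \<zeta> s) w" for t s
  define C where "C t s = form P Q (of_real t * \<zeta> s) (of_real t * w)" for t s
  define V where "V t s = C t s (y t s)" for t s
  \<comment> \<open>The t-derivative of \<open>V\<close>, written by flatness in the shape that
    differentiating A y in s would have if y had s-derivative V.\<close>
  define Vt where "Vt t s = A' t s (y t s) + A t s (V t s)" for t s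
  define yh where "yh t s = y t 0 + integral {0..s} (V t)" for t s
  have \<zeta>U: "\<zeta> s \<in> U" if "s \<in> {0..1}" for s
  proof -
    have "(1 - s) *\<^sub>R z + s *\<^sub>R (z + w) \<in> U"
      using U(2) z that by (intro convexD_alt) auto
    then show ?thesis by (simp add: \<zeta>_def scaleR_conv_of_real algebra_simps)
  qed
  have tU: "of_real t * \<zeta> s \<in> U" if "t \<in> {0..1}" "s \<in> {0..1}" for t s
    using scale_mem[OF \<zeta>U] that by auto
  have c\<zeta>: "continuous_on T (\<lambda>x. \<zeta> (f x))" if "continuous_on T f" for T :: "'t::topological_space set" and f
    unfolding \<zeta>_def by (intro continuous_intros that)
  let ?S = "{0..1::real} \<times> {0..1::real}"
  have cy: "continuous_on ?S (\<lambda>x. y (fst x) (snd x))"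
    unfolding y_def by (intro continuous_on_compose2[OF continuous_on_radial_sol] continuous_intros c\<zeta>) (use tU in auto)
  have cA: "continuous_on ?S (\<lambda>x. A (fst x) (snd x))"
    unfolding A_def by (intro continuous_on_form[OF contPQ] continuous_intros c\<zeta>) (use tU in auto)
  have cC: "continuous_on ?S (\<lambda>x. C (fst x) (snd x))"
    unfolding C_def by (intro continuous_on_form[OF contPQ] continuous_intros c\<zeta>) (use tU in auto)
  have cA': "continuous_on ?S (\<lambda>x. A' (fst x) (snd x))"
    unfolding A'_def
    by (intro continuous_on_add continuous_on_form[OF contPQ] continuous_on_dform_U continuous_intros c\<zeta>) (use tU in auto)
  have cV: "continuous_on ?S (\<lambda>x. V (fst x) (snd x))"
    unfolding V_def by (intro blinfun.continuous_on cC cy)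
  have cVt: "continuous_on ?S (\<lambda>x. Vt (fst x) (snd x))"
    unfolding Vt_def by (intro continuous_on_add blinfun.continuous_on cA' cA cy cV)
  have slice: "continuous_on {0..1} (\<lambda>s. f t s)" if "continuous_on ?S (\<lambda>x. f (fst x) (snd x))" "t \<in> {0..1}"
    for f :: "real \<Rightarrow> real \<Rightarrow> 'e::topological_space" and t
  proof -
    have "continuous_on {0..1} (\<lambda>s. (\<lambda>x. f (fst x) (snd x)) (t, s))"
      by (rule continuous_on_compose2[OF that(1)]) (use that(2) in \<open>auto intro!: continuous_intros\<close>)
    then show ?thesis by simp
  qed
  have dy: "((\<lambda>t. y t s) has_vector_derivative A t s (y t s)) (at t within {0..1})"
    if "t \<in> {0..1}" "s \<in> {0..1}" for t s
    using radial_sol_derivative[OF \<zeta>U] that by (simp add: y_def A_def)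
  have dA: "((\<lambda>s. A t s) has_vector_derivative A' t s) (at s within {0..1})"
    if "t \<in> {0..1}" "s \<in> {0..1}" for t s
  proof -
    have d\<zeta>: "(\<zeta> has_vector_derivative w) (at s within {0..1})"
      unfolding \<zeta>_def by (auto intro!: derivative_eq_intros)
    show ?thesis unfolding A_def A'_def
      using has_vector_derivative_form_U[where g = "\<lambda>s. of_real t * \<zeta> s" and h = \<zeta> and t = s,
          OF tU[OF that] tU[OF that] has_vector_derivative_mult_right[OF d\<zeta>] d\<zeta>] .
  qed
  have dV: "((\<lambda>t. V t s) has_vector_derivative Vt t s) (at t within {0..1})"
    if "t \<in> {0..1}" "s \<in> {0..1}" for t s
  proof -
    let ?p = "of_real t * \<zeta> s"
    have lin: "((\<lambda>t. of_real t * c) has_vector_derivative c) (at t within {0..1})" for c :: complex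
      using has_vector_derivative_mult_left[OF has_vector_derivative_of_real[OF DERIV_ident]] by simp
    have "((\<lambda>t. C t s) has_vector_derivative dform Pu Pv Qu Qv ?p (\<zeta> s) (of_real t * w) + form P Q ?p w) (at t within {0..1})"
      unfolding C_def
      using has_vector_derivative_form_U[where g = "\<lambda>t. of_real t * \<zeta> s" and h = "\<lambda>t. of_real t * w" and t = t,
          OF tU[OF that] tU[OF that] lin lin] .
    from bounded_bilinear.has_vector_derivative[OF bounded_bilinear_blinfun_apply this dy[OF that]]
    have "((\<lambda>t. V t s) has_vector_derivative
        C t s (A t s (y t s)) + (dform Pu Pv Qu Qv ?p (\<zeta> s) (of_real t * w) + form P Q ?p w) (y t s)) (at t within {0..1})"
      by (simp add: V_def)
    \<comment> \<open>\<open>curvature_U\<close> interchanges the ray direction and the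
      displacement. The remaining summand, the form on w, arises on one side from the factor t in t
      w and on the other from the s-derivative of \<zeta>.\<close>
    moreover have "C t s (A t s (y t s)) + (dform Pu Pv Qu Qv ?p (\<zeta> s) (of_real t * w) + form P Q ?p w) (y t s) = Vt t s"
    proof -
      have *: "a + (b + c) = (b' + c) + a'" if "b + a = b' + a'" for a a' b b' c :: 'a
        using that by (metis add.commute add.left_commute)
      show ?thesis
        unfolding Vt_def V_def A_def A'_def C_def blinfun.add_left
        by (rule *, rule curvature_U[OF tU[OF that]])
    qed
    ultimately show ?thesis by simp
  qed
  have iV: "V t integrable_on {0..s}" if "t \<in> {0..1}" "s \<in> {0..1}" for t s
    by (intro integrable_continuous_real continuous_on_subset[OF slice[OF cV that(1)]]) (use that in auto)
  have dyh_t: "((\<lambda>t. yh t s) has_vector_derivative A t 0 (y t 0) + integral {0..s} (Vt t)) (at t within {0..1})"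
    if t: "t \<in> {0..1}" "s \<in> {0..1}" for t s
  proof -
    have "((\<lambda>t. integral (cbox 0 s) (V t)) has_vector_derivative integral (cbox 0 s) (Vt t)) (at t within {0..1})"
    proof (rule leibniz_rule_vector_derivative)
      show "((\<lambda>x. V x \<sigma>) has_vector_derivative Vt x \<sigma>) (at x within {0..1})" if "x \<in> {0..1}" "\<sigma> \<in> cbox 0 s" for x \<sigma>
        using that t by (intro dV) auto
      show "V x integrable_on cbox 0 s" if "x \<in> {0..1}" for x
        using iV that t by simp
      have "continuous_on ({0..1} \<times> cbox 0 s) (\<lambda>x. Vt (fst x) (snd x))"
        by (rule continuous_on_subset[OF cVt]) (use t in auto)
      then show "continuous_on ({0..1} \<times> cbox 0 s) (\<lambda>(x, \<sigma>). Vt x \<sigma>)" by (simp add: split_beta)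
    qed (use t in auto)
    then show ?thesis unfolding yh_def using t
      by (intro has_vector_derivative_add dy) auto
  qed
  have dyh_s: "((\<lambda>s. yh t s) has_vector_derivative V t s) (at s within {0..1})" if "t \<in> {0..1}" "s \<in> {0..1}" for t s
  proof -
    have "((\<lambda>s. y t 0 + integral {0..s} (V t)) has_vector_derivative 0 + V t s) (at s within {0..1})"
      by (intro has_vector_derivative_add has_vector_derivative_const
          integral_has_vector_derivative slice[OF cV]) (use that in auto)
    then show ?thesis by (simp add: yh_def)
  qed
  have cyh: "continuous_on {0..1} (yh t)" if "t \<in> {0..1}" for t
    using dyh_s[OF that] has_vector_derivative_continuous
    by (fastforce simp: continuous_on_eq_continuous_within)
  \<comment> \<open>The fundamental theorem in s for A yh. Unlike y, the function yh has V as its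
    s-derivative by construction.\<close>
  have ftc: "integral {0..s} (\<lambda>\<sigma>. A' t \<sigma> (yh t \<sigma>) + A t \<sigma> (V t \<sigma>)) = A t s (yh t s) - A t 0 (y t 0)"
    if t: "t \<in> {0..1}" "s \<in> {0..1}" for t s
  proof -
    have "((\<lambda>\<sigma>. A' t \<sigma> (yh t \<sigma>) + A t \<sigma> (V t \<sigma>)) has_integral (A t s (yh t s) - A t 0 (yh t 0))) {0..s}"
    proof (rule fundamental_theorem_of_calculus)
      fix \<sigma> assume \<sigma>: "\<sigma> \<in> {0..s}"
      then have "\<sigma> \<in> {0..1}" using t by auto
      from bounded_bilinear.has_vector_derivative[OF bounded_bilinear_blinfun_apply dA[OF t(1) this] dyh_s[OF t(1) this]]
      have "((\<lambda>\<sigma>. A t \<sigma> (yh t \<sigma>)) has_vector_derivative A' t \<sigma> (yh t \<sigma>) + A t \<sigma> (V t \<sigma>)) (at \<sigma> within {0..1})"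
        by (simp add: add.commute)
      then show "((\<lambda>\<sigma>. A t \<sigma> (yh t \<sigma>)) has_vector_derivative A' t \<sigma> (yh t \<sigma>) + A t \<sigma> (V t \<sigma>)) (at \<sigma> within {0..s})"
        by (rule has_vector_derivative_within_subset) (use t in auto)
    qed (use t in auto)
    then show ?thesis by (simp add: integral_unique yh_def)
  qed
  have "bounded ((\<lambda>x. (A (fst x) (snd x), A' (fst x) (snd x))) ` ?S)"
    by (intro compact_imp_bounded compact_continuous_image continuous_on_Pair cA cA' compact_Times compact_Icc)
  then obtain K where K: "\<And>t s. t \<in> {0..1} \<Longrightarrow> s \<in> {0..1} \<Longrightarrow> norm (A t s, A' t s) \<le> K"
    by (fastforce simp: bounded_iff)
  have KA: "norm (A t s) \<le> K" "norm (A' t s) \<le> K" if "t \<in> {0..1}" "s \<in> {0..1}" for t s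
    using K[OF that] norm_fst_le[of "A t s" "A' t s"] norm_snd_le[of "A' t s" "A t s"] by auto
  have "bounded ((\<lambda>x. (y (fst x) (snd x), V (fst x) (snd x))) ` ?S)"
    by (intro compact_imp_bounded compact_continuous_image continuous_on_Pair cy cV compact_Times compact_Icc)
  then obtain B where B': "\<And>t s. t \<in> {0..1} \<Longrightarrow> s \<in> {0..1} \<Longrightarrow> norm (y t s, V t s) \<le> B"
    by (fastforce simp: bounded_iff)
  have B: "norm (y t s) \<le> B" "norm (V t s) \<le> B" if "t \<in> {0..1}" "s \<in> {0..1}" for t s
    using B'[OF that] norm_fst_le[of "y t s" "V t s"] norm_snd_le[of "V t s" "y t s"] by auto
  define d where "d t s = y t s - yh t s" for t s
  define d' where "d' t s = A t s (d t s) - integral {0..s} (\<lambda>\<sigma>. A' t \<sigma> (d t \<sigma>))" for t s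
  have cd: "continuous_on {0..1} (d t)" if "t \<in> {0..1}" for t
    unfolding d_def using slice[OF cy that] cyh[OF that] by (intro continuous_intros) auto
  have "d 1 s = 0"
  \<comment> \<open>The bound 3 B accounts for y t s, y t 0 and the integral of V; the rate 2 K for
    A and for the integral of A' over an interval of length at most 1.\<close>
  proof (rule gronwall_zero[of "{0..1}" d d' "3 * B" "2 * K"])
    fix t s :: real assume st: "s \<in> {0..1}" "t \<in> {0..1}"
    have sub: "{0..s} \<subseteq> {0..1}" using st by auto
    have i: "(\<lambda>\<sigma>. A' t \<sigma> (f \<sigma>)) integrable_on {0..s}" if "continuous_on {0..1} f" for f
      by (intro integrable_continuous_real continuous_on_subset[OF _ sub] blinfun.continuous_on slice[OF cA'] st that)
    have iAV: "(\<lambda>\<sigma>. A t \<sigma> (V t \<sigma>)) integrable_on {0..s}"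
      by (intro integrable_continuous_real continuous_on_subset[OF _ sub] blinfun.continuous_on slice[OF cA] slice[OF cV] st)
    \<comment> \<open>The summand A V of \<open>Vt\<close> cancels against that of
      \<open>ftc\<close>, so only A' applied to the discrepancy d remains under the
      integral.\<close>
    have "A t s (y t s) - (A t 0 (y t 0) + integral {0..s} (Vt t)) = d' t s"
    proof -
      have "integral {0..s} (Vt t) - integral {0..s} (\<lambda>\<sigma>. A' t \<sigma> (yh t \<sigma>) + A t \<sigma> (V t \<sigma>))
        = integral {0..s} (\<lambda>\<sigma>. A' t \<sigma> (d t \<sigma>))"
        unfolding Vt_def
        using i[OF slice[OF cy st(2)]] i[OF cyh[OF st(2)]] iAV
        by (subst integral_diff[symmetric]) (auto intro!: integrable_add simp: d_def blinfun.diff_right)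
      then show ?thesis unfolding ftc[OF st(2,1)] d'_def
        by (simp add: d_def blinfun.diff_right algebra_simps)
    qed
    then show "((\<lambda>t. d t s) has_vector_derivative d' t s) (at t within {0..1})"
      using has_vector_derivative_diff[OF dy[OF st(2,1)] dyh_t[OF st(2,1)]] by (simp add: d_def)
    fix M assume M: "\<And>\<sigma>. \<sigma> \<in> {0..1} \<Longrightarrow> norm (d t \<sigma>) \<le> M"
    have "0 \<le> M" using M[OF st(1)] norm_ge_zero order_trans by blast
    have "norm (integral {0..s} (\<lambda>\<sigma>. A' t \<sigma> (d t \<sigma>))) \<le> K * M * (s - 0)"
    proof (rule integral_bound)
      show "continuous_on {0..s} (\<lambda>\<sigma>. A' t \<sigma> (d t \<sigma>))"
        by (intro continuous_on_subset[OF _ sub] blinfun.continuous_on slice[OF cA'] cd st)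
      fix \<sigma> assume "\<sigma> \<in> {0..s}"
      then have "\<sigma> \<in> {0..1}" using sub by auto
      then show "norm (A' t \<sigma> (d t \<sigma>)) \<le> K * M"
        using KA(2)[OF st(2)] M order_trans[OF norm_blinfun] norm_ge_zero
        by (meson mult_mono order_trans)
    qed (use st in auto)
    also have "\<dots> \<le> K * M"
      using st \<open>0 \<le> M\<close> order_trans[OF norm_ge_zero KA(1)[OF st(2,1)]] by (simp add: mult_left_le)
    finally have 1: "norm (integral {0..s} (\<lambda>\<sigma>. A' t \<sigma> (d t \<sigma>))) \<le> K * M" .
    have 2: "norm (A t s (d t s)) \<le> K * M"
      using KA(1)[OF st(2,1)] M[OF st(1)] order_trans[OF norm_blinfun] norm_ge_zero
      by (meson mult_mono order_trans)
    show "norm (d' t s) \<le> 2 * K * M"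
      unfolding d'_def
      using norm_triangle_ineq4[of "A t s (d t s)" "integral {0..s} (\<lambda>\<sigma>. A' t \<sigma> (d t \<sigma>))"] 1 2 by linarith
  next
    fix s :: real assume "s \<in> {0..1}"
    have "V 0 = (\<lambda>\<sigma>. 0)" by (rule ext) (simp add: V_def C_def form_def)
    then show "d 0 s = 0" by (simp add: d_def yh_def y_def)
  next
    fix t s :: real assume st: "s \<in> {0..1}" "t \<in> {0..1}"
    have "norm (integral {0..s} (V t)) \<le> B * (s - 0)"
      by (rule integral_bound) (use st B(2) in \<open>auto intro: continuous_on_subset[OF slice[OF cV]]\<close>)
    also have "\<dots> \<le> B"
      using st order_trans[OF norm_ge_zero B(1)[OF st(2,1)]] by (simp add: mult_left_le)
    finally have "norm (integral {0..s} (V t)) \<le> B" .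
    then show "norm (d t s) \<le> 3 * B"
      unfolding d_def yh_def using B(1)[OF st(2,1)] B(1)[OF st(2), of 0]
        norm_triangle_ineq4[of "y t s" "y t 0 + integral {0..s} (V t)"] norm_triangle_ineq[of "y t 0" "integral {0..s} (V t)"]
      by simp
  qed (use s in auto)
  moreover have "V 1 = (\<lambda>\<sigma>. form P Q (z + of_real \<sigma> * w) w (radial_sol (z + of_real \<sigma> * w)))"
    by (rule ext) (simp add: V_def C_def y_def \<zeta>_def)
  ultimately show ?thesis
    by (simp add: d_def yh_def y_def \<zeta>_def)
qed

text \<open>By \<open>radial_sol_segment\<close> the increment is the integral of \<omega>(w) x over
  the segment to z + w. Freezing the integrand at z costs at most e |w|, one half from each of the
  coefficients P x and Q x, which are continuous at z.\<close>

lemma radial_sol_has_derivative: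
  assumes z: "z \<in> U"
  shows "(radial_sol has_derivative (\<lambda>w. form P Q z w (radial_sol z))) (at z)"
proof -
  define PX QX where "PX z = P z (radial_sol z)" and "QX z = Q z (radial_sol z)" for z
  have form_X: "form P Q z w (radial_sol z) = Re w *\<^sub>R PX z + Im w *\<^sub>R QX z" for z w
    by (simp add: form_def PX_def QX_def blinfun.add_left blinfun.scaleR_left)
  have "continuous_on U PX" "continuous_on U QX"
    unfolding PX_def QX_def by (intro blinfun.continuous_on contPQ continuous_on_radial_sol)+
  then have c: "isCont PX z" "isCont QX z"
    using U(1) z continuous_on_eq_continuous_at by blast+
  show ?thesis
    unfolding has_derivative_at_alt
  proof (intro conjI allI impI)
    show "bounded_linear (\<lambda>w. form P Q z w (radial_sol z))"
      unfolding form_X by (intro bounded_linear_intros bounded_linear_Re bounded_linear_Im)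
    fix e :: real assume e: "e > 0"
    obtain d1 where d1: "d1 > 0" "\<And>y. dist y z < d1 \<Longrightarrow> dist (PX y) (PX z) < e / 2"
      using c(1) e unfolding continuous_at_eps_delta by (metis half_gt_zero)
    obtain d2 where d2: "d2 > 0" "\<And>y. dist y z < d2 \<Longrightarrow> dist (QX y) (QX z) < e / 2"
      using c(2) e unfolding continuous_at_eps_delta by (metis half_gt_zero)
    obtain d3 where d3: "d3 > 0" "ball z d3 \<subseteq> U" using U(1) z open_contains_ball by blast
    show "\<exists>d>0. \<forall>y. cmod (y - z) < d \<longrightarrow>
        norm (radial_sol y - radial_sol z - form P Q z (y - z) (radial_sol z)) \<le> e * cmod (y - z)"
    proof (intro exI[of _ "min d1 (min d2 d3)"] conjI allI impI)
      fix y assume y: "cmod (y - z) < min d1 (min d2 d3)"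
      define w where "w = y - z"
      have near: "dist (z + of_real s * w) z < min d1 (min d2 d3)" if "s \<in> {0..1}" for s :: real
      proof -
        have "\<bar>s\<bar> * cmod w \<le> cmod w" using that by (simp add: mult_left_le_one_le)
        then show ?thesis using y by (simp add: dist_norm norm_mult w_def)
      qed
      have inU: "z + of_real s * w \<in> U" if "s \<in> {0..1}" for s :: real
        using near[OF that] d3(2) by (auto simp: dist_commute)
      let ?g = "\<lambda>\<sigma>. form P Q (z + of_real \<sigma> * w) w (radial_sol (z + of_real \<sigma> * w))"
      have cg: "continuous_on {0..1} ?g"
        by (intro blinfun.continuous_on continuous_on_form[OF contPQ]
            continuous_on_compose2[OF continuous_on_radial_sol] continuous_intros) (use inU in auto)
      have "radial_sol y - radial_sol z - form P Q z w (radial_sol z) = integral {0..1} ?g - form P Q z w (radial_sol z)"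
        using radial_sol_segment[OF z, of w 1] inU[of 1] by (simp add: w_def)
      also have "\<dots> = integral {0..1} (\<lambda>\<sigma>. ?g \<sigma> - form P Q z w (radial_sol z))"
        by (subst integral_diff) (use cg in \<open>auto intro: integrable_continuous_real\<close>)
      also have "norm \<dots> \<le> e * cmod w * (1 - 0)"
      proof (rule integral_bound)
        fix s :: real assume s: "s \<in> {0..1}"
        let ?p = "z + of_real s * w"
        have "?g s - form P Q z w (radial_sol z) = Re w *\<^sub>R (PX ?p - PX z) + Im w *\<^sub>R (QX ?p - QX z)"
          unfolding form_X by (simp add: algebra_simps)
        also have "norm \<dots> \<le> \<bar>Re w\<bar> * norm (PX ?p - PX z) + \<bar>Im w\<bar> * norm (QX ?p - QX z)"
          by (metis norm_triangle_ineq norm_scaleR)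
        also have "\<dots> \<le> cmod w * (e / 2) + cmod w * (e / 2)"
          using d1(2)[of ?p] d2(2)[of ?p] near[OF s] abs_Re_le_cmod abs_Im_le_cmod
          by (intro add_mono mult_mono) (auto simp: dist_norm intro: less_imp_le)
        finally show "norm (?g s - form P Q z w (radial_sol z)) \<le> e * cmod w" by (simp add: algebra_simps)
      qed (use cg in \<open>auto intro!: continuous_intros\<close>)
      finally show "norm (radial_sol y - radial_sol z - form P Q z (y - z) (radial_sol z)) \<le> e * cmod (y - z)"
        by (simp add: w_def)
    qed (use d1 d2 d3 in auto)
  qed
qed

end
end

section \<open>Passage to simply connected domains by a Riemann map\<close>

lemma simply_connected_convex_chart:
  fixes S :: "complex set"
  assumes "open S" "simply_connected S" "S \<noteq> {}"
  obtains U k h where "open U" "convex U" "0 \<in> U" "k holomorphic_on U" "h holomorphic_on S"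
    "k ` U \<subseteq> S" "h ` S \<subseteq> U" "\<And>z. z \<in> S \<Longrightarrow> k (h z) = z" "\<And>z. z \<in> U \<Longrightarrow> h (k z) = z"
proof -
  \<comment> \<open>The Riemann map onto the disc exists unless S is the whole plane, which is
    convex itself and takes the identity as chart.\<close>
  consider "S = UNIV" | f g where "f holomorphic_on S" "g holomorphic_on ball 0 1"
    "\<forall>z \<in> S. f z \<in> ball 0 1 \<and> g (f z) = z" "\<forall>z \<in> ball 0 1. g z \<in> S \<and> f (g z) = z"
    using assms Riemann_mapping_theorem[of S] by blast
  then show thesis
  proof cases
    case 1
    then show thesis using that[of UNIV "\<lambda>z. z" "\<lambda>z. z"] by (auto intro: holomorphic_intros)
  next
    case 2
    then show thesis by (intro that[of "ball 0 1" g f] assms(1)) auto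
  qed
qed

text \<open>The pull-back of a flat form is flat, so the convex case applies to it and its solutions
  are carried over to S. The base point is the image of the centre of the rays, where
  \<open>radial_sol\<close> takes its initial value; it is therefore chosen once, before x0.\<close>

theorem frobenius_complex:
  fixes P Q Pu Pv Qu Qv :: "complex \<Rightarrow> 'a::banach \<Rightarrow>\<^sub>L 'a"
  assumes S: "open S" "simply_connected S" "S \<noteq> {}"
    and dP: "\<And>z. z \<in> S \<Longrightarrow> (P has_derivative form Pu Pv z) (at z)"
    and dQ: "\<And>z. z \<in> S \<Longrightarrow> (Q has_derivative form Qu Qv z) (at z)"
    and cont': "continuous_on S Pu" "continuous_on S Pv" "continuous_on S Qu" "continuous_on S Qv"
    and flat: "\<And>z. z \<in> S \<Longrightarrow> Pv z + (P z o\<^sub>L Q z) = Qu z + (Q z o\<^sub>L P z)"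
  shows "\<exists>z0\<in>S. \<forall>x0. \<exists>x. x z0 = x0 \<and> (\<forall>z\<in>S. (x has_derivative (\<lambda>w. form P Q z w (x z))) (at z))"
proof -
  obtain U k h where U: "open U" "convex U" "0 \<in> U" and k: "k holomorphic_on U" and h: "h holomorphic_on S"
    and kh: "k ` U \<subseteq> S" "h ` S \<subseteq> U" "\<And>z. z \<in> S \<Longrightarrow> k (h z) = z" "\<And>z. z \<in> U \<Longrightarrow> h (k z) = z"
    using simply_connected_convex_chart[OF S] by metis
  have cP: "continuous_on S P" "continuous_on S Q"
    using dP dQ has_derivative_continuous by (blast intro: continuous_at_imp_continuous_on)+
  define k1 k2 where "k1 = deriv k" and "k2 = deriv k1"
  have k1h: "k1 holomorphic_on U" unfolding k1_def using k U by (intro holomorphic_deriv)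
  have k2h: "k2 holomorphic_on U" unfolding k2_def using k1h U by (intro holomorphic_deriv)
  have dk: "(k has_derivative (*) (k1 z)) (at z)" if "z \<in> U" for z
    using holomorphic_derivI[OF k U(1) that] by (simp add: k1_def has_field_derivative_def)
  have dk1: "(k1 has_derivative (*) (k2 z)) (at z)" if "z \<in> U" for z
    using holomorphic_derivI[OF k1h U(1) that] by (simp add: k2_def has_field_derivative_def)
  have ck: "continuous_on U k" "continuous_on U k1" "continuous_on U k2"
    using k k1h k2h holomorphic_on_imp_continuous_on by blast+
  let ?D = "dform Pu Pv Qu Qv"
  \<comment> \<open>\<open>G c\<close> is the coefficient of the pulled-back form in the direction
    c, used for c = 1 and c = \<i>; \<open>DG c v\<close> is its derivative in the direction
    v.\<close>
  define G where "G c z = form P Q (k z) (c * k1 z)" for c z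
  define DG where "DG c v z = ?D (k z) (k1 z * v) (c * k1 z) + form P Q (k z) (c * (k2 z * v))" for c v z
  have form_G: "form (G 1) (G \<i>) z w = form P Q (k z) (k1 z * w)" for z w
    by (simp add: G_def form_def algebra_simps)
  have form_DG: "form (DG c 1) (DG c \<i>) z = (\<lambda>v. DG c v z)" for c z
    by (rule ext) (simp add: DG_def form_def dform_def algebra_simps)
  have dG: "(G c has_derivative form (DG c 1) (DG c \<i>) z) (at z)" if "z \<in> U" for c z
  proof -
    have "k z \<in> S" using that kh by auto
    show ?thesis unfolding G_def form_DG
      by (rule has_derivative_eq_rhs[OF has_derivative_form[OF dP dQ dk has_derivative_mult_right[OF dk1]]])
         (use that \<open>k z \<in> S\<close> in \<open>auto simp: DG_def\<close>)
  qed
  have cG: "continuous_on U (G c)" for c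
    unfolding G_def by (intro continuous_on_form[OF cP] continuous_intros ck) (use kh in auto)
  have cDG: "continuous_on U (DG c v)" for c v
    unfolding DG_def
    by (intro continuous_on_add continuous_on_form[OF cP] continuous_on_dform[OF cont'] continuous_intros ck) (use kh in auto)
  have flatG: "DG 1 \<i> z + (G 1 z o\<^sub>L G \<i> z) = DG \<i> 1 z + (G \<i> z o\<^sub>L G 1 z)" if "z \<in> U" for z
  proof (rule blinfun_eqI)
    fix \<xi>
    have "k z \<in> S" using that kh by auto
    \<comment> \<open>The terms with \<open>k2\<close> in \<open>DG 1 \<i>\<close> and
      \<open>DG \<i> 1\<close> agree because complex multiplication commutes. What remains is the
      curvature identity downstairs for the vectors \<i> k' and k'.\<close>
    from curvature[where P = P and Q = Q and Pu = Pu and Pv = Pv and Qu = Qu and Qv = Qv and h = "\<i> * k1 z" and w = "k1 z" and \<xi> = \<xi>, OF flat[OF this]]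
    show "(DG 1 \<i> z + (G 1 z o\<^sub>L G \<i> z)) \<xi> = (DG \<i> 1 z + (G \<i> z o\<^sub>L G 1 z)) \<xi>"
      by (simp add: DG_def G_def blinfun.add_left mult.commute)
  qed
  have "\<exists>x. x (k 0) = x0 \<and> (\<forall>z\<in>S. (x has_derivative (\<lambda>w. form P Q z w (x z))) (at z))" for x0
  proof -
    let ?y = "radial_sol (G 1) (G \<i>) x0"
    have y0: "?y 0 = x0" by (rule radial_sol_0[OF U cG cG])
    have dy: "(?y has_derivative (\<lambda>w. form (G 1) (G \<i>) z w (?y z))) (at z)" if "z \<in> U" for z
      by (rule radial_sol_has_derivative[OF U cG cG dG dG cDG cDG cDG cDG flatG that])
    show ?thesis
    proof (intro exI[of _ "\<lambda>z. ?y (h z)"] conjI ballI)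
      show "?y (h (k 0)) = x0" using kh U y0 by simp
      fix z assume z: "z \<in> S"
      then have hz: "h z \<in> U" using kh by auto
      have dh: "(h has_derivative (*) (deriv h z)) (at z)"
        using holomorphic_derivI[OF h S(1) z] by (simp add: has_field_derivative_def)
      \<comment> \<open>Differentiating k (h z) = z shows that the derivative of h cancels the
        factor \<open>k1\<close> introduced by the pull-back.\<close>
      have "((\<lambda>z. k (h z)) has_derivative (\<lambda>w. k1 (h z) * (deriv h z * w))) (at z)"
        by (rule has_derivative_compose[OF dh dk[OF hz]])
      then have "((\<lambda>z. z) has_derivative (\<lambda>w. k1 (h z) * (deriv h z * w))) (at z)"
        by (rule has_derivative_transform_within_open[OF _ S(1) z]) (use kh in auto)
      then have "(\<lambda>w. k1 (h z) * (deriv h z * w)) = (\<lambda>w. w)"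
        using has_derivative_ident has_derivative_unique by blast
      then have inv: "k1 (h z) * (deriv h z * w) = w" for w by metis
      have "((\<lambda>z. ?y (h z)) has_derivative (\<lambda>w. form (G 1) (G \<i>) (h z) (deriv h z * w) (?y (h z)))) (at z)"
        by (rule has_derivative_compose[OF dh dy[OF hz]])
      then show "((\<lambda>z. ?y (h z)) has_derivative (\<lambda>w. form P Q z w (?y (h z)))) (at z)"
        using kh(3)[OF z] inv by (simp add: form_G)
    qed
  qed
  then show ?thesis using kh U by blast
qed

section \<open>Smooth functions of two real variables\<close>

lemma differentiable_on_open_iff:
  "open D \<Longrightarrow> f differentiable_on D \<longleftrightarrow> (\<forall>p\<in>D. f differentiable (at p))"
  unfolding differentiable_on_def using at_within_open by metis

lemma pdir_eqI: "(f has_derivative f') (at p) \<Longrightarrow> pdir k f p = f' (if k = 1 then (1, 0) else (0, 1))"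
  using frechet_derivative_at unfolding pdir_def by metis

lemma has_derivative_pdir:
  assumes "f differentiable (at p)"
  shows "(f has_derivative (\<lambda>w. fst w *\<^sub>R pu f p + snd w *\<^sub>R pv f p)) (at p)"
proof -
  define f' where "f' = frechet_derivative f (at p)"
  have f': "(f has_derivative f') (at p)"
    using assms frechet_derivative_works unfolding f'_def by blast
  interpret bounded_linear f' by (rule has_derivative_bounded_linear[OF f'])
  have "f' w = fst w *\<^sub>R pu f p + snd w *\<^sub>R pv f p" for w
  proof -
    have "w = fst w *\<^sub>R (1, 0) + snd w *\<^sub>R (0, 1)" by (simp add: prod_eq_iff)
    then have "f' w = fst w *\<^sub>R f' (1, 0) + snd w *\<^sub>R f' (0, 1)" by (metis add scaleR)
    then show ?thesis using f' by (simp add: pdir_eqI)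
  qed
  then show ?thesis using f' by presburger
qed

lemma has_derivative_fst_sndI:
  assumes "(f has_derivative (\<lambda>w. fst w *\<^sub>R a + snd w *\<^sub>R b)) (at p)"
  shows "f differentiable (at p)" "pu f p = a" "pv f p = b"
  using assms by (auto simp: differentiable_def pdir_eqI)

lemma pdir_cong:
  assumes "open D" "p \<in> D" "\<And>q. q \<in> D \<Longrightarrow> f q = g q"
  shows "pdir k f p = pdir k g p"
proof -
  have "(f has_derivative f') (at p) \<longleftrightarrow> (g has_derivative f') (at p)" for f'
    using has_derivative_transform_within_open[of f f' p UNIV D g] has_derivative_transform_within_open[of g f' p UNIV D f]
      assms by auto
  then show ?thesis by (simp add: pdir_def frechet_derivative_def)
qed

lemma differentiable_cong_open:
  assumes "open D" "p \<in> D" "\<And>q. q \<in> D \<Longrightarrow> f q = g q" "f differentiable (at p)"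
  shows "g differentiable (at p)"
  using has_derivative_transform_within_open[of f _ p UNIV D g] assms unfolding differentiable_def by blast

lemma pdir_const [simp]: "pdir k (\<lambda>_. c) p = 0"
  by (subst pdir_eqI[OF has_derivative_const]) simp

lemma pdir_linear:
  assumes "bounded_linear L" "f differentiable (at p)"
  shows "pdir k (\<lambda>q. L (f q)) p = L (pdir k f p)"
  using bounded_linear.has_derivative[OF assms(1) has_derivative_pdir[OF assms(2)]]
  by (subst pdir_eqI, assumption) (auto simp: pdir_def)

lemma pdir_add:
  assumes "f differentiable (at p)" "g differentiable (at p)"
  shows "pdir k (\<lambda>q. f q + g q) p = pdir k f p + pdir k g p"
  by (subst pdir_eqI[OF has_derivative_add[OF assms[THEN has_derivative_pdir]]]) (auto simp: pdir_def)

lemma pdir_diff: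
  assumes "f differentiable (at p)" "g differentiable (at p)"
  shows "pdir k (\<lambda>q. f q - g q) p = pdir k f p - pdir k g p"
  by (subst pdir_eqI[OF has_derivative_diff[OF assms[THEN has_derivative_pdir]]]) (auto simp: pdir_def)

lemma pdir_bilinear:
  assumes "bounded_bilinear B" "f differentiable (at p)" "g differentiable (at p)"
  shows "pdir k (\<lambda>q. B (f q) (g q)) p = B (f p) (pdir k g p) + B (pdir k f p) (g p)"
  by (subst pdir_eqI[OF bounded_bilinear.FDERIV[OF assms(1) assms(2,3)[THEN has_derivative_pdir]]]) (auto simp: pdir_def)

lemma differentiable_bilinear:
  fixes f :: "pt \<Rightarrow> 'a::real_normed_vector" and g :: "pt \<Rightarrow> 'b::real_normed_vector"
  assumes "bounded_bilinear B" "f differentiable (at p)" "g differentiable (at p)"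
  shows "(\<lambda>q. B (f q) (g q)) differentiable (at p)"
  using bounded_bilinear.FDERIV[OF assms(1) assms(2,3)[THEN has_derivative_pdir]] by (auto simp: differentiable_def)

lemma differentiable_linear:
  fixes f :: "pt \<Rightarrow> 'a::real_normed_vector"
  assumes "bounded_linear L" "f differentiable (at p)"
  shows "(\<lambda>q. L (f q)) differentiable (at p)"
  using bounded_linear.has_derivative[OF assms(1) has_derivative_pdir[OF assms(2)]] by (auto simp: differentiable_def)

lemma
  assumes "(g has_real_derivative g') (at (f p))" "f differentiable (at p)"
  shows pdir_compose: "pdir k (\<lambda>q. g (f q)) p = g' * pdir k f p"
    and differentiable_compose_real: "(\<lambda>q. g (f q)) differentiable (at p)"
proof -
  have *: "((\<lambda>q. g (f q)) has_derivative (\<lambda>w. g' * (fst w *\<^sub>R pu f p + snd w *\<^sub>R pv f p))) (at p)"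
    using has_derivative_compose[OF has_derivative_pdir[OF assms(2)]] assms(1)
    unfolding has_field_derivative_def by blast
  show "pdir k (\<lambda>q. g (f q)) p = g' * pdir k f p"
    by (subst pdir_eqI[OF *]) (auto simp: pdir_def)
  show "(\<lambda>q. g (f q)) differentiable (at p)" using * by (auto simp: differentiable_def)
qed

lemma pdir_scaleR:
  assumes "f differentiable (at p)" "g differentiable (at p)"
  shows "pdir k (\<lambda>q. f q *\<^sub>R g q) p = f p *\<^sub>R pdir k g p + pdir k f p *\<^sub>R g p"
  by (rule pdir_bilinear[OF bounded_bilinear_scaleR assms])

lemma pdir_cmult:
  fixes f :: "pt \<Rightarrow> real"
  assumes "f differentiable (at p)"
  shows "pdir k (\<lambda>q. c * f q) p = c * pdir k f p"
  by (rule pdir_linear[OF bounded_linear_mult_right assms])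

text \<open>Differentiability n times on D, with no continuity asked of the derivatives of order n.
  \<open>iter_pd\<close> adds derivatives at the outside, whereas this recursion peels them off at
  the inside, where the product and chain rules act; hence closure properties follow by induction on
  n.\<close>

primrec Ck :: "nat \<Rightarrow> pt set \<Rightarrow> (pt \<Rightarrow> 'a::real_normed_vector) \<Rightarrow> bool" where
  "Ck 0 D f \<longleftrightarrow> True"
| "Ck (Suc n) D f \<longleftrightarrow> f differentiable_on D \<and> (\<forall>k. Ck n D (pdir k f))"

lemma iter_pd_append: "iter_pd (ks @ [k]) f = iter_pd ks (pdir k f)"
  by (induction ks) auto

lemma smooth_on_pdir: "smooth_on D f \<Longrightarrow> smooth_on D (pdir k f)"
  unfolding smooth_on_def by (metis iter_pd_append)

lemma smooth_on_differentiable: "smooth_on D f \<Longrightarrow> p \<in> D \<Longrightarrow> f differentiable (at p)"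
  unfolding smooth_on_def using differentiable_on_open_iff iter_pd.simps(1) by metis

lemma smooth_on_iff_Ck: "smooth_on D f \<longleftrightarrow> open D \<and> (\<forall>n. Ck n D f)"
proof safe
  show "open D" if "smooth_on D f" using that by (simp add: smooth_on_def)
  show "Ck n D f" if "smooth_on D f" for n
    using that
  proof (induction n arbitrary: f)
    case (Suc n)
    then show ?case using smooth_on_pdir smooth_on_def iter_pd.simps(1) by (metis Ck.simps(2))
  qed simp
  assume D: "open D" "\<forall>n. Ck n D f"
  have "iter_pd ks f differentiable_on D" if "\<forall>n. Ck n D f" for ks and f :: "pt \<Rightarrow> 'a"
    using that
  proof (induction ks arbitrary: f rule: rev_induct)
    case Nil
    then show ?case using Ck.simps(2) by (metis iter_pd.simps(1))
  next
    case (snoc k ks)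
    then show ?case unfolding iter_pd_append by (metis Ck.simps(2))
  qed
  then show "smooth_on D f" using D by (simp add: smooth_on_def)
qed

lemma Ck_mono: "Ck (Suc n) D f \<Longrightarrow> Ck n D f"
  by (induction n arbitrary: f) auto

lemma Ck_cong:
  assumes "open D" "\<And>q. q \<in> D \<Longrightarrow> f q = g q" "Ck n D f"
  shows "Ck n D g"
  using assms(2,3)
proof (induction n arbitrary: f g)
  case (Suc n)
  have "pdir k f q = pdir k g q" if "q \<in> D" for k q
    using pdir_cong[OF assms(1) that] Suc.prems by metis
  then show ?case using Suc differentiable_cong_open[OF assms(1)]
    unfolding Ck.simps differentiable_on_open_iff[OF assms(1)] by metis
qed simp

lemma Ck_const: "Ck n D (\<lambda>_. c)"
proof (induction n arbitrary: c)
  case (Suc n)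
  have "pdir k (\<lambda>_. c) = (\<lambda>_. 0)" for k by (rule ext) simp
  then show ?case using Suc by (simp add: differentiable_on_const)
qed simp

lemma Ck_linear:
  assumes "bounded_linear L" "open D" "Ck n D f"
  shows "Ck n D (\<lambda>q. L (f q))"
  using assms(3)
proof (induction n arbitrary: f)
  case (Suc n)
  then have d: "f differentiable (at q)" if "q \<in> D" for q
    using that by (simp add: differentiable_on_open_iff[OF assms(2)])
  show ?case
    unfolding Ck.simps
  proof (intro conjI allI)
    show "(\<lambda>q. L (f q)) differentiable_on D"
      using differentiable_linear[OF assms(1) d] by (simp add: differentiable_on_open_iff[OF assms(2)])
    have "Ck n D (\<lambda>q. L (pdir k f q))" for k using Suc by simp
    then show "Ck n D (pdir k (\<lambda>q. L (f q)))" for k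
      by (rule Ck_cong[OF assms(2), rotated]) (simp add: pdir_linear[OF assms(1) d])
  qed
qed simp

lemma Ck_add:
  assumes "open D" "Ck n D f" "Ck n D g"
  shows "Ck n D (\<lambda>q. f q + g q)"
  using assms(2,3)
proof (induction n arbitrary: f g)
  case (Suc n)
  then have d: "f differentiable (at q)" "g differentiable (at q)" if "q \<in> D" for q
    using that by (simp_all add: differentiable_on_open_iff[OF assms(1)])
  show ?case
    unfolding Ck.simps
  proof (intro conjI allI)
    show "(\<lambda>q. f q + g q) differentiable_on D"
      using differentiable_add d by (simp add: differentiable_on_open_iff[OF assms(1)])
    have "Ck n D (\<lambda>q. pdir k f q + pdir k g q)" for k using Suc by simp
    then show "Ck n D (pdir k (\<lambda>q. f q + g q))" for k
      by (rule Ck_cong[OF assms(1), rotated]) (simp add: pdir_add d)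
  qed
qed simp

lemma Ck_bilinear:
  assumes "bounded_bilinear B" "open D" "Ck n D f" "Ck n D g"
  shows "Ck n D (\<lambda>q. B (f q) (g q))"
  using assms(3,4)
proof (induction n arbitrary: f g)
  case (Suc n)
  show ?case
    unfolding Ck.simps
  proof (intro conjI allI)
    show "(\<lambda>q. B (f q) (g q)) differentiable_on D"
      using Suc.prems differentiable_bilinear[OF assms(1)] by (simp add: differentiable_on_open_iff[OF assms(2)])
    fix k
    have "Ck n D (\<lambda>q. B (f q) (pdir k g q) + B (pdir k f q) (g q))"
      using Suc Ck_mono Ck_add[OF assms(2)] by (metis Ck.simps(2))
    then show "Ck n D (pdir k (\<lambda>q. B (f q) (g q)))"
      by (rule Ck_cong[OF assms(2), rotated])
         (use Suc.prems in \<open>simp add: pdir_bilinear[OF assms(1)] differentiable_on_open_iff[OF assms(2)]\<close>)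
  qed
qed simp

text \<open>One induction covers every function of one variable whose derivative is smooth wherever the function itself is,
  such as exp, ln and inverse.\<close>

lemma Ck_compose:
  fixes f :: "pt \<Rightarrow> real"
  assumes D: "open D" and g: "\<And>q. q \<in> D \<Longrightarrow> (g has_real_derivative g' (f q)) (at (f q))"
    and g': "\<And>n. Ck n D f \<Longrightarrow> Ck n D (\<lambda>q. g (f q)) \<Longrightarrow> Ck n D (\<lambda>q. g' (f q))"
    and "Ck n D f"
  shows "Ck n D (\<lambda>q. g (f q))"
  using assms(4)
proof (induction n)
  case (Suc n)
  have n: "Ck n D f" using Suc.prems by (rule Ck_mono)
  have d: "f differentiable (at q)" if "q \<in> D" for q
    using Suc.prems that by (simp add: differentiable_on_open_iff[OF D])
  show ?case
    unfolding Ck.simps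
  proof (intro conjI allI)
    show "(\<lambda>q. g (f q)) differentiable_on D"
      using differentiable_compose_real[OF g d] by (simp add: differentiable_on_open_iff[OF D])
    fix k
    have "Ck n D (\<lambda>q. g' (f q) * pdir k f q)"
      using Ck_bilinear[OF bounded_bilinear_mult D g'[OF n Suc.IH[OF n]]] Suc.prems by simp
    then show "Ck n D (pdir k (\<lambda>q. g (f q)))"
      by (rule Ck_cong[OF D, rotated]) (simp add: pdir_compose[OF g d])
  qed
qed simp

lemma smooth_on_const: "open D \<Longrightarrow> smooth_on D (\<lambda>_. c)"
  by (simp add: smooth_on_iff_Ck Ck_const)

lemma smooth_on_cong:
  assumes "smooth_on D f" "\<And>q. q \<in> D \<Longrightarrow> f q = g q"
  shows "smooth_on D g"
  using assms Ck_cong unfolding smooth_on_iff_Ck by metis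

lemma smooth_on_linear: "bounded_linear L \<Longrightarrow> smooth_on D f \<Longrightarrow> smooth_on D (\<lambda>q. L (f q))"
  by (simp add: smooth_on_iff_Ck Ck_linear)

lemma smooth_on_bilinear:
  "bounded_bilinear B \<Longrightarrow> smooth_on D f \<Longrightarrow> smooth_on D g \<Longrightarrow> smooth_on D (\<lambda>q. B (f q) (g q))"
  by (simp add: smooth_on_iff_Ck Ck_bilinear)

lemma smooth_on_add: "smooth_on D f \<Longrightarrow> smooth_on D g \<Longrightarrow> smooth_on D (\<lambda>q. f q + g q)"
  by (simp add: smooth_on_iff_Ck Ck_add)

lemma smooth_on_minus: "smooth_on D f \<Longrightarrow> smooth_on D (\<lambda>q. - f q)"
  by (rule smooth_on_linear[OF bounded_linear_minus[OF bounded_linear_ident]])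

lemma smooth_on_diff: "smooth_on D f \<Longrightarrow> smooth_on D g \<Longrightarrow> smooth_on D (\<lambda>q. f q - g q)"
  using smooth_on_add[OF _ smooth_on_minus] by fastforce

lemma smooth_on_mult:
  fixes f g :: "pt \<Rightarrow> real"
  shows "smooth_on D f \<Longrightarrow> smooth_on D g \<Longrightarrow> smooth_on D (\<lambda>q. f q * g q)"
  by (rule smooth_on_bilinear[OF bounded_bilinear_mult])

lemma smooth_on_cmult:
  fixes f :: "pt \<Rightarrow> real"
  shows "smooth_on D f \<Longrightarrow> smooth_on D (\<lambda>q. c * f q)"
  by (rule smooth_on_linear[OF bounded_linear_mult_right])

lemma smooth_on_sum:
  assumes "open D" "\<And>i. i \<in> I \<Longrightarrow> smooth_on D (f i)"
  shows "smooth_on D (\<lambda>q. \<Sum>i\<in>I. f i q)"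
  using assms(2) by (induction I rule: infinite_finite_induct) (auto intro: smooth_on_const smooth_on_add assms(1))

lemma smooth_on_exp:
  fixes f :: "pt \<Rightarrow> real"
  assumes "smooth_on D f"
  shows "smooth_on D (\<lambda>q. exp (f q))"
  unfolding smooth_on_iff_Ck
proof safe
  show D: "open D" using assms by (simp add: smooth_on_def)
  show "Ck n D (\<lambda>q. exp (f q))" for n
    by (rule Ck_compose[where g' = exp, OF D DERIV_exp]) (use assms in \<open>simp_all add: smooth_on_iff_Ck\<close>)
qed

lemma smooth_on_inverse:
  fixes f :: "pt \<Rightarrow> real"
  assumes "smooth_on D f" "\<And>q. q \<in> D \<Longrightarrow> f q \<noteq> 0"
  shows "smooth_on D (\<lambda>q. inverse (f q))"
  unfolding smooth_on_iff_Ck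
proof safe
  show D: "open D" using assms by (simp add: smooth_on_def)
  show "Ck n D (\<lambda>q. inverse (f q))" for n
  proof (rule Ck_compose[where g = inverse and f = f and g' = "\<lambda>x. - (inverse x * inverse x)", OF D])
    show "(inverse has_real_derivative - (inverse (f q) * inverse (f q))) (at (f q))" if "q \<in> D" for q
      using DERIV_inverse[OF assms(2)[OF that]] by (simp add: power2_eq_square)
    show "Ck n D (\<lambda>q. - (inverse (f q) * inverse (f q)))" if "Ck n D (\<lambda>q. inverse (f q))" for n
      by (rule Ck_linear[OF bounded_linear_minus[OF bounded_linear_ident] D Ck_bilinear[OF bounded_bilinear_mult D that that]])
  qed (use assms in \<open>auto simp: smooth_on_iff_Ck\<close>)
qed

lemma smooth_on_divide:
  fixes f :: "pt \<Rightarrow> real"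
  assumes "smooth_on D f" "smooth_on D g" "\<And>q. q \<in> D \<Longrightarrow> g q \<noteq> 0"
  shows "smooth_on D (\<lambda>q. f q / g q)"
  unfolding divide_inverse by (intro smooth_on_mult smooth_on_inverse assms)

lemma smooth_on_ln:
  fixes f :: "pt \<Rightarrow> real"
  assumes "smooth_on D f" "\<And>q. q \<in> D \<Longrightarrow> f q > 0"
  shows "smooth_on D (\<lambda>q. ln (f q))"
  unfolding smooth_on_iff_Ck
proof safe
  show D: "open D" using assms by (simp add: smooth_on_def)
  have "smooth_on D (\<lambda>q. inverse (f q))"
    using assms(2) by (intro smooth_on_inverse assms(1)) (metis less_irrefl)
  then have inv: "Ck n D (\<lambda>q. inverse (f q))" for n by (simp add: smooth_on_iff_Ck)
  show "Ck n D (\<lambda>q. ln (f q))" for n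
    by (rule Ck_compose[where g' = inverse, OF D DERIV_ln[OF assms(2)] inv])
       (use assms in \<open>simp_all add: smooth_on_iff_Ck\<close>)
qed

lemma smooth_on_vec:
  fixes f :: "'n::finite \<Rightarrow> pt \<Rightarrow> 'a::euclidean_space"
  assumes "open D" "\<And>i. smooth_on D (f i)"
  shows "smooth_on D (\<lambda>q. \<chi> i. f i q)"
proof -
  have "smooth_on D (\<lambda>q. \<Sum>i\<in>UNIV. (\<chi> j. if j = i then f i q else 0) :: 'a ^ 'n)"
  proof (intro smooth_on_sum smooth_on_linear[where L = "\<lambda>x. \<chi> j. if j = _ then x else 0"] assms)
    show "bounded_linear (\<lambda>x. (\<chi> j. if j = i then x else 0) :: 'a ^ 'n)" for i
      by (rule linear_conv_bounded_linear[THEN iffD1]) (auto simp: linear_iff vec_eq_iff)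
  qed
  then show ?thesis
    by (rule smooth_on_cong) (simp add: vec_eq_iff sum_component if_distrib cong: if_cong)
qed

lemma smooth_on_nth:
  fixes f :: "pt \<Rightarrow> 'a::real_normed_vector ^ 'n"
  shows "smooth_on D f \<Longrightarrow> smooth_on D (\<lambda>q. f q $ i)"
  by (rule smooth_on_linear[OF bounded_linear_vec_nth])

lemma smooth_on_continuous: "smooth_on D f \<Longrightarrow> continuous_on D f"
  unfolding smooth_on_def using differentiable_imp_continuous_on iter_pd.simps(1) by metis

section \<open>Symmetry of mixed partial derivatives\<close>

lemma partial_derivatives:
  fixes f :: "pt \<Rightarrow> real"
  assumes "f differentiable (at (a, b))"
  shows "((\<lambda>x. f (x, b)) has_real_derivative pu f (a, b)) (at a)"
    and "((\<lambda>y. f (a, y)) has_real_derivative pv f (a, b)) (at b)"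
proof -
  note d = has_derivative_pdir[OF assms]
  have "((\<lambda>x. f (x, b)) has_derivative (\<lambda>h. fst (h, 0::real) *\<^sub>R pu f (a, b) + snd (h, 0::real) *\<^sub>R pv f (a, b))) (at a)"
    by (rule has_derivative_compose[where f = "\<lambda>x. (x, b)", OF _ d]) (auto intro!: derivative_eq_intros)
  then show "((\<lambda>x. f (x, b)) has_real_derivative pu f (a, b)) (at a)"
    by (rule has_derivative_imp_has_field_derivative) simp
  have "((\<lambda>y. f (a, y)) has_derivative (\<lambda>h. fst (0::real, h) *\<^sub>R pu f (a, b) + snd (0::real, h) *\<^sub>R pv f (a, b))) (at b)"
    by (rule has_derivative_compose[where f = "\<lambda>y. (a, y)", OF _ d]) (auto intro!: derivative_eq_intros)
  then show "((\<lambda>y. f (a, y)) has_real_derivative pv f (a, b)) (at b)"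
    by (rule has_derivative_imp_has_field_derivative) simp
qed

text \<open>The second difference over a small square of side h, evaluated by the mean value theorem
  in both orders, is h^2 times one mixed derivative and also h^2 times the other, at two points of
  the square. Continuity of both at p excludes a gap between their values there.\<close>

lemma clairaut_real:
  fixes f :: "pt \<Rightarrow> real"
  assumes f: "smooth_on D f" and p: "p \<in> D"
  shows "pu (pv f) p = pv (pu f) p"
proof (rule ccontr)
  assume ne: "pu (pv f) p \<noteq> pv (pu f) p"
  obtain a b where ab: "p = (a, b)" by force
  define e where "e = \<bar>pu (pv f) p - pv (pu f) p\<bar> / 2"
  have e: "e > 0" using ne by (simp add: e_def)
  have D: "open D" using f by (simp add: smooth_on_def)
  have c: "isCont (pu (pv f)) p" "isCont (pv (pu f)) p"
    using smooth_on_continuous[OF smooth_on_pdir[OF smooth_on_pdir[OF f]]] D p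
    by (auto simp: continuous_on_eq_continuous_at)
  obtain d1 where d1: "d1 > 0" "\<And>q. dist q p < d1 \<Longrightarrow> dist (pu (pv f) q) (pu (pv f) p) < e"
    using c(1) e unfolding continuous_at_eps_delta by metis
  obtain d2 where d2: "d2 > 0" "\<And>q. dist q p < d2 \<Longrightarrow> dist (pv (pu f) q) (pv (pu f) p) < e"
    using c(2) e unfolding continuous_at_eps_delta by metis
  obtain d3 where d3: "d3 > 0" "ball p d3 \<subseteq> D" using D p open_contains_ball by blast
  define r where "r = min d1 (min d2 d3)"
  \<comment> \<open>A point of the square is then at distance at most 2 h = r / 2 from its corner
    p.\<close>
  define h where "h = r / 4"
  have h: "h > 0" using d1 d2 d3 by (simp add: h_def r_def)
  have near: "dist (x, y) p < r" if "a \<le> x" "x \<le> a + h" "b \<le> y" "y \<le> b + h" for x y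
  proof -
    have "dist (x, y) p \<le> dist x a + dist y b"
      unfolding ab dist_Pair_Pair by (rule sqrt_sum_squares_le_sum) auto
    also have "\<dots> < r" using that h by (simp add: dist_real_def h_def)
    finally show ?thesis .
  qed
  have inD: "(x, y) \<in> D" if "a \<le> x" "x \<le> a + h" "b \<le> y" "y \<le> b + h" for x y
    using near[OF that] d3(2) by (auto simp: r_def dist_commute)
  have df: "f differentiable (at q)" "pu f differentiable (at q)" "pv f differentiable (at q)" if "q \<in> D" for q
    using smooth_on_differentiable[OF _ that] f smooth_on_pdir[OF f] by auto
  let ?S = "f (a + h, b + h) - f (a + h, b) - f (a, b + h) + f (a, b)"
  have "\<exists>x>a. x < a + h \<and> (f (a + h, b + h) - f (a + h, b)) - (f (a, b + h) - f (a, b)) =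
      (a + h - a) * (pu f (x, b + h) - pu f (x, b))"
    by (intro MVT2 DERIV_diff partial_derivatives df inD) (use h in auto)
  then obtain x where x: "a < x" "x < a + h" "?S = h * (pu f (x, b + h) - pu f (x, b))" by auto
  have "\<exists>y>b. y < b + h \<and> pu f (x, b + h) - pu f (x, b) = (b + h - b) * pv (pu f) (x, y)"
    by (intro MVT2 DERIV_diff partial_derivatives df inD) (use h x in auto)
  then obtain y where y: "b < y" "y < b + h" "?S = h * (h * pv (pu f) (x, y))" using x by auto
  have "\<exists>y'>b. y' < b + h \<and> (f (a + h, b + h) - f (a, b + h)) - (f (a + h, b) - f (a, b)) =
      (b + h - b) * (pv f (a + h, y') - pv f (a, y'))"
    by (intro MVT2 DERIV_diff partial_derivatives df inD) (use h in auto)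
  then obtain y' where y': "b < y'" "y' < b + h" "?S = h * (pv f (a + h, y') - pv f (a, y'))" by auto
  have "\<exists>x'>a. x' < a + h \<and> pv f (a + h, y') - pv f (a, y') = (a + h - a) * pu (pv f) (x', y')"
    by (intro MVT2 DERIV_diff partial_derivatives df inD) (use h y' in auto)
  then obtain x' where x': "a < x'" "x' < a + h" "?S = h * (h * pu (pv f) (x', y'))" using y' by auto
  have "pu (pv f) (x', y') = pv (pu f) (x, y)" using x'(3) y(3) h by simp
  moreover have "dist (pu (pv f) (x', y')) (pu (pv f) p) < e"
    using x' y' near[of x' y'] by (intro d1) (auto simp: r_def)
  moreover have "dist (pv (pu f) (x, y)) (pv (pu f) p) < e"
    using x y near[of x y] by (intro d2) (auto simp: r_def)
  ultimately have "dist (pu (pv f) p) (pv (pu f) p) < 2 * e"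
    by (metis dist_commute dist_triangle_less_add mult_2)
  then show False by (simp add: e_def dist_real_def)
qed

lemma clairaut:
  fixes f :: "pt \<Rightarrow> 'a::euclidean_space"
  assumes f: "smooth_on D f" and p: "p \<in> D"
  shows "pu (pv f) p = pv (pu f) p"
proof (rule euclidean_eqI)
  fix b :: 'a assume "b \<in> Basis"
  have D: "open D" using f by (simp add: smooth_on_def)
  have *: "pdir j (pdir k (\<lambda>q. f q \<bullet> b)) p = pdir j (pdir k f) p \<bullet> b" for j k
  proof -
    have "pdir k (\<lambda>q. f q \<bullet> b) q = pdir k f q \<bullet> b" if "q \<in> D" for q
      by (rule pdir_linear[OF bounded_linear_inner_left smooth_on_differentiable[OF f that]])
    then have "pdir j (pdir k (\<lambda>q. f q \<bullet> b)) p = pdir j (\<lambda>q. pdir k f q \<bullet> b) p"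
      by (rule pdir_cong[OF D p])
    also have "\<dots> = pdir j (pdir k f) p \<bullet> b"
      by (rule pdir_linear[OF bounded_linear_inner_left smooth_on_differentiable[OF smooth_on_pdir[OF f] p]])
    finally show ?thesis .
  qed
  show "pu (pv f) p \<bullet> b = pv (pu f) p \<bullet> b"
    using clairaut_real[OF smooth_on_linear[where L = "\<lambda>x. x \<bullet> b", OF bounded_linear_inner_left f] p] unfolding * .
qed

section \<open>Transfer between the complex plane and pairs of reals\<close>

lemma simply_connected_Complex_image:
  fixes D :: "pt set"
  assumes "open D" "simply_connected D"
  shows "open ((\<lambda>p. Complex (fst p) (snd p)) ` D)" "simply_connected ((\<lambda>p. Complex (fst p) (snd p)) ` D)"
proof -
  let ?f = "\<lambda>p::pt. Complex (fst p) (snd p)"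
  have "continuous_on UNIV (\<lambda>z. (Re z, Im z))" by (intro continuous_intros)
  then have "open ((\<lambda>z. (Re z, Im z)) -` D)" using assms(1) by (metis open_vimage)
  moreover have eq: "?f ` D = (\<lambda>z. (Re z, Im z)) -` D"
    by (auto simp: image_iff) (metis complex.collapse fst_conv snd_conv)
  ultimately show "open (?f ` D)" by simp
  have "continuous_on D ?f" unfolding Complex_eq by (intro continuous_intros)
  then have "D homeomorphic ?f ` D"
    unfolding homeomorphic_def homeomorphism_def
    by (intro exI[of _ ?f] exI[of _ "\<lambda>z. (Re z, Im z)"]) (auto simp: image_image intro!: continuous_intros)
  then show "simply_connected (?f ` D)" using assms homeomorphic_simply_connected by blast
qed

theorem frobenius:
  fixes P Q :: "pt \<Rightarrow> 'a::banach \<Rightarrow>\<^sub>L 'a"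
  assumes D: "open D" "simply_connected D" "D \<noteq> {}"
    and smooth: "smooth_on D P" "smooth_on D Q"
    and flat: "\<And>p. p \<in> D \<Longrightarrow> pv P p + (P p o\<^sub>L Q p) = pu Q p + (Q p o\<^sub>L P p)"
  shows "\<exists>p0\<in>D. \<forall>x0. \<exists>x. x p0 = x0 \<and>
    (\<forall>p\<in>D. (x has_derivative (\<lambda>w. fst w *\<^sub>R P p (x p) + snd w *\<^sub>R Q p (x p))) (at p))"
proof -
  let ?f = "\<lambda>p::pt. Complex (fst p) (snd p)"
  let ?c = "\<lambda>z. (Re z, Im z)"
  have dc: "(?c has_derivative ?c) (at z within T)" for z T
    by (intro bounded_linear_imp_has_derivative bounded_linear_Pair bounded_linear_Re bounded_linear_Im)
  have df: "(?f has_derivative ?f) (at p within T)" for p T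
    unfolding Complex_eq by (auto intro!: derivative_eq_intros)
  have c: "?c z \<in> D" if "z \<in> ?f ` D" for z using that by auto
  have d: "((\<lambda>z. g (?c z)) has_derivative form (\<lambda>z. pu g (?c z)) (\<lambda>z. pv g (?c z)) z) (at z)"
    if "smooth_on D g" "z \<in> ?f ` D" for g :: "pt \<Rightarrow> 'a \<Rightarrow>\<^sub>L 'a" and z
    using has_derivative_compose[OF dc has_derivative_pdir[OF smooth_on_differentiable[OF that(1) c[OF that(2)]]], of UNIV]
    by (simp add: form_def[abs_def])
  have cont: "continuous_on (?f ` D) (\<lambda>z. pdir k g (?c z))"
    if "smooth_on D g" for g :: "pt \<Rightarrow> 'a \<Rightarrow>\<^sub>L 'a" and k
    by (rule continuous_on_compose2[OF smooth_on_continuous[OF smooth_on_pdir[OF that]]])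
       (auto intro!: continuous_intros)
  have "\<exists>z0\<in>?f ` D. \<forall>x0. \<exists>x. x z0 = x0 \<and>
    (\<forall>z\<in>?f ` D. (x has_derivative (\<lambda>w. form (\<lambda>z. P (?c z)) (\<lambda>z. Q (?c z)) z w (x z))) (at z))"
    by (rule frobenius_complex[OF simply_connected_Complex_image[OF D(1,2)] _
          d[OF smooth(1)] d[OF smooth(2)] cont[OF smooth(1)] cont[OF smooth(1)] cont[OF smooth(2)] cont[OF smooth(2)]])
       (use D flat c in auto)
  then obtain z0 where z0: "z0 \<in> ?f ` D" and ex: "\<And>x0. \<exists>x. x z0 = x0 \<and>
    (\<forall>z\<in>?f ` D. (x has_derivative (\<lambda>w. form (\<lambda>z. P (?c z)) (\<lambda>z. Q (?c z)) z w (x z))) (at z))"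
    by blast
  show ?thesis
  proof (intro bexI[of _ "?c z0"] allI)
    fix x0
    obtain x where x: "x z0 = x0"
      "\<And>z. z \<in> ?f ` D \<Longrightarrow> (x has_derivative (\<lambda>w. form (\<lambda>z. P (?c z)) (\<lambda>z. Q (?c z)) z w (x z))) (at z)"
      using ex by blast
    have "((\<lambda>p. x (?f p)) has_derivative (\<lambda>w. fst w *\<^sub>R P p (x (?f p)) + snd w *\<^sub>R Q p (x (?f p)))) (at p)"
      if "p \<in> D" for p
      using has_derivative_compose[OF df x(2), of p UNIV] that
      by (simp add: form_def blinfun.add_left blinfun.scaleR_left)
    then show "\<exists>x. x (?c z0) = x0 \<and>
      (\<forall>p\<in>D. (x has_derivative (\<lambda>w. fst w *\<^sub>R P p (x p) + snd w *\<^sub>R Q p (x p))) (at p))"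
      using x(1) by (intro exI[of _ "\<lambda>p. x (?f p)"]) auto
  qed (use z0 c in auto)
qed

section \<open>Uniqueness and regularity for linear systems of first-order equations\<close>

context
  fixes B :: "'m::real_normed_vector \<Rightarrow> 'a::real_normed_vector \<Rightarrow> 'a"
  assumes B: "bounded_bilinear B"
begin

interpretation bounded_bilinear B by (rule B)

text \<open>The bilinear B is a parameter because two systems with the same coefficient matrices
  occur: the matrix product for the frame, and \<open>lyap\<close> for its Gram matrix.\<close>

definition solves :: "pt set \<Rightarrow> (pt \<Rightarrow> 'm) \<Rightarrow> (pt \<Rightarrow> 'm) \<Rightarrow> (pt \<Rightarrow> 'a) \<Rightarrow> bool" where
  "solves D M N x \<longleftrightarrow> (\<forall>p\<in>D. (x has_derivative (\<lambda>w. fst w *\<^sub>R B (M p) (x p) + snd w *\<^sub>R B (N p) (x p))) (at p))"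

lemma solves_zero_near:
  assumes x: "solves D M N x" and D: "open D" "p \<in> D" and cont: "continuous_on D M" "continuous_on D N"
    and "x p = 0"
  shows "\<exists>r>0. \<forall>q\<in>cball p r. x q = 0"
proof -
  obtain K where K: "K > 0" "\<And>a b. norm (B a b) \<le> norm a * norm b * K" using pos_bounded by blast
  obtain d where d: "d > 0" "cball p d \<subseteq> D" using D open_contains_cball by blast
  have "bounded ((\<lambda>q. (M q, N q)) ` cball p d)"
    using cont d by (intro compact_imp_bounded compact_continuous_image compact_cball continuous_on_Pair) (auto intro: continuous_on_subset)
  then obtain C0 where C0: "\<And>q. q \<in> cball p d \<Longrightarrow> norm (M q, N q) \<le> C0"
    unfolding bounded_iff ball_simps by blast
  define C where "C = max C0 1"
  have C: "norm (M q) \<le> C" "norm (N q) \<le> C" if "q \<in> cball p d" for q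
    using C0[OF that] norm_fst_le[of "M q" "N q"] norm_snd_le[of "N q" "M q"] by (auto simp: C_def)
  have C1: "C \<ge> 1" by (simp add: C_def)
  \<comment> \<open>For this radius the mean value inequality bounds the maximum of |x| on the ball
    by half of itself, which forces it to be 0.\<close>
  define r where "r = min d (1 / (4 * C * K))"
  have r: "r > 0" "r \<le> d" "r * (4 * C * K) \<le> 1"
    using d K C1 by (auto simp: r_def min_def field_simps)
  have sub: "cball p r \<subseteq> cball p d" using r by auto
  have dx: "(x has_derivative (\<lambda>w. fst w *\<^sub>R B (M q) (x q) + snd w *\<^sub>R B (N q) (x q))) (at q)" if "q \<in> cball p r" for q
    using x that sub d unfolding solves_def by blast
  have cx: "continuous_on (cball p r) (\<lambda>q. norm (x q))"
    by (intro continuous_on_norm continuous_at_imp_continuous_on ballI has_derivative_continuous[OF dx])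
  obtain q0 where q0: "q0 \<in> cball p r" "\<And>q. q \<in> cball p r \<Longrightarrow> norm (x q) \<le> norm (x q0)"
    using continuous_attains_sup[OF compact_cball _ cx] r by (metis centre_in_cball empty_iff less_imp_le)
  have on: "onorm (\<lambda>w. fst w *\<^sub>R B (M q) (x q) + snd w *\<^sub>R B (N q) (x q)) \<le> 2 * C * K * norm (x q0)"
    if q: "q \<in> cball p r" for q
  proof (rule onorm_bound)
    show "0 \<le> 2 * C * K * norm (x q0)" using C1 K by simp
    fix w :: pt
    have b: "norm (B m (x q)) \<le> C * norm (x q0) * K" if "norm m \<le> C" for m
    proof -
      have "norm (B m (x q)) \<le> norm m * norm (x q) * K" by (rule K)
      also have "\<dots> \<le> C * norm (x q0) * K"
        using that q0(2)[OF q] K C1 by (intro mult_mono) auto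
      finally show ?thesis .
    qed
    have "norm (fst w *\<^sub>R B (M q) (x q) + snd w *\<^sub>R B (N q) (x q))
      \<le> \<bar>fst w\<bar> * norm (B (M q) (x q)) + \<bar>snd w\<bar> * norm (B (N q) (x q))"
      by (metis norm_triangle_ineq norm_scaleR)
    also have "\<dots> \<le> norm w * (C * norm (x q0) * K) + norm w * (C * norm (x q0) * K)"
      using C[of q] q sub b norm_fst_le[of "fst w" "snd w"] norm_snd_le[of "snd w" "fst w"]
      by (intro add_mono mult_mono) auto
    finally show "norm (fst w *\<^sub>R B (M q) (x q) + snd w *\<^sub>R B (N q) (x q)) \<le> 2 * C * K * norm (x q0) * norm w"
      by (simp add: algebra_simps)
  qed
  have "norm (x q0 - x p) \<le> (2 * C * K * norm (x q0)) * norm (q0 - p)"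
    by (rule differentiable_bound[OF convex_cball has_derivative_at_withinI[OF dx] on]) (use q0 r in auto)
  also have "\<dots> \<le> (2 * C * K * norm (x q0)) * r"
    using q0(1) C1 K by (intro mult_left_mono) (auto simp: dist_norm norm_minus_commute)
  also have "\<dots> = (r * (4 * C * K)) * norm (x q0) / 2" by simp
  also have "\<dots> \<le> 1 * norm (x q0) / 2"
    using r(3) by (intro divide_right_mono mult_right_mono) auto
  finally have "norm (x q0) \<le> 0" using \<open>x p = 0\<close> by simp
  then have "x q = 0" if "q \<in> cball p r" for q
    using q0(2)[OF that] norm_ge_zero by (metis norm_le_zero_iff order_trans)
  then show ?thesis using r(1) by blast
qed

lemma solves_zero:
  assumes x: "solves D M N x" and D: "open D" "connected D" and cont: "continuous_on D M" "continuous_on D N"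
    and p0: "p0 \<in> D" "x p0 = 0" and p: "p \<in> D"
  shows "x p = 0"
proof -
  define Z where "Z = {p \<in> D. x p = 0}"
  have "continuous_on D x"
    using x unfolding solves_def by (blast intro: continuous_at_imp_continuous_on has_derivative_continuous)
  then have "closedin (top_of_set D) Z"
    unfolding Z_def by (rule continuous_closedin_preimage_constant)
  moreover have "open Z"
    unfolding open_contains_cball
  proof
    fix q assume "q \<in> Z"
    then have q: "q \<in> D" "x q = 0" by (auto simp: Z_def)
    obtain r where r: "r > 0" "\<forall>y\<in>cball q r. x y = 0" using solves_zero_near[OF x D(1) q(1) cont q(2)] by blast
    obtain d where d: "d > 0" "cball q d \<subseteq> D" using D q open_contains_cball by blast
    show "\<exists>e>0. cball q e \<subseteq> Z" using r d by (intro exI[of _ "min r d"]) (auto simp: Z_def)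
  qed
  then have "openin (top_of_set D) Z" by (auto simp: Z_def intro: open_subset)
  ultimately have "Z = {} \<or> Z = D" using D(2) unfolding connected_clopen by blast
  then show ?thesis using p0 p unfolding Z_def by blast
qed

lemma solves_unique:
  assumes "solves D M N x" "solves D M N y" and D: "open D" "connected D" "continuous_on D M" "continuous_on D N"
    and "p0 \<in> D" "x p0 = y p0" and p: "p \<in> D"
  shows "x p = y p"
proof -
  have "solves D M N (\<lambda>p. x p - y p)"
    unfolding solves_def
  proof
    fix p assume "p \<in> D"
    then have "(x has_derivative (\<lambda>w. fst w *\<^sub>R B (M p) (x p) + snd w *\<^sub>R B (N p) (x p))) (at p)"
      "(y has_derivative (\<lambda>w. fst w *\<^sub>R B (M p) (y p) + snd w *\<^sub>R B (N p) (y p))) (at p)"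
      using assms(1,2) unfolding solves_def by blast+
    from has_derivative_diff[OF this]
    show "((\<lambda>p. x p - y p) has_derivative
        (\<lambda>w. fst w *\<^sub>R B (M p) (x p - y p) + snd w *\<^sub>R B (N p) (x p - y p))) (at p)"
      unfolding diff_right scaleR_diff_right by (rule has_derivative_eq_rhs) (rule ext, simp)
  qed
  from solves_zero[OF this D \<open>p0 \<in> D\<close> _ p] show ?thesis using \<open>x p0 = y p0\<close> by simp
qed

text \<open>Bootstrapping: the partial derivatives of x are B M x and B N x, hence as often
  differentiable as x, which is therefore differentiable once more.\<close>

lemma solves_smooth:
  assumes x: "solves D M N x" and smooth: "smooth_on D M" "smooth_on D N"
  shows "smooth_on D x"
proof -
  have D: "open D" using smooth by (simp add: smooth_on_def)
  have d: "x differentiable (at p)" "pu x p = B (M p) (x p)" "pv x p = B (N p) (x p)" if "p \<in> D" for p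
    using has_derivative_fst_sndI[of x] x that unfolding solves_def by blast+
  have "Ck n D x" for n
  proof (induction n)
    case (Suc n)
    show ?case
      unfolding Ck.simps
    proof (intro conjI allI)
      show "x differentiable_on D" using d by (simp add: differentiable_on_open_iff[OF D])
      have ck: "Ck n D (\<lambda>q. B (M q) (x q))" "Ck n D (\<lambda>q. B (N q) (x q))"
        using Suc smooth by (auto simp: smooth_on_iff_Ck intro!: Ck_bilinear[OF B])
      have "Ck n D (pu x)" "Ck n D (pv x)"
        by (rule Ck_cong[OF D d(2)[symmetric] ck(1)], assumption, rule Ck_cong[OF D d(3)[symmetric] ck(2)])
      \<comment> \<open>\<open>pdir\<close> takes every index other than 1 as the
        v-direction.\<close>
      moreover have "pdir k x = pu x \<or> pdir k x = pv x" for k by (auto simp: pdir_def fun_eq_iff)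
      ultimately show "Ck n D (pdir k x)" for k by metis
    qed
  qed simp
  then show ?thesis using D by (simp add: smooth_on_iff_Ck)
qed

end

lemma bounded_bilinear_matrix_mult: "bounded_bilinear ((**) :: real^'n^'m \<Rightarrow> real^'k^'n \<Rightarrow> real^'k^'m)"
  by (rule bilinear_conv_bounded_bilinear[THEN iffD1])
     (auto simp: bilinear_def linear_iff vec_eq_iff matrix_matrix_mult_def sum_distrib_left algebra_simps sum.distrib)

theorem frobenius_matrix:
  fixes M N :: "pt \<Rightarrow> real^'n^'n"
  assumes D: "open D" "simply_connected D" "D \<noteq> {}"
    and smooth: "smooth_on D M" "smooth_on D N"
    and flat: "\<And>p. p \<in> D \<Longrightarrow> pv M p + M p ** N p = pu N p + N p ** M p"
  shows "\<exists>p0\<in>D. \<forall>X0 :: real^'n^'n. \<exists>X. X p0 = X0 \<and> solves (**) D M N X"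
proof -
  interpret bounded_bilinear "(**) :: real^'n^'n \<Rightarrow> real^'n^'n \<Rightarrow> real^'n^'n"
    by (rule bounded_bilinear_matrix_mult)
  \<comment> \<open>\<open>prod_right (M p)\<close> is left multiplication by \<open>M p\<close>,
    regarded as a bounded operator on matrices.\<close>
  have smooth': "smooth_on D (\<lambda>p. prod_right (M p))" "smooth_on D (\<lambda>p. prod_right (N p))"
    by (intro smooth_on_linear[OF bounded_linear_prod_right] smooth)+
  have "\<exists>p0\<in>D. \<forall>X0. \<exists>X. X p0 = X0 \<and> (\<forall>p\<in>D. (X has_derivative
      (\<lambda>w. fst w *\<^sub>R prod_right (M p) (X p) + snd w *\<^sub>R prod_right (N p) (X p))) (at p))"
  proof (rule frobenius[OF D smooth'])
    fix p assume p: "p \<in> D"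
    have pd: "pdir k (\<lambda>p. prod_right (A p)) p = prod_right (pdir k A p)" if "smooth_on D A" for A k
      by (rule pdir_linear[OF bounded_linear_prod_right smooth_on_differentiable[OF that p]])
    show "pv (\<lambda>p. prod_right (M p)) p + (prod_right (M p) o\<^sub>L prod_right (N p)) =
        pu (\<lambda>p. prod_right (N p)) p + (prod_right (N p) o\<^sub>L prod_right (M p))"
    proof (rule blinfun_eqI)
      fix X :: "real^'n^'n"
      have "(pv M p + M p ** N p) ** X = (pu N p + N p ** M p) ** X"
        using flat[OF p] by simp
      then show "(pv (\<lambda>p. prod_right (M p)) p + (prod_right (M p) o\<^sub>L prod_right (N p))) X =
          (pu (\<lambda>p. prod_right (N p)) p + (prod_right (N p) o\<^sub>L prod_right (M p))) X"
        unfolding pd[OF smooth(1)] pd[OF smooth(2)]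
        by (simp add: blinfun.add_left add_left matrix_mul_assoc)
    qed
  qed
  then show ?thesis unfolding solves_def[OF bounded_bilinear_matrix_mult] by simp
qed

section \<open>Moving frames and the structure equations\<close>

text \<open>\<open>pu\<close> abbreviates \<open>pdir 1\<close>; rewriting the index to
  \<open>Suc 0\<close> would hide it from facts stated with \<open>pu\<close>.\<close>

declare One_nat_def [simp del]

lemma exhaust_5:
  fixes x :: 5
  shows "x = 1 \<or> x = 2 \<or> x = 3 \<or> x = 4 \<or> x = 5"
proof (induct x)
  case (of_int z)
  then have "0 \<le> z" and "z < 5" by simp_all
  then have "z = 0 \<or> z = 1 \<or> z = 2 \<or> z = 3 \<or> z = 4" by arith
  then show ?case by auto
qed

lemma forall_5: "(\<forall>i::5. P i) \<longleftrightarrow> P 1 \<and> P 2 \<and> P 3 \<and> P 4 \<and> P 5"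
  by (metis exhaust_5)

lemma UNIV_5: "UNIV = {1::5, 2, 3, 4, 5}"
  using exhaust_5 by auto

lemma sum_5: "sum f (UNIV :: 5 set) = f 1 + f 2 + f 3 + f 4 + f 5"
  unfolding UNIV_5 by (simp add: ac_simps)

definition vec5 :: "real \<Rightarrow> real \<Rightarrow> real \<Rightarrow> real \<Rightarrow> real \<Rightarrow> real^5" where
  "vec5 a b c d e = (\<chi> i. if i = 1 then a else if i = 2 then b else if i = 3 then c else if i = 4 then d else e)"

lemma vec5_nth [simp]:
  "vec5 a b c d e $ 1 = a" "vec5 a b c d e $ 2 = b" "vec5 a b c d e $ 3 = c" "vec5 a b c d e $ 4 = d" "vec5 a b c d e $ 5 = e"
  by (simp_all add: vec5_def)

lemma mat5_nth [simp]:
  "mat5 a b c d e $ 1 = a" "mat5 a b c d e $ 2 = b" "mat5 a b c d e $ 3 = c" "mat5 a b c d e $ 4 = d" "mat5 a b c d e $ 5 = e"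
  by (simp_all add: mat5_def)

lemma mat5_eq_iff: "(A :: real^5^5) = B \<longleftrightarrow> A $ 1 = B $ 1 \<and> A $ 2 = B $ 2 \<and> A $ 3 = B $ 3 \<and> A $ 4 = B $ 4 \<and> A $ 5 = B $ 5"
  by (simp add: vec_eq_iff[of A] forall_5)

section \<open>Gram matrices and expansion in a frame\<close>

lemma bounded_bilinear_ip: "bounded_bilinear (ip L0)"
  by (rule bilinear_conv_bounded_bilinear[THEN iffD1])
     (auto simp: bilinear_def linear_iff ip_def sum_distrib_left algebra_simps sum.distrib simp del: mult_minus_left)

interpretation ip: bounded_bilinear "ip L0" for L0 by (rule bounded_bilinear_ip)

lemma ip_commute: "ip L0 x y = ip L0 y x"
  unfolding ip_def by (intro sum.cong) auto

definition gram :: "real \<Rightarrow> real^5^5 \<Rightarrow> real^5^5" where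
  "gram L0 X = (\<chi> i j. ip L0 (X $ i) (X $ j))"

definition metric_mat :: "real \<Rightarrow> real^5^5" where
  "metric_mat L0 = (\<chi> i j. if i = j then (if L0 < 0 \<and> i = 1 then -1 else 1) else 0)"

lemma gram_eq: "gram L0 X = X ** metric_mat L0 ** transpose X"
  by (auto simp: vec_eq_iff gram_def ip_def matrix_matrix_mult_def metric_mat_def transpose_def if_distrib
      cong: if_cong intro!: sum.cong)

text \<open>The Gram matrix required of the rows F, T1, T2, N1, N2: F has square 1 / L0, the others
  are mutually orthogonal, orthogonal to F and of square E = e^(2 \<lambda>).\<close>

definition gram0 :: "real \<Rightarrow> real \<Rightarrow> real^5^5" where
  "gram0 L0 E = mat5 (vec5 (1 / L0) 0 0 0 0) (vec5 0 E 0 0 0) (vec5 0 0 E 0 0) (vec5 0 0 0 E 0) (vec5 0 0 0 0 E)"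

lemma mult_mat5_nth: "(A ** X) $ i = A $ i $ 1 *\<^sub>R X $ 1 + A $ i $ 2 *\<^sub>R X $ 2 + A $ i $ 3 *\<^sub>R X $ 3 + A $ i $ 4 *\<^sub>R X $ 4 + A $ i $ 5 *\<^sub>R X $ 5"
  for A X :: "real^5^5"
  by (simp add: vec_eq_iff matrix_matrix_mult_def sum_5)

lemma gram0_invertible:
  assumes "L0 \<noteq> 0" "E \<noteq> 0"
  shows "gram0 L0 E ** gram0 (1 / L0) (1 / E) = mat 1"
  using assms by (simp add: mat5_eq_iff mult_mat5_nth gram0_def) (simp add: vec_eq_iff forall_5 mat_def)

text \<open>Writing the Gram matrix as X \<eta> X^T exhibits \<eta> X^T times its inverse as a right
  inverse of X, and for square matrices a right inverse is a left one. The argument is indifferent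
  to the signature of \<eta>.\<close>

lemma
  assumes "L0 \<noteq> 0" "E \<noteq> 0" and g: "gram L0 X = gram0 L0 E"
  shows frame_left_inverse: "metric_mat L0 ** transpose X ** gram0 (1 / L0) (1 / E) ** X = mat 1"
    and frame_invertible: "invertible X"
proof -
  have 1: "X ** (metric_mat L0 ** transpose X ** gram0 (1 / L0) (1 / E)) = mat 1"
    using gram0_invertible[OF assms(1,2)] unfolding g[symmetric] gram_eq by (simp add: matrix_mul_assoc)
  then show "metric_mat L0 ** transpose X ** gram0 (1 / L0) (1 / E) ** X = mat 1"
    by (simp add: matrix_left_right_inverse)
  with 1 show "invertible X" unfolding invertible_def by blast
qed

text \<open>Apply V to the left-inverse identity: V \<eta> X^T lists the products of V with the
  rows, and the inverse Gram matrix divides each by the square of its row. The square of F being 1 /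
  L0, its coefficient gets the factor L0.\<close>

lemma frame_expansion:
  assumes "L0 \<noteq> 0" "E \<noteq> 0" and g: "gram L0 X = gram0 L0 E"
  shows "V = (L0 * ip L0 V (X $ 1)) *\<^sub>R X $ 1 + (ip L0 V (X $ 2) / E) *\<^sub>R X $ 2 + (ip L0 V (X $ 3) / E) *\<^sub>R X $ 3
    + (ip L0 V (X $ 4) / E) *\<^sub>R X $ 4 + (ip L0 V (X $ 5) / E) *\<^sub>R X $ 5"
proof -
  have "V = V v* (metric_mat L0 ** transpose X ** gram0 (1 / L0) (1 / E) ** X)"
    unfolding frame_left_inverse[OF assms] by simp
  also have "\<dots> = (V v* (metric_mat L0 ** transpose X)) v* gram0 (1 / L0) (1 / E) v* X"
    by (simp add: vector_matrix_mul_assoc matrix_mul_assoc)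
  also have "V v* (metric_mat L0 ** transpose X) = (\<chi> i. ip L0 V (X $ i))"
    by (simp add: vec_eq_iff vector_matrix_mult_def ip_def matrix_matrix_mult_def metric_mat_def transpose_def sum_5)
  finally show ?thesis
    unfolding vec_eq_iff[of V]
    by (simp add: vector_matrix_mult_def sum_5 gram0_def)
qed

lemma frame_eqI:
  assumes "L0 \<noteq> 0" "E \<noteq> 0" "gram L0 X = gram0 L0 E"
    and "ip L0 V (X $ 1) = a / L0" "ip L0 V (X $ 2) = b * E" "ip L0 V (X $ 3) = c * E"
    "ip L0 V (X $ 4) = d * E" "ip L0 V (X $ 5) = e * E"
  shows "V = a *\<^sub>R X $ 1 + b *\<^sub>R X $ 2 + c *\<^sub>R X $ 3 + d *\<^sub>R X $ 4 + e *\<^sub>R X $ 5"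
  using frame_expansion[OF assms(1-3), of V] assms by simp

text \<open>Row i expands the u-derivative of the i-th of F, T1, T2, N1, N2 in this frame. The entry
  -f is the coefficient of F in F_uu: the product of F_uu with F is -e^(2 \<lambda>), and
  \<open>frame_expansion\<close> multiplies it by L0.\<close>

definition conn_u :: "real \<Rightarrow> real \<Rightarrow> real \<Rightarrow> real \<Rightarrow> real \<Rightarrow> real \<Rightarrow> real \<Rightarrow> real \<Rightarrow> real^5^5" where
  "conn_u f lu lv a1 a2 b1 b2 m1 = mat5 (vec5 0 1 0 0 0) (vec5 (-f) lu (-lv) a1 b1) (vec5 0 lv lu a2 b2)
     (vec5 0 (-a1) (-a2) lu m1) (vec5 0 (-b1) (-b2) (-m1) lu)"

definition conn_v :: "real \<Rightarrow> real \<Rightarrow> real \<Rightarrow> real \<Rightarrow> real \<Rightarrow> real \<Rightarrow> real \<Rightarrow> real \<Rightarrow> real^5^5" where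
  "conn_v f lu lv a2 a3 b2 b3 m2 = mat5 (vec5 0 0 1 0 0) (vec5 0 lv lu a2 b2) (vec5 (-f) (-lu) lv a3 b3)
     (vec5 0 (-a2) (-a3) lv m2) (vec5 0 (-b2) (-b3) (-m2) lv)"

lemma smooth_on_vec5:
  assumes "smooth_on D a" "smooth_on D b" "smooth_on D c" "smooth_on D d" "smooth_on D e"
  shows "smooth_on D (\<lambda>p. vec5 (a p) (b p) (c p) (d p) (e p))"
proof -
  have "smooth_on D (\<lambda>p. \<chi> i::5. (if i = 1 then a else if i = 2 then b else if i = 3 then c else if i = 4 then d else e) p)"
    using assms by (intro smooth_on_vec) (auto simp: smooth_on_def)
  then show ?thesis by (rule smooth_on_cong) (auto simp: vec5_def vec_eq_iff)
qed

lemma smooth_on_mat5: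
  assumes "smooth_on D a" "smooth_on D b" "smooth_on D c" "smooth_on D d" "smooth_on D e"
  shows "smooth_on D (\<lambda>p. mat5 (a p) (b p) (c p) (d p) (e p))"
proof -
  have "smooth_on D (\<lambda>p. \<chi> i::5. (if i = 1 then a else if i = 2 then b else if i = 3 then c else if i = 4 then d else e) p)"
    using assms by (intro smooth_on_vec) (auto simp: smooth_on_def)
  then show ?thesis by (rule smooth_on_cong) (auto simp: mat5_def vec_eq_iff)
qed

lemma smooth_on_conn:
  assumes "smooth_on D f" "smooth_on D lu" "smooth_on D lv" "smooth_on D a1" "smooth_on D a2" "smooth_on D a3"
    "smooth_on D b1" "smooth_on D b2" "smooth_on D b3" "smooth_on D m1" "smooth_on D m2"
  shows "smooth_on D (\<lambda>p. conn_u (f p) (lu p) (lv p) (a1 p) (a2 p) (b1 p) (b2 p) (m1 p))"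
    and "smooth_on D (\<lambda>p. conn_v (f p) (lu p) (lv p) (a2 p) (a3 p) (b2 p) (b3 p) (m2 p))"
proof -
  have D: "open D" using assms(1) by (simp add: smooth_on_def)
  note c = smooth_on_const[OF D]
  show "smooth_on D (\<lambda>p. conn_u (f p) (lu p) (lv p) (a1 p) (a2 p) (b1 p) (b2 p) (m1 p))"
    "smooth_on D (\<lambda>p. conn_v (f p) (lu p) (lv p) (a2 p) (a3 p) (b2 p) (b3 p) (m2 p))"
    unfolding conn_u_def conn_v_def
    by (intro smooth_on_mat5 smooth_on_vec5 smooth_on_minus c assms)+
qed

lemma pdir_nth:
  fixes f :: "pt \<Rightarrow> 'a::real_normed_vector ^ 'n"
  assumes "f differentiable (at p)"
  shows "pdir k f p $ i = pdir k (\<lambda>q. f q $ i) p"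
  by (rule pdir_linear[OF bounded_linear_vec_nth assms, symmetric])

lemma pdir_minus:
  assumes "f differentiable (at p)"
  shows "pdir k (\<lambda>q. - f q) p = - pdir k f p"
  by (rule pdir_linear[OF bounded_linear_minus[OF bounded_linear_ident] assms])

text \<open>The constant 1 in the first row has derivative 0, but \<open>conn_u\<close> and
  \<open>conn_v\<close> put it back whatever their arguments; the last summand removes it.\<close>

lemma pdir_conn:
  assumes "smooth_on D f" "smooth_on D lu" "smooth_on D lv" "smooth_on D a1" "smooth_on D a2" "smooth_on D a3"
    "smooth_on D b1" "smooth_on D b2" "smooth_on D b3" "smooth_on D m1" "smooth_on D m2" and p: "p \<in> D"
  shows "pdir k (\<lambda>p. conn_u (f p) (lu p) (lv p) (a1 p) (a2 p) (b1 p) (b2 p) (m1 p)) p =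
      conn_u (pdir k f p) (pdir k lu p) (pdir k lv p) (pdir k a1 p) (pdir k a2 p) (pdir k b1 p) (pdir k b2 p) (pdir k m1 p)
        - mat5 (vec5 0 1 0 0 0) 0 0 0 0" (is ?U)
    and "pdir k (\<lambda>p. conn_v (f p) (lu p) (lv p) (a2 p) (a3 p) (b2 p) (b3 p) (m2 p)) p =
      conn_v (pdir k f p) (pdir k lu p) (pdir k lv p) (pdir k a2 p) (pdir k a3 p) (pdir k b2 p) (pdir k b3 p) (pdir k m2 p)
        - mat5 (vec5 0 0 1 0 0) 0 0 0 0" (is ?V)
proof -
  note d = assms(1-11)[THEN smooth_on_differentiable, OF p]
  note s = smooth_on_conn[OF assms(1-11)]
  note dd = smooth_on_differentiable[OF s(1) p] smooth_on_differentiable[OF s(2) p]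
  note ddn = smooth_on_differentiable[OF smooth_on_nth[OF s(1)] p] smooth_on_differentiable[OF smooth_on_nth[OF s(2)] p]
  show ?U
    unfolding vec_eq_iff pdir_nth[OF dd(1)] pdir_nth[OF ddn(1)]
    by (simp add: forall_5 conn_u_def pdir_minus d)
  show ?V
    unfolding vec_eq_iff pdir_nth[OF dd(2)] pdir_nth[OF ddn(2)]
    by (simp add: forall_5 conn_v_def pdir_minus d)
qed

text \<open>The coefficients \<alpha> and \<beta> are differentiated and enter as functions. The
  first derivatives of \<lambda> and the \<mu> enter as numbers, so that the equations can be read
  as a linear system for them.\<close>

definition codazzi where
  "codazzi lu lv a1 a2 a3 b1 b2 b3 m1 m2 p \<longleftrightarrow>
     pv a1 p - pu a2 p = lv * a3 p + lu * a2 p + b1 p * m2 - b2 p * m1 \<and>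
     pv b1 p - pu b2 p = lv * b3 p + lu * b2 p - a1 p * m2 + a2 p * m1 \<and>
     pv a2 p - pu a3 p = - lu * a1 p - lv * a2 p + b2 p * m2 - b3 p * m1 \<and>
     pv b2 p - pu b3 p = - lu * b1 p - lv * b2 p - a2 p * m2 + (a3 p * m1 :: real)"

text \<open>Entry by entry, the first column gives f_u and f_v, the mixed tangent-normal entries the
  Codazzi equations, the tangent block the Gauss equation, the normal block the Ricci equation, and
  the diagonal the symmetry of the second derivatives of \<lambda>. Keeping \<open>f\<close>,
  \<open>lu\<close>, \<open>lv\<close> as separate functions makes the equivalence usable both for
  an existing immersion and for prescribed data.\<close>

lemma conn_flat_iff:
  assumes "smooth_on D f" "smooth_on D lu" "smooth_on D lv" "smooth_on D a1" "smooth_on D a2" "smooth_on D a3"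
    "smooth_on D b1" "smooth_on D b2" "smooth_on D b3" "smooth_on D m1" "smooth_on D m2" and p: "p \<in> D"
  defines "M \<equiv> \<lambda>p. conn_u (f p) (lu p) (lv p) (a1 p) (a2 p) (b1 p) (b2 p) (m1 p)"
    and "N \<equiv> \<lambda>p. conn_v (f p) (lu p) (lv p) (a2 p) (a3 p) (b2 p) (b3 p) (m2 p)"
  shows "pv M p + M p ** N p = pu N p + N p ** M p \<longleftrightarrow>
    codazzi (lu p) (lv p) a1 a2 a3 b1 b2 b3 (m1 p) (m2 p) p \<and>
    pu f p = 2 * lu p * f p \<and> pv f p = 2 * lv p * f p \<and> pv lu p = pu lv p \<and>
    a2 p * a2 p + b2 p * b2 p - a1 p * a3 p - b1 p * b3 p - pu lu p - pv lv p = f p \<and>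
    pv m1 p - pu m2 p = a1 p * b2 p + a2 p * b3 p - a2 p * b1 p - a3 p * b2 p"
  unfolding M_def N_def pdir_conn[OF assms(1-12)]
  unfolding mat5_eq_iff vector_add_component mult_mat5_nth
  unfolding conn_u_def conn_v_def codazzi_def vec_eq_iff forall_5
  apply simp
  apply (rule iffI; (elim conjE)?; (intro conjI)?; (simp only: algebra_simps)?; linarith?)
  done

text \<open>The right-hand side is a linear system for \<phi> and \<psi> whose determinant is
  -\<sigma> (W X + Y Z). The sign is carried by \<sigma>, so both cases are treated at once.\<close>

lemma Cramer_2:
  fixes W X Y Z y w \<phi> \<psi> \<sigma> :: real
  assumes "W * X + Y * Z \<noteq> 0" "\<sigma> * \<sigma> = 1"
  shows "- \<sigma> / (W * X + Y * Z) * (- X * y + Z * w) = \<phi> \<and> - 1 / (W * X + Y * Z) * (Y * y + W * w) = \<psi> \<longleftrightarrow>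
    y = \<sigma> * \<phi> * W - \<psi> * Z \<and> w = - \<sigma> * \<phi> * Y - \<psi> * X"
proof -
  let ?\<Delta> = "W * X + Y * Z"
  have "- \<sigma> / ?\<Delta> * (- X * y + Z * w) = \<phi> \<longleftrightarrow> X * y - Z * w = \<sigma> * \<phi> * ?\<Delta>"
  proof -
    have "- \<sigma> / ?\<Delta> * (- X * y + Z * w) = \<phi> \<longleftrightarrow> \<sigma> * (X * y - Z * w) = \<phi> * ?\<Delta>"
      using assms(1) by (simp add: field_simps)
    also have "\<dots> \<longleftrightarrow> X * y - Z * w = \<sigma> * \<phi> * ?\<Delta>"
      using assms(2) by algebra
    finally show ?thesis .
  qed
  moreover have "- 1 / ?\<Delta> * (Y * y + W * w) = \<psi> \<longleftrightarrow> Y * y + W * w = - \<psi> * ?\<Delta>"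
    using assms(1) by (auto simp add: field_simps)
  moreover have "X * y - Z * w = \<sigma> * \<phi> * ?\<Delta> \<and> Y * y + W * w = - \<psi> * ?\<Delta> \<longleftrightarrow>
    ?\<Delta> * y = ?\<Delta> * (\<sigma> * \<phi> * W - \<psi> * Z) \<and> ?\<Delta> * w = ?\<Delta> * (- \<sigma> * \<phi> * Y - \<psi> * X)" (is "?l \<longleftrightarrow> ?r")
  proof
    assume ?l then show ?r by algebra
  next
    assume ?r
    then have "y = \<sigma> * \<phi> * W - \<psi> * Z" "w = - \<sigma> * \<phi> * Y - \<psi> * X" using assms(1) mult_left_cancel by blast+
    then show ?l by algebra
  qed
  ultimately show ?thesis using assms(1) by simp
qed

lemma sg_simps [simp]: "sg True = 1" "sg False = -1" "sg s * sg s = 1"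
  by (simp_all add: sg_def)

text \<open>For each sign s, a sum or difference of Codazzi equations produces the two derivative
  expressions occurring in A for s and in B for the opposite sign. They form a linear system for
  \<phi> and \<psi> of these signs, with determinant \<Delta> of sign s up to sign. The pairs for
  the two values of s are together equivalent to the four equations.\<close>

lemma codazzi_iff:
  assumes D: "open D" "p \<in> D"
    and smooth: "smooth_on D a1" "smooth_on D a2" "smooth_on D a3" "smooth_on D b1" "smooth_on D b2" "smooth_on D b3"
    and W: "\<And>s q. q \<in> D \<Longrightarrow> W s q = a2 q + sg s * b1 q" and X: "\<And>s q. q \<in> D \<Longrightarrow> X s q = a2 q + sg s * b3 q"
    and Y: "\<And>s q. q \<in> D \<Longrightarrow> Y s q = b2 q + sg s * a1 q" and Z: "\<And>s q. q \<in> D \<Longrightarrow> Z s q = b2 q + sg s * a3 q"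
    and Dl: "\<And>s. Dl W X Y Z s p \<noteq> 0"
  shows "(\<forall>s. Acoef W X Y Z s p = lu - sg s * m2 \<and> Bcoef W X Y Z s p = lv - sg s * m1) \<longleftrightarrow>
    codazzi lu lv a1 a2 a3 b1 b2 b3 m1 m2 p"
proof -
  have pd: "pdir k f p = pdir k a p + sg s * pdir k b p"
    if "smooth_on D a" "smooth_on D b" "\<And>q. q \<in> D \<Longrightarrow> f q = a q + sg s * b q" for f a b s k
  proof -
    have "pdir k f p = pdir k (\<lambda>q. a q + sg s * b q) p"
      by (rule pdir_cong[OF D that(3)])
    also have "\<dots> = pdir k a p + pdir k (\<lambda>q. sg s * b q) p"
      by (intro pdir_add smooth_on_differentiable[OF _ D(2)] smooth_on_cmult that)
    also have "pdir k (\<lambda>q. sg s * b q) p = sg s * pdir k b p"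
      by (intro pdir_cmult smooth_on_differentiable[OF _ D(2)] that)
    finally show ?thesis .
  qed
  have pdW: "pdir k (W s) p = pdir k a2 p + sg s * pdir k b1 p"
    and pdX: "pdir k (X s) p = pdir k a2 p + sg s * pdir k b3 p"
    and pdY: "pdir k (Y s) p = pdir k b2 p + sg s * pdir k a1 p"
    and pdZ: "pdir k (Z s) p = pdir k b2 p + sg s * pdir k a3 p" for k s
    by (rule pd, (rule smooth)+, rule W X Y Z, assumption)+
  have *: "Acoef W X Y Z s p = lu - sg s * m2 \<and> Bcoef W X Y Z (\<not> s) p = lv - sg (\<not> s) * m1 \<longleftrightarrow>
    pv (Y s) p - sg s * pu (X s) p = sg s * (lu - sg s * m2) * W (\<not> s) p - (lv - sg (\<not> s) * m1) * Z (\<not> s) p \<and>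
    pv (W (\<not> s)) p + sg s * pu (Z (\<not> s)) p = - sg s * (lu - sg s * m2) * Y s p - (lv - sg (\<not> s) * m1) * X s p" for s
    using Cramer_2[of "W (\<not> s) p" "X s p" "Y s p" "Z (\<not> s) p" "sg s"] Dl[of s]
    by (simp add: Acoef_def Bcoef_def Dl_def)
  \<comment> \<open>A of sign s shares its determinant with B of the opposite sign; over both values
    of s, the claims about B may be reindexed accordingly.\<close>
  have "(\<forall>s. Acoef W X Y Z s p = lu - sg s * m2 \<and> Bcoef W X Y Z s p = lv - sg s * m1) \<longleftrightarrow>
    (\<forall>s. Acoef W X Y Z s p = lu - sg s * m2 \<and> Bcoef W X Y Z (\<not> s) p = lv - sg (\<not> s) * m1)"
    by (auto simp: all_bool_eq)
  also have "\<dots> \<longleftrightarrow> codazzi lu lv a1 a2 a3 b1 b2 b3 m1 m2 p"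
    unfolding * pdW pdX pdY pdZ W[OF D(2)] X[OF D(2)] Y[OF D(2)] Z[OF D(2)] all_bool_eq codazzi_def
    by (rule iffI; elim conjE; (intro conjI)?; (simp add: algebra_simps)?; linarith?)
  finally show ?thesis .
qed

lemma invertible_mult_right_cancel:
  fixes A :: "real^'n^'n"
  assumes "invertible X" "A ** X = B ** X"
  shows "A = B"
proof -
  obtain R where R: "X ** R = mat 1" using assms(1) unfolding invertible_def by blast
  have "A ** X ** R = B ** X ** R" using assms(2) by simp
  then show ?thesis by (simp add: matrix_mul_assoc[symmetric] R)
qed

section \<open>Structure equations of a given conformal immersion\<close>

locale surface =
  fixes L0 :: real and D :: "pt set" and F N1 N2 :: "pt \<Rightarrow> real^5" and lam :: "pt \<Rightarrow> real" and ori :: "real^5 \<Rightarrow> real"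
  assumes L0: "L0 \<noteq> 0" and conf: "conf_frame L0 D F lam N1 N2 ori"
begin

abbreviation "E p \<equiv> exp (2 * lam p)"
abbreviation "a1 \<equiv> alpha L0 F N1 N2 1"
abbreviation "a2 \<equiv> alpha L0 F N1 N2 2"
abbreviation "a3 \<equiv> alpha L0 F N1 N2 3"
abbreviation "b1 \<equiv> beta L0 F N1 N2 1"
abbreviation "b2 \<equiv> beta L0 F N1 N2 2"
abbreviation "b3 \<equiv> beta L0 F N1 N2 3"
abbreviation "m1 \<equiv> mu L0 F N1 N2 1"
abbreviation "m2 \<equiv> mu L0 F N1 N2 2"

definition frame :: "pt \<Rightarrow> real^5^5" where
  "frame p = mat5 (F p) (pu F p) (pv F p) (N1 p) (N2 p)"

lemma open_D: "open D" using conf by (simp add: conf_frame_def)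

lemma smooth_frame_rows:
  "smooth_on D F" "smooth_on D N1" "smooth_on D N2" "smooth_on D (pu F)" "smooth_on D (pv F)"
  using conf smooth_on_pdir by (auto simp: conf_frame_def)

lemma
  assumes "p \<in> D"
  shows ip_FF: "ip L0 (F p) (F p) = 1 / L0"
    and ip_uu: "ip L0 (pu F p) (pu F p) = E p" and ip_vv: "ip L0 (pv F p) (pv F p) = E p"
    and ip_uv: "ip L0 (pu F p) (pv F p) = 0"
    and ip_1F: "ip L0 (N1 p) (F p) = 0" and ip_2F: "ip L0 (N2 p) (F p) = 0"
    and ip_1u: "ip L0 (N1 p) (pu F p) = 0" and ip_1v: "ip L0 (N1 p) (pv F p) = 0"
    and ip_2u: "ip L0 (N2 p) (pu F p) = 0" and ip_2v: "ip L0 (N2 p) (pv F p) = 0"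
    and ip_11: "ip L0 (N1 p) (N1 p) = E p" and ip_22: "ip L0 (N2 p) (N2 p) = E p"
    and ip_12: "ip L0 (N1 p) (N2 p) = 0"
  using conf assms by (simp_all add: conf_frame_def spform_def)

text \<open>\<open>conf_frame\<close> asks smoothness of F, N1 and N2; \<lambda> inherits it as half
  the logarithm of the square of F_u.\<close>

lemma smooth_lam: "smooth_on D lam"
proof -
  have "smooth_on D (\<lambda>p. (1 / 2) * ln (ip L0 (pu F p) (pu F p)))"
    by (intro smooth_on_cmult smooth_on_ln smooth_on_bilinear[OF bounded_bilinear_ip] smooth_frame_rows) (simp add: ip_uu)
  then show ?thesis by (rule smooth_on_cong) (simp add: ip_uu)
qed

lemma pdir_E: "p \<in> D \<Longrightarrow> pdir k E p = 2 * pdir k lam p * E p"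
proof -
  assume p: "p \<in> D"
  have "pdir k (\<lambda>q. exp (2 * lam q)) p = exp (2 * lam p) * pdir k (\<lambda>q. 2 * lam q) p"
    by (rule pdir_compose[OF DERIV_exp smooth_on_differentiable[OF smooth_on_cmult[OF smooth_lam] p]])
  then show ?thesis
    by (simp add: pdir_cmult[OF smooth_on_differentiable[OF smooth_lam p]])
qed

lemma pdir_ip:
  assumes "p \<in> D" "smooth_on D a" "smooth_on D b" "\<And>q. q \<in> D \<Longrightarrow> ip L0 (a q) (b q) = g q"
  shows "ip L0 (a p) (pdir k b p) + ip L0 (pdir k a p) (b p) = pdir k g p"
  using pdir_bilinear[OF bounded_bilinear_ip smooth_on_differentiable[OF assms(2,1)] smooth_on_differentiable[OF assms(3,1)], of k L0]
    pdir_cong[OF open_D assms(1), of "\<lambda>q. ip L0 (a q) (b q)" g k] assms(4) by simp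

lemma ip_F_pdir: "p \<in> D \<Longrightarrow> ip L0 (F p) (pdir k F p) = 0"
  using pdir_ip[OF _ smooth_frame_rows(1,1) ip_FF, of p k] by (simp add: ip_commute)

lemma gram_frame: "p \<in> D \<Longrightarrow> gram L0 (frame p) = gram0 L0 (E p)"
  by (simp add: mat5_eq_iff) (simp add: vec_eq_iff forall_5 gram_def frame_def gram0_def ip_FF ip_uu ip_vv ip_uv
      ip_1F ip_2F ip_1u ip_1v ip_2u ip_2v ip_11 ip_22 ip_12 ip_F_pdir
      ip_commute[of _ "pu F p" "F p"] ip_commute[of _ "pv F p" "F p"] ip_commute[of _ "pv F p" "pu F p"]
      ip_commute[of _ "F p" "N1 p"] ip_commute[of _ "F p" "N2 p"] ip_commute[of _ "pu F p" "N1 p"] ip_commute[of _ "pu F p" "N2 p"]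
      ip_commute[of _ "pv F p" "N1 p"] ip_commute[of _ "pv F p" "N2 p"] ip_commute[of _ "N2 p" "N1 p"])

lemma ncoef_nproj:
  assumes "p \<in> D"
  shows "ncoef L0 N1 p (nproj L0 N1 N2 p V) = ip L0 V (N1 p) / E p"
    and "ncoef L0 N2 p (nproj L0 N1 N2 p V) = ip L0 V (N2 p) / E p"
  using assms by (simp_all add: ncoef_def nproj_def ip.add_left ip.scaleR_left ip_11 ip_22 ip_12 ip_commute[of _ "N2 p" "N1 p"])

lemma ip_covD:
  assumes "p \<in> D"
  shows "ip L0 (covD L0 F k V p) (N1 p) = ip L0 (pdir k V p) (N1 p)"
    and "ip L0 (covD L0 F k V p) (N2 p) = ip L0 (pdir k V p) (N2 p)"
  using assms ip_1F ip_2F by (simp_all add: covD_def ip.diff_left ip.scaleR_left ip_commute[of _ "F p"])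

lemma alpha_beta_mu_eq:
  assumes "p \<in> D"
  shows "a1 p = ip L0 (pu (pu F) p) (N1 p) / E p" "b1 p = ip L0 (pu (pu F) p) (N2 p) / E p"
    and "a2 p = ip L0 (pv (pu F) p) (N1 p) / E p" "b2 p = ip L0 (pv (pu F) p) (N2 p) / E p"
    and "a3 p = ip L0 (pv (pv F) p) (N1 p) / E p" "b3 p = ip L0 (pv (pv F) p) (N2 p) / E p"
    and "m1 p = ip L0 (pu N1 p) (N2 p) / E p" "m2 p = ip L0 (pv N1 p) (N2 p) / E p"
  using assms by (simp_all add: alpha_def beta_def mu_def sff_def ncoef_nproj ip_covD)

lemma smooth_coeffs:
  "smooth_on D a1" "smooth_on D a2" "smooth_on D a3" "smooth_on D b1" "smooth_on D b2" "smooth_on D b3"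
  "smooth_on D m1" "smooth_on D m2"
proof -
  have "smooth_on D E" by (intro smooth_on_exp smooth_on_cmult smooth_lam)
  then have *: "smooth_on D (\<lambda>p. ip L0 (V p) (N p) / E p)" if "smooth_on D V" "smooth_on D N" for V N
    by (intro smooth_on_divide smooth_on_bilinear[OF bounded_bilinear_ip] that) auto
  note ** = smooth_on_cong[OF * alpha_beta_mu_eq(1)[symmetric]] smooth_on_cong[OF * alpha_beta_mu_eq(2)[symmetric]]
    smooth_on_cong[OF * alpha_beta_mu_eq(3)[symmetric]] smooth_on_cong[OF * alpha_beta_mu_eq(4)[symmetric]]
    smooth_on_cong[OF * alpha_beta_mu_eq(5)[symmetric]] smooth_on_cong[OF * alpha_beta_mu_eq(6)[symmetric]]
    smooth_on_cong[OF * alpha_beta_mu_eq(7)[symmetric]] smooth_on_cong[OF * alpha_beta_mu_eq(8)[symmetric]]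
  show "smooth_on D a1" "smooth_on D a2" "smooth_on D a3" "smooth_on D b1" "smooth_on D b2" "smooth_on D b3"
    "smooth_on D m1" "smooth_on D m2"
    by (rule **; (intro smooth_on_pdir smooth_frame_rows)?; assumption?)+
qed

abbreviation "M p \<equiv> conn_u (L0 * E p) (pu lam p) (pv lam p) (a1 p) (a2 p) (b1 p) (b2 p) (m1 p)"
abbreviation "N p \<equiv> conn_v (L0 * E p) (pu lam p) (pv lam p) (a2 p) (a3 p) (b2 p) (b3 p) (m2 p)"

text \<open>Each identity comes from differentiating one entry of the Gram matrix of the frame.
  Together with the symmetry of F_uv they fix the derivatives of the frame up to \<alpha>, \<beta>
  and \<mu>.\<close>

lemma
  assumes p: "p \<in> D"
  shows ip_second_F: "ip L0 (pdir k (pdir l F) p) (F p) = - ip L0 (pdir l F p) (pdir k F p)"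
    and ip_second_uu: "ip L0 (pdir k (pu F) p) (pu F p) = pdir k lam p * E p"
    and ip_second_vv: "ip L0 (pdir k (pv F) p) (pv F p) = pdir k lam p * E p"
    and ip_second_uv: "ip L0 (pdir k (pu F) p) (pv F p) = - ip L0 (pdir k (pv F) p) (pu F p)"
    and ip_N_F: "ip L0 (pdir k N1 p) (F p) = - ip L0 (N1 p) (pdir k F p)" "ip L0 (pdir k N2 p) (F p) = - ip L0 (N2 p) (pdir k F p)"
    and ip_N1_u: "ip L0 (pdir k N1 p) (pu F p) = - ip L0 (pdir k (pu F) p) (N1 p)"
    and ip_N1_v: "ip L0 (pdir k N1 p) (pv F p) = - ip L0 (pdir k (pv F) p) (N1 p)"
    and ip_N2_u: "ip L0 (pdir k N2 p) (pu F p) = - ip L0 (pdir k (pu F) p) (N2 p)"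
    and ip_N2_v: "ip L0 (pdir k N2 p) (pv F p) = - ip L0 (pdir k (pv F) p) (N2 p)"
    and ip_N1_N1: "ip L0 (pdir k N1 p) (N1 p) = pdir k lam p * E p"
    and ip_N2_N2: "ip L0 (pdir k N2 p) (N2 p) = pdir k lam p * E p"
    and ip_N2_N1: "ip L0 (pdir k N2 p) (N1 p) = - ip L0 (pdir k N1 p) (N2 p)"
proof -
  note s = smooth_frame_rows and c = ip_commute[of L0] and e = eq_neg_iff_add_eq_0
  have F: "ip L0 (pdir l F q) (F q) = 0" if "q \<in> D" for q
    using ip_F_pdir[OF that] c by metis
  show "ip L0 (pdir k (pdir l F) p) (F p) = - ip L0 (pdir l F p) (pdir k F p)"
    using pdir_ip[OF p smooth_on_pdir[OF s(1)] s(1) F, of k] by (simp add: add.commute eq_neg_iff_add_eq_0)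
  show "ip L0 (pdir k (pu F) p) (pu F p) = pdir k lam p * E p"
    using pdir_ip[OF p s(4,4) ip_uu, of k] by (simp add: pdir_E p c[of "pu F p"])
  show "ip L0 (pdir k (pv F) p) (pv F p) = pdir k lam p * E p"
    using pdir_ip[OF p s(5,5) ip_vv, of k] by (simp add: pdir_E p c[of "pv F p"])
  show "ip L0 (pdir k (pu F) p) (pv F p) = - ip L0 (pdir k (pv F) p) (pu F p)"
    using pdir_ip[OF p s(4,5) ip_uv, of k] by (simp add: e c[of "pu F p"] add.commute)
  show "ip L0 (pdir k N1 p) (F p) = - ip L0 (N1 p) (pdir k F p)"
    using pdir_ip[OF p s(2,1) ip_1F, of k] by (simp add: e add.commute)
  show "ip L0 (pdir k N2 p) (F p) = - ip L0 (N2 p) (pdir k F p)"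
    using pdir_ip[OF p s(3,1) ip_2F, of k] by (simp add: e add.commute)
  show "ip L0 (pdir k N1 p) (pu F p) = - ip L0 (pdir k (pu F) p) (N1 p)"
    using pdir_ip[OF p s(2,4) ip_1u, of k] by (simp add: e c[of "N1 p"] add.commute)
  show "ip L0 (pdir k N1 p) (pv F p) = - ip L0 (pdir k (pv F) p) (N1 p)"
    using pdir_ip[OF p s(2,5) ip_1v, of k] by (simp add: e c[of "N1 p"] add.commute)
  show "ip L0 (pdir k N2 p) (pu F p) = - ip L0 (pdir k (pu F) p) (N2 p)"
    using pdir_ip[OF p s(3,4) ip_2u, of k] by (simp add: e c[of "N2 p"] add.commute)
  show "ip L0 (pdir k N2 p) (pv F p) = - ip L0 (pdir k (pv F) p) (N2 p)"
    using pdir_ip[OF p s(3,5) ip_2v, of k] by (simp add: e c[of "N2 p"] add.commute)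
  show "ip L0 (pdir k N1 p) (N1 p) = pdir k lam p * E p"
    using pdir_ip[OF p s(2,2) ip_11, of k] by (simp add: pdir_E p c[of "N1 p"])
  show "ip L0 (pdir k N2 p) (N2 p) = pdir k lam p * E p"
    using pdir_ip[OF p s(3,3) ip_22, of k] by (simp add: pdir_E p c[of "N2 p"])
  show "ip L0 (pdir k N2 p) (N1 p) = - ip L0 (pdir k N1 p) (N2 p)"
    using pdir_ip[OF p s(2,3) ip_12, of k] by (simp add: e c[of "N1 p"] add.commute)
qed

lemma smooth_frame: "smooth_on D frame"
  unfolding frame_def[abs_def] by (intro smooth_on_mat5 smooth_frame_rows)

lemma pdir_frame:
  assumes p: "p \<in> D"
  shows "pdir k frame p = mat5 (pdir k F p) (pdir k (pu F) p) (pdir k (pv F) p) (pdir k N1 p) (pdir k N2 p)"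
  unfolding mat5_eq_iff pdir_nth[OF smooth_on_differentiable[OF smooth_frame p]]
  by (simp add: frame_def)

lemma frame_nth [simp]: "frame p $ 1 = F p" "frame p $ 2 = pu F p" "frame p $ 3 = pv F p" "frame p $ 4 = N1 p" "frame p $ 5 = N2 p"
  by (simp_all add: frame_def)

lemma frame_eqs:
  assumes p: "p \<in> D"
  shows "pu frame p = M p ** frame p" "pv frame p = N p ** frame p"
proof -
  have E: "E p \<noteq> 0" by simp
  note ex = frame_eqI[OF L0 E gram_frame[OF p]]
  have clairaut_F: "pu (pv F) p = pv (pu F) p" by (rule clairaut[OF smooth_frame_rows(1) p])
  have abm: "ip L0 (pu (pu F) p) (N1 p) = a1 p * E p" "ip L0 (pu (pu F) p) (N2 p) = b1 p * E p"
    "ip L0 (pv (pu F) p) (N1 p) = a2 p * E p" "ip L0 (pv (pu F) p) (N2 p) = b2 p * E p"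
    "ip L0 (pv (pv F) p) (N1 p) = a3 p * E p" "ip L0 (pv (pv F) p) (N2 p) = b3 p * E p"
    "ip L0 (pu N1 p) (N2 p) = m1 p * E p" "ip L0 (pv N1 p) (N2 p) = m2 p * E p"
    using alpha_beta_mu_eq[OF p] by simp_all
  \<comment> \<open>Since F_uv = F_vu, the product with T2 is half the u-derivative of the square of
    T2. The other tangential products reduce to derivatives of \<lambda> in the same way.\<close>
  have vu: "ip L0 (pv (pu F) p) (pv F p) = pu lam p * E p"
    using ip_second_vv[OF p, of 1] clairaut_F by simp
  have uv: "ip L0 (pu (pu F) p) (pv F p) = - (pv lam p * E p)" "ip L0 (pv (pv F) p) (pu F p) = - (pu lam p * E p)"
    using ip_second_uv[OF p, of 1] ip_second_uv[OF p, of 2] ip_second_uu[OF p, of 2] clairaut_F vu by simp_all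
  note facts = ip_second_F[OF p] ip_second_uu[OF p] ip_second_vv[OF p] ip_N_F[OF p] ip_N1_u[OF p] ip_N1_v[OF p]
    ip_N2_u[OF p] ip_N2_v[OF p] ip_N1_N1[OF p] ip_N2_N2[OF p] ip_N2_N1[OF p] abm uv clairaut_F
    ip_uu[OF p] ip_vv[OF p] ip_uv[OF p] ip_1u[OF p] ip_2u[OF p] ip_1v[OF p] ip_2v[OF p] ip_commute[of L0 "pv F p" "pu F p"]
  have *: "pu (pu F) p = (- (L0 * E p)) *\<^sub>R frame p $ 1 + pu lam p *\<^sub>R frame p $ 2 + (- pv lam p) *\<^sub>R frame p $ 3 + a1 p *\<^sub>R frame p $ 4 + b1 p *\<^sub>R frame p $ 5"
    "pv (pu F) p = 0 *\<^sub>R frame p $ 1 + pv lam p *\<^sub>R frame p $ 2 + pu lam p *\<^sub>R frame p $ 3 + a2 p *\<^sub>R frame p $ 4 + b2 p *\<^sub>R frame p $ 5"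
    "pv (pv F) p = (- (L0 * E p)) *\<^sub>R frame p $ 1 + (- pu lam p) *\<^sub>R frame p $ 2 + pv lam p *\<^sub>R frame p $ 3 + a3 p *\<^sub>R frame p $ 4 + b3 p *\<^sub>R frame p $ 5"
    "pu N1 p = 0 *\<^sub>R frame p $ 1 + (- a1 p) *\<^sub>R frame p $ 2 + (- a2 p) *\<^sub>R frame p $ 3 + pu lam p *\<^sub>R frame p $ 4 + m1 p *\<^sub>R frame p $ 5"
    "pv N1 p = 0 *\<^sub>R frame p $ 1 + (- a2 p) *\<^sub>R frame p $ 2 + (- a3 p) *\<^sub>R frame p $ 3 + pv lam p *\<^sub>R frame p $ 4 + m2 p *\<^sub>R frame p $ 5"
    "pu N2 p = 0 *\<^sub>R frame p $ 1 + (- b1 p) *\<^sub>R frame p $ 2 + (- b2 p) *\<^sub>R frame p $ 3 + (- m1 p) *\<^sub>R frame p $ 4 + pu lam p *\<^sub>R frame p $ 5"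
    "pv N2 p = 0 *\<^sub>R frame p $ 1 + (- b2 p) *\<^sub>R frame p $ 2 + (- b3 p) *\<^sub>R frame p $ 3 + (- m2 p) *\<^sub>R frame p $ 4 + pv lam p *\<^sub>R frame p $ 5"
    by (rule ex; (simp add: facts vu L0)?)+
  show "pu frame p = M p ** frame p" "pv frame p = N p ** frame p"
    unfolding mat5_eq_iff pdir_frame[OF p] mult_mat5_nth conn_u_def conn_v_def mat5_nth vec5_nth clairaut_F *
    by (simp_all only: frame_nth) simp_all
qed

lemma solves_frame: "solves (**) D M N frame"
  unfolding solves_def[OF bounded_bilinear_matrix_mult]
  using frame_eqs has_derivative_pdir[OF smooth_on_differentiable[OF smooth_frame]] by auto

lemma smooth_f: "smooth_on D (\<lambda>p. L0 * E p)"
  by (intro smooth_on_exp smooth_on_cmult smooth_lam)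

lemmas smooth_data = smooth_f smooth_on_pdir[OF smooth_lam, of 1] smooth_on_pdir[OF smooth_lam, of 2] smooth_coeffs

text \<open>The mixed second derivatives of the frame agree, and the frame is invertible, so it can
  be cancelled from them; this leaves the flatness equation for the coefficient matrices.\<close>

lemma codazzi:
  assumes p: "p \<in> D"
  shows "codazzi (pu lam p) (pv lam p) a1 a2 a3 b1 b2 b3 (m1 p) (m2 p) p"
proof -
  note sM = smooth_on_conn[OF smooth_data]
  note bl = bounded_bilinear_matrix_mult
  have inv: "invertible (frame p)"
    by (rule frame_invertible[OF L0 _ gram_frame[OF p]]) simp
  note d = smooth_on_differentiable[OF sM(1) p] smooth_on_differentiable[OF sM(2) p] smooth_on_differentiable[OF smooth_frame p]
  have "pv (pu frame) p = pv (\<lambda>p. M p ** frame p) p"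
    by (rule pdir_cong[OF open_D p frame_eqs(1)])
  also have "\<dots> = (pv M p + M p ** N p) ** frame p"
    unfolding pdir_bilinear[OF bl d(1,3)] frame_eqs[OF p] bounded_bilinear.add_left[OF bl] by (simp add: matrix_mul_assoc)
  finally have 1: "pv (pu frame) p = (pv M p + M p ** N p) ** frame p" .
  have "pu (pv frame) p = pu (\<lambda>p. N p ** frame p) p"
    by (rule pdir_cong[OF open_D p frame_eqs(2)])
  also have "\<dots> = (pu N p + N p ** M p) ** frame p"
    unfolding pdir_bilinear[OF bl d(2,3)] frame_eqs[OF p] bounded_bilinear.add_left[OF bl] by (simp add: matrix_mul_assoc)
  finally have "(pv M p + M p ** N p) ** frame p = (pu N p + N p ** M p) ** frame p"
    using 1 clairaut[OF smooth_frame p] by simp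
  then have "pv M p + M p ** N p = pu N p + N p ** M p"
    by (rule invertible_mult_right_cancel[OF inv])
  then show ?thesis
    using conn_flat_iff[OF smooth_data p] by simp
qed

text \<open>Agreement is asked only on D because the uniqueness argument applies this to prescribed
  functions, which may differ from the associated ones outside. As D is open, the derivatives agree
  as well.\<close>

lemma Acoef_Bcoef:
  assumes p: "p \<in> D"
    and W: "\<And>s q. q \<in> D \<Longrightarrow> W s q = assocW L0 F N1 N2 s q" and X: "\<And>s q. q \<in> D \<Longrightarrow> X s q = assocX L0 F N1 N2 s q"
    and Y: "\<And>s q. q \<in> D \<Longrightarrow> Y s q = assocY L0 F N1 N2 s q" and Z: "\<And>s q. q \<in> D \<Longrightarrow> Z s q = assocZ L0 F N1 N2 s q"
    and Dl: "\<And>s. Dl W X Y Z s p \<noteq> 0"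
  shows "Acoef W X Y Z s p = pu lam p - sg s * m2 p" "Bcoef W X Y Z s p = pv lam p - sg s * m1 p"
  using codazzi_iff[OF open_D p smooth_coeffs(1-6) W[unfolded assocW_def] X[unfolded assocX_def]
      Y[unfolded assocY_def] Z[unfolded assocZ_def] Dl] codazzi[OF p] by blast+

end

section \<open>Twistor lifts\<close>

context surface
begin

lemma gauss_weingarten:
  assumes p: "p \<in> D"
  shows "pu (pu F) p = - (L0 * E p) *\<^sub>R F p + pu lam p *\<^sub>R pu F p - pv lam p *\<^sub>R pv F p + a1 p *\<^sub>R N1 p + b1 p *\<^sub>R N2 p"
    and "pv (pu F) p = pv lam p *\<^sub>R pu F p + pu lam p *\<^sub>R pv F p + a2 p *\<^sub>R N1 p + b2 p *\<^sub>R N2 p"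
    and "pu (pv F) p = pv lam p *\<^sub>R pu F p + pu lam p *\<^sub>R pv F p + a2 p *\<^sub>R N1 p + b2 p *\<^sub>R N2 p"
    and "pv (pv F) p = - (L0 * E p) *\<^sub>R F p - pu lam p *\<^sub>R pu F p + pv lam p *\<^sub>R pv F p + a3 p *\<^sub>R N1 p + b3 p *\<^sub>R N2 p"
    and "pu N1 p = - a1 p *\<^sub>R pu F p - a2 p *\<^sub>R pv F p + pu lam p *\<^sub>R N1 p + m1 p *\<^sub>R N2 p"
    and "pv N1 p = - a2 p *\<^sub>R pu F p - a3 p *\<^sub>R pv F p + pv lam p *\<^sub>R N1 p + m2 p *\<^sub>R N2 p"
    and "pu N2 p = - b1 p *\<^sub>R pu F p - b2 p *\<^sub>R pv F p - m1 p *\<^sub>R N1 p + pu lam p *\<^sub>R N2 p"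
    and "pv N2 p = - b2 p *\<^sub>R pu F p - b3 p *\<^sub>R pv F p - m2 p *\<^sub>R N1 p + pv lam p *\<^sub>R N2 p"
  using frame_eqs[OF p] unfolding pdir_frame[OF p] mat5_eq_iff mult_mat5_nth conn_u_def conn_v_def mat5_nth vec5_nth frame_nth
  by (simp_all del: frame_nth)

text \<open>The derivative of e^(-\<lambda>) cancels the term \<lambda>_k R, and the projection to N
  removes the multiple of F.\<close>

lemma covD_rescaled:
  assumes p: "p \<in> D" and R: "smooth_on D R"
    and R': "pdir k R p = x *\<^sub>R F p + pdir k lam p *\<^sub>R R p + y" and "ip L0 (R p) (F p) = 0" and "ip L0 y (F p) = 0"
  shows "covD L0 F k (\<lambda>q. exp (- lam q) *\<^sub>R R q) p = exp (- lam p) *\<^sub>R y"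
proof -
  note dl = smooth_on_differentiable[OF smooth_on_minus[OF smooth_lam] p]
  have "pdir k (\<lambda>q. exp (- lam q)) p = - (exp (- lam p) * pdir k lam p)"
    using pdir_compose[OF DERIV_exp dl] by (simp add: pdir_minus[OF smooth_on_differentiable[OF smooth_lam p]])
  then have "pdir k (\<lambda>q. exp (- lam q) *\<^sub>R R q) p = exp (- lam p) *\<^sub>R (x *\<^sub>R F p + y)"
    using pdir_scaleR[OF differentiable_compose_real[OF DERIV_exp dl] smooth_on_differentiable[OF R p], of k]
    by (simp add: R' algebra_simps)
  then show ?thesis
    using assms L0 by (simp add: covD_def ip.add_left ip.scaleR_left ip_FF algebra_simps)
qed

lemma covD_eframe:
  assumes p: "p \<in> D"
  defines "e \<equiv> exp (- lam p)" and "C \<equiv> \<lambda>k a. covD L0 F k (eframe F lam N1 N2 a) p"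
  shows "C 1 1 = e *\<^sub>R (- pv lam p *\<^sub>R pv F p + a1 p *\<^sub>R N1 p + b1 p *\<^sub>R N2 p)"
    and "C 2 1 = e *\<^sub>R (pu lam p *\<^sub>R pv F p + a2 p *\<^sub>R N1 p + b2 p *\<^sub>R N2 p)"
    and "C 1 2 = e *\<^sub>R (pv lam p *\<^sub>R pu F p + a2 p *\<^sub>R N1 p + b2 p *\<^sub>R N2 p)"
    and "C 2 2 = e *\<^sub>R (- pu lam p *\<^sub>R pu F p + a3 p *\<^sub>R N1 p + b3 p *\<^sub>R N2 p)"
    and "C 1 3 = e *\<^sub>R (- a1 p *\<^sub>R pu F p - a2 p *\<^sub>R pv F p + m1 p *\<^sub>R N2 p)"
    and "C 2 3 = e *\<^sub>R (- a2 p *\<^sub>R pu F p - a3 p *\<^sub>R pv F p + m2 p *\<^sub>R N2 p)"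
    and "C 1 4 = e *\<^sub>R (- b1 p *\<^sub>R pu F p - b2 p *\<^sub>R pv F p - m1 p *\<^sub>R N1 p)"
    and "C 2 4 = e *\<^sub>R (- b2 p *\<^sub>R pu F p - b3 p *\<^sub>R pv F p - m2 p *\<^sub>R N1 p)"
proof -
  have ef: "eframe F lam N1 N2 1 = (\<lambda>p. exp (- lam p) *\<^sub>R pu F p)" "eframe F lam N1 N2 2 = (\<lambda>p. exp (- lam p) *\<^sub>R pv F p)"
    "eframe F lam N1 N2 3 = (\<lambda>p. exp (- lam p) *\<^sub>R N1 p)" "eframe F lam N1 N2 4 = (\<lambda>p. exp (- lam p) *\<^sub>R N2 p)"
    by (simp_all add: eframe_def[abs_def])
  have F: "ip L0 (pdir k F p) (F p) = 0" for k using ip_F_pdir[OF p] ip_commute by metis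
  note c = covD_rescaled[OF p, where x = 0] covD_rescaled[OF p, where x = "- (L0 * E p)"]
  note s = smooth_frame_rows and gw = gauss_weingarten[OF p]
  note z = F ip_1F[OF p] ip_2F[OF p] ip.add_left ip.diff_left ip.minus_left ip.scaleR_left
  show "C 1 1 = e *\<^sub>R (- pv lam p *\<^sub>R pv F p + a1 p *\<^sub>R N1 p + b1 p *\<^sub>R N2 p)"
    unfolding C_def e_def ef by (rule c(2)[OF s(4)]) (simp_all add: gw z)
  show "C 2 1 = e *\<^sub>R (pu lam p *\<^sub>R pv F p + a2 p *\<^sub>R N1 p + b2 p *\<^sub>R N2 p)"
    unfolding C_def e_def ef by (rule c(1)[OF s(4)]) (simp_all add: gw z)
  show "C 1 2 = e *\<^sub>R (pv lam p *\<^sub>R pu F p + a2 p *\<^sub>R N1 p + b2 p *\<^sub>R N2 p)"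
    unfolding C_def e_def ef by (rule c(1)[OF s(5)]) (simp_all add: gw z)
  show "C 2 2 = e *\<^sub>R (- pu lam p *\<^sub>R pu F p + a3 p *\<^sub>R N1 p + b3 p *\<^sub>R N2 p)"
    unfolding C_def e_def ef by (rule c(2)[OF s(5)]) (simp_all add: gw z)
  show "C 1 3 = e *\<^sub>R (- a1 p *\<^sub>R pu F p - a2 p *\<^sub>R pv F p + m1 p *\<^sub>R N2 p)"
    unfolding C_def e_def ef by (rule c(1)[OF s(2)]) (simp_all add: gw z)
  show "C 2 3 = e *\<^sub>R (- a2 p *\<^sub>R pu F p - a3 p *\<^sub>R pv F p + m2 p *\<^sub>R N2 p)"
    unfolding C_def e_def ef by (rule c(1)[OF s(2)]) (simp_all add: gw z)
  show "C 1 4 = e *\<^sub>R (- b1 p *\<^sub>R pu F p - b2 p *\<^sub>R pv F p - m1 p *\<^sub>R N1 p)"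
    unfolding C_def e_def ef by (rule c(1)[OF s(3)]) (simp_all add: gw z)
  show "C 2 4 = e *\<^sub>R (- b2 p *\<^sub>R pu F p - b3 p *\<^sub>R pv F p - m2 p *\<^sub>R N1 p)"
    unfolding C_def e_def ef by (rule c(1)[OF s(3)]) (simp_all add: gw z)
qed

text \<open>Up to scale, \<open>Om2\<close> and \<open>Om3\<close> are e1 \<and> e3 \<plusminus> e4
  \<and> e2 and e1 \<and> e4 \<plusminus> e2 \<and> e3, which complete the twistor lift to an
  orthogonal basis of the self-dual or anti-self-dual bivectors.\<close>

definition Om2 :: "bool \<Rightarrow> pt \<Rightarrow> real^5^5" where
  "Om2 s p = wedge (pu F p) (N1 p) + sg s *\<^sub>R wedge (N2 p) (pv F p)"

definition Om3 :: "bool \<Rightarrow> pt \<Rightarrow> real^5^5" where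
  "Om3 s p = wedge (pu F p) (N2 p) + sg s *\<^sub>R wedge (pv F p) (N1 p)"

text \<open>The lift has constant length and stays in its half of the bivectors, so its derivative
  has components only along the other two basis vectors. In c, each of the two factors of a wedge
  product contributes e^(-\<lambda>).\<close>

lemma twistor_cov_eq:
  assumes p: "p \<in> D"
  defines "c \<equiv> exp (- lam p) * exp (- lam p) / sqrt 2"
  shows "twistor_cov L0 F lam N1 N2 s 1 p =
      c *\<^sub>R (assocW L0 F N1 N2 s p *\<^sub>R Om2 s p + assocY L0 F N1 N2 (\<not> s) p *\<^sub>R Om3 s p)"
    and "twistor_cov L0 F lam N1 N2 s 2 p =
      (c * sg s) *\<^sub>R (assocZ L0 F N1 N2 s p *\<^sub>R Om2 s p - assocX L0 F N1 N2 (\<not> s) p *\<^sub>R Om3 s p)"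
proof -
  have ef: "eframe F lam N1 N2 1 p = exp (- lam p) *\<^sub>R pu F p" "eframe F lam N1 N2 2 p = exp (- lam p) *\<^sub>R pv F p"
    "eframe F lam N1 N2 3 p = exp (- lam p) *\<^sub>R N1 p" "eframe F lam N1 N2 4 p = exp (- lam p) *\<^sub>R N2 p"
    by (simp_all add: eframe_def)
  have [simp]: "wedge (r *\<^sub>R x) (t *\<^sub>R y) = (r * t) *\<^sub>R wedge x y" for r t x y
    by (simp add: wedge_def vec_eq_iff algebra_simps)
  note defs = c_def assocW_def assocX_def assocY_def assocZ_def Om2_def Om3_def wedge_def
  show "twistor_cov L0 F lam N1 N2 s 1 p =
      c *\<^sub>R (assocW L0 F N1 N2 s p *\<^sub>R Om2 s p + assocY L0 F N1 N2 (\<not> s) p *\<^sub>R Om3 s p)"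
    unfolding twistor_cov_def Let_def covD_eframe[OF p] ef
    by (cases s) (simp_all add: defs vec_eq_iff, simp_all add: field_simps)
  show "twistor_cov L0 F lam N1 N2 s 2 p =
      (c * sg s) *\<^sub>R (assocZ L0 F N1 N2 s p *\<^sub>R Om2 s p - assocX L0 F N1 N2 (\<not> s) p *\<^sub>R Om3 s p)"
    unfolding twistor_cov_def Let_def covD_eframe[OF p] ef
    by (cases s) (simp_all add: defs vec_eq_iff, simp_all add: field_simps)
qed

text \<open>Contraction with N1 maps Om2 and Om3 to multiples of T1 and T2.\<close>

lemma Om_independent:
  assumes p: "p \<in> D" and 0: "x *\<^sub>R Om2 s p + y *\<^sub>R Om3 s p = 0"
  shows "x = 0 \<and> y = 0"
proof -
  define contr :: "real^5^5 \<Rightarrow> real^5" where "contr A = (\<chi> i. ip L0 (A $ i) (N1 p))" for A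
  have lin: "contr (r *\<^sub>R A + t *\<^sub>R B) = r *\<^sub>R contr A + t *\<^sub>R contr B" for r t A B
    by (simp add: contr_def vec_eq_iff ip.add_left ip.scaleR_left)
  have w: "contr (wedge a b) = ip L0 b (N1 p) *\<^sub>R a - ip L0 a (N1 p) *\<^sub>R b" for a b
  proof -
    have w0: "wedge a b $ i = a $ i *\<^sub>R b - b $ i *\<^sub>R a" for i by (simp add: wedge_def vec_eq_iff)
    show ?thesis
      by (rule vec_eq_iff[THEN iffD2]) (simp add: contr_def w0 ip.diff_left ip.scaleR_left)
  qed
  have c: "ip L0 (pu F p) (N1 p) = 0" "ip L0 (pv F p) (N1 p) = 0" "ip L0 (N2 p) (N1 p) = 0"
    using ip_1u[OF p] ip_1v[OF p] ip_12[OF p] by (simp_all add: ip_commute)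
  have "contr (x *\<^sub>R Om2 s p + y *\<^sub>R Om3 s p) = E p *\<^sub>R (x *\<^sub>R pu F p + (sg s * y) *\<^sub>R pv F p)"
    unfolding lin unfolding Om2_def Om3_def
    using lin[of 1 _ "sg s"] by (simp add: w c ip_11[OF p] algebra_simps)
  moreover have "contr 0 = 0" by (simp add: contr_def vec_eq_iff ip.zero_left)
  ultimately have z: "x *\<^sub>R pu F p + (sg s * y) *\<^sub>R pv F p = 0" using 0 by simp
  have "ip L0 (x *\<^sub>R pu F p + (sg s * y) *\<^sub>R pv F p) (pu F p) = x * E p"
    "ip L0 (x *\<^sub>R pu F p + (sg s * y) *\<^sub>R pv F p) (pv F p) = sg s * y * E p"
    using p by (simp_all add: ip.add_left ip.scaleR_left ip_uu ip_vv ip_uv ip_commute[of _ "pv F p" "pu F p"])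
  then show ?thesis unfolding z by (cases s) (auto simp: ip.zero_left)
qed

text \<open>In the basis \<open>Om2\<close>, \<open>Om3\<close> the derivatives of the lift of sign
  s have coefficients proportional to (W, Y') and (Z, -X'), where the prime marks the opposite sign.
  Their determinant is minus \<Delta> of the opposite sign, so each lift is governed by the other
  sign's \<Delta>.\<close>

lemma twistor_nondeg_iff:
  "twistor_nondeg L0 D F lam N1 N2 \<longleftrightarrow>
    (\<forall>s. \<forall>p\<in>D. Dl (assocW L0 F N1 N2) (assocX L0 F N1 N2) (assocY L0 F N1 N2) (assocZ L0 F N1 N2) s p \<noteq> 0)"
proof -
  have *: "(\<forall>a b. a *\<^sub>R twistor_cov L0 F lam N1 N2 s 1 p + b *\<^sub>R twistor_cov L0 F lam N1 N2 s 2 p = 0 \<longrightarrow> a = 0 \<and> b = 0) \<longleftrightarrow>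
    Dl (assocW L0 F N1 N2) (assocX L0 F N1 N2) (assocY L0 F N1 N2) (assocZ L0 F N1 N2) (\<not> s) p \<noteq> 0" if p: "p \<in> D" for s p
  proof -
    let ?W = "assocW L0 F N1 N2 s p" and ?X = "assocX L0 F N1 N2 (\<not> s) p" and ?Y = "assocY L0 F N1 N2 (\<not> s) p" and ?Z = "assocZ L0 F N1 N2 s p"
    have T: "a *\<^sub>R twistor_cov L0 F lam N1 N2 s 1 p + b *\<^sub>R twistor_cov L0 F lam N1 N2 s 2 p = 0 \<longleftrightarrow>
      a * ?W + b * (sg s * ?Z) = 0 \<and> a * ?Y - b * (sg s * ?X) = 0" for a b
    proof -
      have "a *\<^sub>R twistor_cov L0 F lam N1 N2 s 1 p + b *\<^sub>R twistor_cov L0 F lam N1 N2 s 2 p =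
        (exp (- lam p) * exp (- lam p) / sqrt 2) *\<^sub>R
          ((a * ?W + b * (sg s * ?Z)) *\<^sub>R Om2 s p + (a * ?Y - b * (sg s * ?X)) *\<^sub>R Om3 s p)"
        unfolding twistor_cov_eq[OF p] by (simp add: algebra_simps)
      moreover have "x *\<^sub>R Om2 s p + y *\<^sub>R Om3 s p = 0 \<longleftrightarrow> x = 0 \<and> y = 0" for x y
        using Om_independent[OF p, of x s y] by auto
      ultimately show ?thesis by simp
    qed
    have "(\<forall>a b. a * ?W + b * (sg s * ?Z) = 0 \<and> a * ?Y - b * (sg s * ?X) = 0 \<longrightarrow> a = 0 \<and> b = 0) \<longleftrightarrow> ?W * ?X + ?Y * ?Z \<noteq> 0"
      (is "?l \<longleftrightarrow> ?r")
    proof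
      assume l: ?l
      show ?r
      proof
        assume 0: "?W * ?X + ?Y * ?Z = 0"
        have ss: "sg s * sg s = 1" by simp
        \<comment> \<open>If the determinant vanishes, (\<sigma> Z, -W) and then (X, \<sigma> Y)
          solve the system, where \<sigma> is the sign. Both must be zero, so all coefficients
          vanish and (1, 0) is a nonzero solution.\<close>
        have "sg s * ?Z = 0 \<and> - ?W = 0"
          by (rule l[rule_format]) (use 0 ss in algebra)
        moreover have "?X = 0 \<and> sg s * ?Y = 0"
          by (rule l[rule_format]) (use 0 ss calculation in algebra)
        ultimately show False using l[rule_format, of 1 0] by (cases s) auto
      qed
    next
      assume r: ?r
      show ?l
      proof (intro allI impI)
        fix a b assume "a * ?W + b * (sg s * ?Z) = 0 \<and> a * ?Y - b * (sg s * ?X) = 0"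
        then have "a * (?W * ?X + ?Y * ?Z) = 0" "b * (sg s * (?W * ?X + ?Y * ?Z)) = 0" by algebra+
        then show "a = 0 \<and> b = 0" using r by (cases s) auto
      qed
    qed
    then show ?thesis unfolding T by (simp add: Dl_def)
  qed
  show ?thesis
    unfolding twistor_nondeg_def using * by (simp add: all_bool_eq) blast
qed

end

section \<open>Existence and uniqueness of the immersion\<close>

lemma solvesI:
  assumes B: "bounded_bilinear B"
    and "\<And>p. p \<in> D \<Longrightarrow> x differentiable (at p)" "\<And>p. p \<in> D \<Longrightarrow> pu x p = B (M p) (x p)" "\<And>p. p \<in> D \<Longrightarrow> pv x p = B (N p) (x p)"
  shows "solves B D M N x"
  unfolding solves_def[OF B]
proof
  fix p assume p: "p \<in> D"
  show "(x has_derivative (\<lambda>w. fst w *\<^sub>R B (M p) (x p) + snd w *\<^sub>R B (N p) (x p))) (at p)"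
    using has_derivative_pdir[OF assms(2)[OF p]] unfolding assms(3)[OF p] assms(4)[OF p] .
qed

lemma solvesD:
  assumes B: "bounded_bilinear B" and "solves B D M N x" "p \<in> D"
  shows "x differentiable (at p)" "pu x p = B (M p) (x p)" "pv x p = B (N p) (x p)"
proof -
  have h: "(x has_derivative (\<lambda>w. fst w *\<^sub>R B (M p) (x p) + snd w *\<^sub>R B (N p) (x p))) (at p)"
    using assms(2,3) unfolding solves_def[OF B] by blast
  show "x differentiable (at p)" "pu x p = B (M p) (x p)" "pv x p = B (N p) (x p)"
    by (rule has_derivative_fst_sndI[OF h])+
qed

text \<open>The action on Gram matrices: if X_u = M X, then G = X \<eta> X^T satisfies G_u = M G + G
  M^T.\<close>

abbreviation lyap :: "real^5^5 \<Rightarrow> real^5^5 \<Rightarrow> real^5^5" where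
  "lyap A S \<equiv> A ** S + S ** transpose A"

lemma bounded_linear_transpose: "bounded_linear (transpose :: real^'n^'m \<Rightarrow> real^'m^'n)"
  by (rule linear_conv_bounded_linear[THEN iffD1]) (auto simp: linear_iff transpose_def vec_eq_iff)

lemma bounded_bilinear_lyap: "bounded_bilinear lyap"
proof -
  interpret bounded_bilinear "(**) :: real^5^5 \<Rightarrow> real^5^5 \<Rightarrow> real^5^5" by (rule bounded_bilinear_matrix_mult)
  interpret t: bounded_linear "transpose :: real^5^5 \<Rightarrow> real^5^5" by (rule bounded_linear_transpose)
  show ?thesis
    by (rule bilinear_conv_bounded_bilinear[THEN iffD1])
       (auto simp: bilinear_def linear_iff add_left add_right scaleR_left scaleR_right t.add t.scaleR scaleR_add_right)
qed

lemma solves_gram: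
  assumes X: "solves (**) D M N X"
  shows "solves lyap D M N (\<lambda>p. gram L0 (X p))"
proof -
  note bl = bounded_bilinear_matrix_mult and tl = bounded_linear_transpose
  have lin: "bounded_linear (\<lambda>A. metric_mat L0 ** transpose A)"
    by (rule bounded_linear_compose[OF bounded_bilinear.bounded_linear_right[OF bl] tl])
  have eq: "gram L0 = (\<lambda>A. A ** (metric_mat L0 ** transpose A))" by (rule ext) (simp add: gram_eq matrix_mul_assoc)
  have pd: "pdir k (\<lambda>p. gram L0 (X p)) p = lyap A (gram L0 (X p))"
    if "X differentiable (at p)" "pdir k X p = A ** X p" for p k A
  proof -
    have "pdir k (\<lambda>p. gram L0 (X p)) p =
        X p ** (metric_mat L0 ** transpose (pdir k X p)) + pdir k X p ** (metric_mat L0 ** transpose (X p))"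
      unfolding eq using pdir_bilinear[OF bl that(1) differentiable_linear[OF lin that(1)], of k]
      by (simp add: pdir_linear[OF lin that(1)])
    then show ?thesis by (simp add: that(2) gram_eq matrix_transpose_mul matrix_mul_assoc add.commute)
  qed
  show ?thesis
  proof (rule solvesI[OF bounded_bilinear_lyap])
    fix p assume p: "p \<in> D"
    note s = solvesD[OF bl X p]
    show "(\<lambda>p. gram L0 (X p)) differentiable (at p)"
      unfolding eq by (rule differentiable_bilinear[OF bl s(1) differentiable_linear[OF lin s(1)]])
    show "pu (\<lambda>p. gram L0 (X p)) p = lyap (M p) (gram L0 (X p))" "pv (\<lambda>p. gram L0 (X p)) p = lyap (N p) (gram L0 (X p))"
      by (rule pd[OF s(1,2)], rule pd[OF s(1,3)])
  qed
qed

text \<open>Off the first row and column, the connection matrices are skew apart from \<lambda>_u or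
  \<lambda>_v on the diagonal, which reproduces the growth of E. The products of F with T1 and T2
  stay 0 because the entry f = L0 E, weighted by the square 1 / L0 of F, balances E.\<close>

lemma solves_gram0:
  assumes D: "open D" and L0: "L0 \<noteq> 0" and E: "smooth_on D E"
    and dE: "\<And>p. p \<in> D \<Longrightarrow> pu E p = 2 * lu p * E p" "\<And>p. p \<in> D \<Longrightarrow> pv E p = 2 * lv p * E p"
  shows "solves lyap D (\<lambda>p. conn_u (L0 * E p) (lu p) (lv p) (a1 p) (a2 p) (b1 p) (b2 p) (m1 p))
      (\<lambda>p. conn_v (L0 * E p) (lu p) (lv p) (a2 p) (a3 p) (b2 p) (b3 p) (m2 p)) (\<lambda>p. gram0 L0 (E p))"
proof (rule solvesI[OF bounded_bilinear_lyap])
  have s: "smooth_on D (\<lambda>p. gram0 L0 (E p))"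
    unfolding gram0_def by (intro smooth_on_mat5 smooth_on_vec5 smooth_on_const D E)
  fix p assume p: "p \<in> D"
  note d = smooth_on_differentiable[OF s p] smooth_on_differentiable[OF smooth_on_nth[OF s] p]
  show "(\<lambda>p. gram0 L0 (E p)) differentiable (at p)" by (rule d)
  have pd: "pdir k (\<lambda>p. gram0 L0 (E p)) p $ i $ j = pdir k (\<lambda>p. gram0 L0 (E p) $ i $ j) p" for k i j
    by (simp add: pdir_nth d)
  show "pu (\<lambda>p. gram0 L0 (E p)) p = lyap (conn_u (L0 * E p) (lu p) (lv p) (a1 p) (a2 p) (b1 p) (b2 p) (m1 p)) (gram0 L0 (E p))"
    using L0 unfolding vec_eq_iff pd
    by (simp add: forall_5 gram0_def conn_u_def matrix_matrix_mult_def sum_5 transpose_def dE[OF p])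
  show "pv (\<lambda>p. gram0 L0 (E p)) p = lyap (conn_v (L0 * E p) (lu p) (lv p) (a2 p) (a3 p) (b2 p) (b3 p) (m2 p)) (gram0 L0 (E p))"
    using L0 unfolding vec_eq_iff pd
    by (simp add: forall_5 gram0_def conn_v_def matrix_matrix_mult_def sum_5 transpose_def dE[OF p])
qed

lemma gram0_realized:
  assumes "L0 \<noteq> 0" "E > 0"
  shows "\<exists>X. gram L0 X = gram0 L0 E"
proof
  \<comment> \<open>The first coordinate is timelike exactly for L0 < 0, so in both cases the first
    row has square 1 / L0.\<close>
  let ?X = "mat5 (vec5 (1 / sqrt \<bar>L0\<bar>) 0 0 0 0) (vec5 0 (sqrt E) 0 0 0) (vec5 0 0 (sqrt E) 0 0) (vec5 0 0 0 (sqrt E) 0) (vec5 0 0 0 0 (sqrt E))"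
  show "gram L0 ?X = gram0 L0 E"
    using assms by (simp add: vec_eq_iff forall_5 gram_def gram0_def ip_def sum_5)
qed

lemma connected_same_sign:
  fixes g :: "'a::topological_space \<Rightarrow> real"
  assumes "connected D" "continuous_on D g" "\<And>p. p \<in> D \<Longrightarrow> g p \<noteq> 0" "p \<in> D" "q \<in> D"
  shows "sgn (g p) * g q > 0"
proof (rule ccontr)
  assume n: "\<not> sgn (g p) * g q > 0"
  have "is_interval (g ` D)"
    using connected_continuous_image[OF assms(2,1)] by (simp add: is_interval_connected_1)
  then have iv: "x \<in> g ` D" if "a \<in> g ` D" "b \<in> g ` D" "a \<le> x" "x \<le> b" for a b x
    using that unfolding is_interval_1 by blast
  have "g p \<noteq> 0" "g q \<noteq> 0" using assms by auto
  then have "g p < 0 \<and> 0 < g q \<or> g q < 0 \<and> 0 < g p" using n by (auto simp: sgn_if split: if_splits)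
  then have "0 \<in> g ` D" using iv[of "g p" "g q" 0] iv[of "g q" "g p" 0] assms(4,5) by auto
  then show False using assms(3) by auto
qed

lemma continuous_on_det:
  fixes X :: "'a::topological_space \<Rightarrow> real^'n^'n"
  assumes "continuous_on D X"
  shows "continuous_on D (\<lambda>p. det (X p))"
  unfolding det_def by (intro continuous_intros assms)

text \<open>Frames store their vectors as rows, so an ambient linear map acts on them by
  multiplication from the right.\<close>

lemma isometry_vector_matrix:
  assumes "R ** metric_mat L0 ** transpose R = metric_mat L0"
  shows "isometry_N L0 (\<lambda>x. x v* R)"
  unfolding isometry_N_def
proof (intro conjI allI)
  show "linear (\<lambda>x. x v* R)"
    by (auto simp: linear_iff vector_matrix_mult_def vec_eq_iff sum_distrib_left algebra_simps sum.distrib)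
  have ip: "ip L0 x y = x \<bullet> (metric_mat L0 *v y)" for x y
    by (simp add: ip_def inner_vec_def matrix_vector_mult_def metric_mat_def sum_5)
  fix x y
  have "ip L0 (x v* R) (y v* R) = x \<bullet> (R *v (metric_mat L0 *v (transpose R *v y)))"
    unfolding ip by (simp add: dot_lmul_matrix)
  also have "\<dots> = x \<bullet> ((R ** metric_mat L0 ** transpose R) *v y)"
    by (simp only: matrix_vector_mul_assoc matrix_mul_assoc)
  finally show "ip L0 (x v* R) (y v* R) = ip L0 x y" using assms by (simp add: ip)
qed

lemma pdir_half_ln:
  fixes g :: "pt \<Rightarrow> real"
  assumes "g differentiable (at p)" "g p > 0"
  shows "pdir k (\<lambda>q. ln (g q) / 2) p = pdir k g p / (2 * g p)"
  using pdir_compose[OF DERIV_ln[OF assms(2)] assms(1), of k]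
    pdir_cmult[OF differentiable_compose_real[OF DERIV_ln[OF assms(2)] assms(1)], of k "1 / 2"]
  by (simp add: field_simps)

section \<open>Prescribed data and the structure equations they satisfy\<close>

locale compatible_data =
  fixes L0 :: real and D :: "pt set" and W X Y Z :: "bool \<Rightarrow> pt \<Rightarrow> real"
  assumes L0: "L0 \<noteq> 0" and D: "open D" "connected D" "simply_connected D"
    and smooth: "\<And>s. smooth_on D (W s)" "\<And>s. smooth_on D (X s)" "\<And>s. smooth_on D (Y s)" "\<And>s. smooth_on D (Z s)"
    and WX: "\<And>p. p \<in> D \<Longrightarrow> W True p + W False p = X True p + X False p"
    and YZ: "\<And>p. p \<in> D \<Longrightarrow> Y True p + Y False p = Z True p + Z False p"
    and Dl: "\<And>p s. p \<in> D \<Longrightarrow> Dl W X Y Z s p \<noteq> 0"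
begin

abbreviation "A \<equiv> Acoef W X Y Z"
abbreviation "B \<equiv> Bcoef W X Y Z"
abbreviation "f \<equiv> \<lambda>p. Dl W X Y Z True p - pu (A True) p - pv (B False) p"
abbreviation "lam \<equiv> \<lambda>p. ln (f p / L0) / 2"

text \<open>The definitions of the associated functions, solved for \<alpha>, \<beta>, \<mu> and the
  derivatives of \<lambda>, with A and B in the place of \<phi> and \<psi>. \<open>WX\<close> and
  \<open>YZ\<close> say that W and X lead to the same \<alpha>2, and Y and Z to the same
  \<beta>2.\<close>

definition a1 where "a1 p = (Y True p - Y False p) / 2"
definition a2 where "a2 p = (W True p + W False p) / 2"
definition a3 where "a3 p = (Z True p - Z False p) / 2"
definition b1 where "b1 p = (W True p - W False p) / 2"
definition b2 where "b2 p = (Y True p + Y False p) / 2"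
definition b3 where "b3 p = (X True p - X False p) / 2"
definition m1 where "m1 p = (B False p - B True p) / 2"
definition m2 where "m2 p = (A False p - A True p) / 2"
definition lu where "lu p = (A True p + A False p) / 2"
definition lv where "lv p = (B True p + B False p) / 2"

lemma W_eq: "W s p = a2 p + sg s * b1 p" and Y_eq: "Y s p = b2 p + sg s * a1 p"
  by (cases s; simp add: a2_def b1_def b2_def a1_def field_simps)+

lemma X_eq: "p \<in> D \<Longrightarrow> X s p = a2 p + sg s * b3 p" and Z_eq: "p \<in> D \<Longrightarrow> Z s p = b2 p + sg s * a3 p"
  using WX[of p] YZ[of p] by (cases s; simp add: a2_def b3_def b2_def a3_def field_simps)+

lemma A_eq: "A s p = lu p - sg s * m2 p" and B_eq: "B s p = lv p - sg s * m1 p"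
  by (cases s; simp add: lu_def m2_def lv_def m1_def field_simps)+

lemma smooth_Dl: "smooth_on D (Dl W X Y Z s)"
  unfolding Dl_def[abs_def] by (intro smooth_on_add smooth_on_mult smooth)

lemma smooth_AB: "smooth_on D (A s)" "smooth_on D (B s)"
  unfolding Acoef_def[abs_def] Bcoef_def[abs_def]
  by (intro smooth_on_mult smooth_on_divide smooth_on_add smooth_on_diff smooth_on_minus smooth_on_cmult smooth_on_const
      smooth_on_pdir smooth smooth_Dl D(1) Dl; assumption)+

lemma smooth_coeffs: "smooth_on D lu" "smooth_on D lv" "smooth_on D a1" "smooth_on D a2" "smooth_on D a3"
    "smooth_on D b1" "smooth_on D b2" "smooth_on D b3" "smooth_on D m1" "smooth_on D m2"
  unfolding lu_def[abs_def] lv_def[abs_def] a1_def[abs_def] a2_def[abs_def] a3_def[abs_def] b1_def[abs_def]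
    b2_def[abs_def] b3_def[abs_def] m1_def[abs_def] m2_def[abs_def]
  by (intro smooth_on_divide smooth_on_add smooth_on_diff smooth_on_const smooth smooth_AB D(1); simp)+

lemma smooth_f: "smooth_on D f"
  by (intro smooth_on_diff smooth_on_pdir smooth_Dl smooth_AB)

text \<open>\<open>m1\<close>, \<open>m2\<close>, \<open>lu\<close> and \<open>lv\<close> are read
  off from A and B, and these are the Cramer solutions of the Codazzi equations.\<close>

lemma codazzi: "p \<in> D \<Longrightarrow> codazzi (lu p) (lv p) a1 a2 a3 b1 b2 b3 (m1 p) (m2 p) p"
  using codazzi_iff[OF D(1) _ smooth_coeffs(3-8) W_eq X_eq Y_eq Z_eq Dl, of p "lu p" "m2 p" "lv p" "m1 p"] A_eq B_eq
  by blast

context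
  assumes compat: "\<And>p. p \<in> D \<Longrightarrow> Dl W X Y Z True p - Dl W X Y Z False p
        = pu (\<lambda>q. A True q - A False q) p - pv (\<lambda>q. B True q - B False q) p"
    and f_pos: "\<And>p. p \<in> D \<Longrightarrow> f p / L0 > 0"
    and df: "\<And>p. p \<in> D \<Longrightarrow> pu f p = f p * (A True p + A False p)" "\<And>p. p \<in> D \<Longrightarrow> pv f p = f p * (B True p + B False p)"
begin

lemma exp_lam: "p \<in> D \<Longrightarrow> exp (2 * lam p) = f p / L0"
  using f_pos by simp

lemma smooth_E: "smooth_on D (\<lambda>p. f p / L0)"
  by (intro smooth_on_divide smooth_f smooth_on_const D(1) L0)

lemma smooth_lam: "smooth_on D lam"
  by (rule smooth_on_divide[OF smooth_on_ln[OF smooth_E f_pos] smooth_on_const[OF D(1)]]) simp_all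

lemma pdir_f: "p \<in> D \<Longrightarrow> pu f p = 2 * lu p * f p" "p \<in> D \<Longrightarrow> pv f p = 2 * lv p * f p"
  using df[of p] by (simp_all add: lu_def lv_def)

lemma pdir_E: "p \<in> D \<Longrightarrow> pu (\<lambda>p. f p / L0) p = 2 * lu p * (f p / L0)" "p \<in> D \<Longrightarrow> pv (\<lambda>p. f p / L0) p = 2 * lv p * (f p / L0)"
  using pdir_cmult[OF smooth_on_differentiable[OF smooth_f], of p _ "1 / L0"] by (simp_all add: pdir_f)

lemma pdir_lam: "p \<in> D \<Longrightarrow> pu lam p = lu p" "p \<in> D \<Longrightarrow> pv lam p = lv p"
proof -
  have cancel: "2 * l * g / (2 * g) = l" if "g > 0" for l g :: real
    using that by simp
  show "p \<in> D \<Longrightarrow> pu lam p = lu p" "p \<in> D \<Longrightarrow> pv lam p = lv p"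
    by (simp_all only: pdir_half_ln[OF smooth_on_differentiable[OF smooth_E] f_pos] pdir_E cancel[OF f_pos])
qed

abbreviation "M p \<equiv> conn_u (f p) (lu p) (lv p) (a1 p) (a2 p) (b1 p) (b2 p) (m1 p)"
abbreviation "N p \<equiv> conn_v (f p) (lu p) (lv p) (a2 p) (a3 p) (b2 p) (b3 p) (m2 p)"

lemma flat:
  assumes p: "p \<in> D"
  shows "pv M p + M p ** N p = pu N p + N p ** M p"
proof -
  note d = smooth_on_differentiable[OF _ p]
  have half: "pdir k (\<lambda>q. (g q + h q) / 2) p = (pdir k g p + pdir k h p) / 2"
    "pdir k (\<lambda>q. (g q - h q) / 2) p = (pdir k g p - pdir k h p) / 2"
    if "smooth_on D g" "smooth_on D h" for g h :: "pt \<Rightarrow> real" and k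
    using pdir_cmult[OF d[OF smooth_on_add[OF that]], of k "1 / 2"] pdir_cmult[OF d[OF smooth_on_diff[OF that]], of k "1 / 2"]
    by (simp_all add: pdir_add pdir_diff d that)
  have pd: "pdir k lu p = (pdir k (A True) p + pdir k (A False) p) / 2" "pdir k lv p = (pdir k (B True) p + pdir k (B False) p) / 2"
    "pdir k m1 p = (pdir k (B False) p - pdir k (B True) p) / 2" "pdir k m2 p = (pdir k (A False) p - pdir k (A True) p) / 2" for k
    unfolding lu_def[abs_def] lv_def[abs_def] m1_def[abs_def] m2_def[abs_def] by (intro half smooth_AB)+
  have c: "Dl W X Y Z True p - Dl W X Y Z False p = pu (A True) p - pu (A False) p - (pv (B True) p - pv (B False) p)"
    using compat[OF p] by (simp add: pdir_diff d smooth_AB)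
  have Dl_eq: "Dl W X Y Z s p = (a2 p - sg s * b1 p) * (a2 p + sg s * b3 p) + (b2 p + sg s * a1 p) * (b2 p - sg s * a3 p)" for s
    using W_eq[of "\<not> s" p] Y_eq[of s p] X_eq[OF p, of s] Z_eq[OF p, of "\<not> s"] by (cases s) (simp_all add: Dl_def)
  \<comment> \<open>By \<open>pdir_lam\<close> the functions \<open>lu\<close> and \<open>lv\<close>
    are the partial derivatives of \<open>lam\<close>, whose mixed second derivatives agree.\<close>
  have "pv lu p = pu lv p"
    using clairaut[OF smooth_lam p] pdir_cong[OF D(1) p pdir_lam(1), where k = 2] pdir_cong[OF D(1) p pdir_lam(2), where k = 1] by simp
  \<comment> \<open>The mean of the two expressions for f that belong to the two signs; the Ricci
    equation that follows is half their difference.\<close>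
  moreover have "a2 p * a2 p + b2 p * b2 p - a1 p * a3 p - b1 p * b3 p - pu lu p - pv lv p = f p"
    unfolding pd using c unfolding Dl_eq by (simp add: field_simps)
  moreover have "pv m1 p - pu m2 p = a1 p * b2 p + a2 p * b3 p - a2 p * b1 p - a3 p * b2 p"
    unfolding pd using c unfolding Dl_eq by (simp add: field_simps)
  ultimately show ?thesis
    using conn_flat_iff[OF smooth_f smooth_coeffs p] codazzi[OF p] pdir_f[OF p] by blast
qed

theorem immersion_exists:
  "\<exists>F N1 N2 ori. conf_frame L0 D F lam N1 N2 ori \<and>
     (\<forall>s. \<forall>p\<in>D. assocW L0 F N1 N2 s p = W s p \<and> assocX L0 F N1 N2 s p = X s p \<and>
                 assocY L0 F N1 N2 s p = Y s p \<and> assocZ L0 F N1 N2 s p = Z s p) \<and>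
     twistor_nondeg L0 D F lam N1 N2"
proof (cases "D = {}")
  case True
  have "smooth_on {} g" for g :: "pt \<Rightarrow> real^5"
    by (simp add: smooth_on_def differentiable_on_def)
  then show ?thesis
    unfolding True conf_frame_def twistor_nondeg_def
    by (intro exI[of _ "\<lambda>_. 0"] exI[of _ "\<lambda>_. 1"]) (simp add: orientation_def)
next
  case False
  note bl = bounded_bilinear_matrix_mult and sM = smooth_on_conn[OF smooth_f smooth_coeffs]
  have "\<exists>p0\<in>D. \<forall>X0 :: real^5^5. \<exists>X. X p0 = X0 \<and> solves (**) D M N X"
    by (rule frobenius_matrix[OF D(1,3) False sM flat])
  then obtain p0 where p0: "p0 \<in> D" "\<forall>X0 :: real^5^5. \<exists>X. X p0 = X0 \<and> solves (**) D M N X"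
    by (rule bexE)
  obtain X0 where X0: "gram L0 X0 = gram0 L0 (f p0 / L0)"
    using gram0_realized[OF L0 f_pos[OF p0(1)]] by blast
  obtain \<Psi> where \<Psi>: "\<Psi> p0 = X0" "solves (**) D M N \<Psi>" using p0(2)[rule_format, of X0] by (elim exE conjE)
  note eqs = solvesD[OF bl \<Psi>(2)]
  have smooth_\<Psi>: "smooth_on D \<Psi>" by (rule solves_smooth[OF bl \<Psi>(2) sM])
  have gram: "gram L0 (\<Psi> p) = gram0 L0 (f p / L0)" if "p \<in> D" for p
  proof (rule solves_unique[OF bounded_bilinear_lyap solves_gram[OF \<Psi>(2)] _ D(1,2) _ _ p0(1) _ that])
    show "solves lyap D M N (\<lambda>p. gram0 L0 (f p / L0))"
      using solves_gram0[OF D(1) L0 smooth_E pdir_E] L0 by simp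
    show "continuous_on D M" "continuous_on D N" by (intro smooth_on_continuous sM)+
    show "gram L0 (\<Psi> p0) = gram0 L0 (f p0 / L0)" using \<Psi> X0 by simp
  qed
  have inv: "invertible (\<Psi> p)" if "p \<in> D" for p
    using frame_invertible[OF L0 _ gram[OF that]] f_pos[OF that] by force
  define F N1 N2 where "F p = \<Psi> p $ 1" and "N1 p = \<Psi> p $ 4" and "N2 p = \<Psi> p $ 5" for p
  \<comment> \<open>The first rows of M and N say that the derivatives of the first row of \<Psi>
    are its second and third rows.\<close>
  have F_uv: "pu F p = \<Psi> p $ 2" "pv F p = \<Psi> p $ 3" if "p \<in> D" for p
    unfolding F_def[abs_def] pdir_nth[OF eqs(1)[OF that], symmetric] eqs(2,3)[OF that] mult_mat5_nth conn_u_def conn_v_def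
    by simp_all
  have frame: "mat5 (F p) (pu F p) (pv F p) (N1 p) (N2 p) = \<Psi> p" if "p \<in> D" for p
    unfolding F_uv[OF that] by (simp add: mat5_eq_iff F_def N1_def N2_def)
  \<comment> \<open>The determinant of \<Psi> has one sign on the connected D, so a constant
    function already orients N as required.\<close>
  define ori :: "real^5 \<Rightarrow> real" where "ori x = sgn (det (\<Psi> p0))" for x
  have det0: "det (\<Psi> p) \<noteq> 0" if "p \<in> D" for p
    using inv[OF that] by (simp add: invertible_det_nz)
  have pos: "ori x * det (\<Psi> p) > 0" if "p \<in> D" for x p
    unfolding ori_def
    by (rule connected_same_sign[OF D(2) continuous_on_det[OF smooth_on_continuous[OF smooth_\<Psi>]] det0 p0(1) that])
  have ori: "orientation L0 ori"
    using det0[OF p0(1)] by (auto simp: orientation_def ori_def sgn_if)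
  have gram_nth: "ip L0 (\<Psi> p $ i) (\<Psi> p $ j) = gram0 L0 (f p / L0) $ i $ j" if "p \<in> D" for p i j
    using gram[OF that] by (simp add: gram_def vec_eq_iff)
  have conf: "conf_frame L0 D F lam N1 N2 ori"
    unfolding conf_frame_def pos_oriented_def
  proof (intro conjI ballI)
    show "smooth_on D F" "smooth_on D N1" "smooth_on D N2"
      unfolding F_def[abs_def] N1_def[abs_def] N2_def[abs_def] by (intro smooth_on_nth smooth_\<Psi>)+
    fix p assume p: "p \<in> D"
    show "0 < ori (F p) * det (mat5 (F p) (pu F p) (pv F p) (N1 p) (N2 p))"
      unfolding frame[OF p] by (rule pos[OF p])
  qed (simp_all only: exp_lam F_uv spform_def mem_Collect_eq F_def N1_def N2_def gram_nth, simp_all add: gram0_def D ori)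
  interpret S: surface L0 D F N1 N2 lam ori by unfold_locales (rule L0, rule conf)
  \<comment> \<open>Both connection matrices yield the derivative of the same invertible frame,
    hence coincide; the second fundamental form of F is then read off from their entries.\<close>
  have coeffs: "S.M p = M p" "S.N p = N p" if p: "p \<in> D" for p
  proof -
    have fr: "S.frame q = \<Psi> q" if "q \<in> D" for q using frame[OF that] by (simp add: S.frame_def)
    have "pdir k S.frame p = pdir k \<Psi> p" for k by (rule pdir_cong[OF D(1) p fr])
    then have "S.M p ** \<Psi> p = M p ** \<Psi> p" "S.N p ** \<Psi> p = N p ** \<Psi> p"
      using S.frame_eqs[OF p] eqs(2,3)[OF p] fr[OF p] by simp_all
    then show "S.M p = M p" "S.N p = N p" using invertible_mult_right_cancel[OF inv[OF p]] by blast+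
  qed
  have "S.a1 p = a1 p" "S.a2 p = a2 p" "S.a3 p = a3 p" "S.b1 p = b1 p" "S.b2 p = b2 p" "S.b3 p = b3 p" if p: "p \<in> D" for p
    using coeffs[OF p] unfolding conn_u_def conn_v_def by (simp_all add: mat5_eq_iff vec_eq_iff forall_5)
  then have assoc: "assocW L0 F N1 N2 s p = W s p" "assocX L0 F N1 N2 s p = X s p"
      "assocY L0 F N1 N2 s p = Y s p" "assocZ L0 F N1 N2 s p = Z s p" if "p \<in> D" for s p
    using that W_eq[of s p] X_eq[OF that, of s] Y_eq[of s p] Z_eq[OF that, of s]
    by (simp_all add: assocW_def assocX_def assocY_def assocZ_def)
  have "twistor_nondeg L0 D F lam N1 N2"
    unfolding S.twistor_nondeg_iff using Dl by (simp add: Dl_def assoc)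
  then show ?thesis using conf assoc by blast
qed

end

text \<open>The associated functions determine \<alpha> and \<beta> and, through A and B with the
  common \<lambda>, also \<mu>. Both frames therefore solve one system, and the constant matrix R
  that relates them at p0 relates them on D. R preserves the bilinear form because the two Gram
  matrices agree at p0.\<close>

theorem immersion_unique:
  assumes 1: "conf_frame L0 D F l N1 N2 ori"
      "\<And>s p. p \<in> D \<Longrightarrow> assocW L0 F N1 N2 s p = W s p \<and> assocX L0 F N1 N2 s p = X s p \<and>
                 assocY L0 F N1 N2 s p = Y s p \<and> assocZ L0 F N1 N2 s p = Z s p"
    and 2: "conf_frame L0 D F' l N1' N2' ori'"
      "\<And>s p. p \<in> D \<Longrightarrow> assocW L0 F' N1' N2' s p = W s p \<and> assocX L0 F' N1' N2' s p = X s p \<and>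
                 assocY L0 F' N1' N2' s p = Y s p \<and> assocZ L0 F' N1' N2' s p = Z s p"
  shows "\<exists>\<Phi>. isometry_N L0 \<Phi> \<and> (\<forall>p\<in>D. F' p = \<Phi> (F p))"
proof (cases "D = {}")
  case True
  then show ?thesis by (auto simp: isometry_N_def intro!: exI[of _ "\<lambda>x. x"] linear_id[unfolded id_def])
next
  case False
  then obtain p0 where p0: "p0 \<in> D" by blast
  interpret S: surface L0 D F N1 N2 l ori by unfold_locales (rule L0, rule 1)
  interpret T: surface L0 D F' N1' N2' l ori' by unfold_locales (rule L0, rule 2)
  note bl = bounded_bilinear_matrix_mult
  have conn: "T.M p = S.M p" "T.N p = S.N p" if p: "p \<in> D" for p
  proof -
    have w: "W s p = assocW L0 F N1 N2 s p" "X s p = assocX L0 F N1 N2 s p"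
        "Y s p = assocY L0 F N1 N2 s p" "Z s p = assocZ L0 F N1 N2 s p"
      and w': "W s p = assocW L0 F' N1' N2' s p" "X s p = assocX L0 F' N1' N2' s p"
        "Y s p = assocY L0 F' N1' N2' s p" "Z s p = assocZ L0 F' N1' N2' s p" for s
      using 1(2)[OF p, of s] 2(2)[OF p, of s] by simp_all
    have "S.a1 p = a1 p" "S.a2 p = a2 p" "S.a3 p = a3 p" "S.b1 p = b1 p" "S.b2 p = b2 p" "S.b3 p = b3 p"
      unfolding a1_def a2_def a3_def b1_def b2_def b3_def w
      by (simp_all add: assocW_def assocX_def assocY_def assocZ_def)
    moreover have "T.a1 p = a1 p" "T.a2 p = a2 p" "T.a3 p = a3 p" "T.b1 p = b1 p" "T.b2 p = b2 p" "T.b3 p = b3 p"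
      unfolding a1_def a2_def a3_def b1_def b2_def b3_def w'
      by (simp_all add: assocW_def assocX_def assocY_def assocZ_def)
    moreover have "A s p = pu l p - sg s * S.m2 p" "B s p = pv l p - sg s * S.m1 p" for s
      using S.Acoef_Bcoef[OF p, of W X Y Z s] 1(2) Dl[OF p] by auto
    moreover have "A s p = pu l p - sg s * T.m2 p" "B s p = pv l p - sg s * T.m1 p" for s
      using T.Acoef_Bcoef[OF p, of W X Y Z s] 2(2) Dl[OF p] by auto
    from this[of True] calculation(13,14)[of True] have "S.m1 p = T.m1 p" "S.m2 p = T.m2 p" by simp_all
    ultimately show "T.M p = S.M p" "T.N p = S.N p" by simp_all
  qed
  have gr: "gram L0 (T.frame p0) = gram L0 (S.frame p0)"
    using S.gram_frame[OF p0] T.gram_frame[OF p0] by simp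
  have inv: "invertible (S.frame p0)"
    by (rule frame_invertible[OF L0 _ S.gram_frame[OF p0]]) simp
  then obtain S' where S': "S.frame p0 ** S' = mat 1" "S' ** S.frame p0 = mat 1" unfolding invertible_def by blast
  define R where "R = S' ** T.frame p0"
  have R: "S.frame p0 ** R = T.frame p0"
    by (simp add: R_def matrix_mul_assoc S')
  have solS: "solves (**) D S.M S.N (\<lambda>p. S.frame p ** R)"
  proof (rule solvesI[OF bl])
    note lin = bounded_bilinear.bounded_linear_left[OF bl, of R]
    fix p assume p: "p \<in> D"
    note d = smooth_on_differentiable[OF S.smooth_frame p]
    show "(\<lambda>p. S.frame p ** R) differentiable (at p)" by (rule differentiable_linear[OF lin d])
    show "pu (\<lambda>p. S.frame p ** R) p = S.M p ** (S.frame p ** R)" "pv (\<lambda>p. S.frame p ** R) p = S.N p ** (S.frame p ** R)"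
      unfolding pdir_linear[OF lin d] S.frame_eqs[OF p] by (simp_all add: matrix_mul_assoc)
  qed
  have solT: "solves (**) D S.M S.N T.frame"
    using T.solves_frame conn unfolding solves_def[OF bl] by simp
  have sM: "continuous_on D S.M" "continuous_on D S.N"
    using smooth_on_conn[OF S.smooth_data] smooth_on_continuous by blast+
  have eq: "T.frame p = S.frame p ** R" if "p \<in> D" for p
    by (rule solves_unique[OF bl solT solS D(1,2) sM p0 _ that]) (simp add: R)
  \<comment> \<open>The equality of Gram matrices at p0, in factored form; multiplying by the
    inverse of the frame on both sides isolates the condition on R.\<close>
  have "S.frame p0 ** (R ** metric_mat L0 ** transpose R) ** transpose (S.frame p0) = S.frame p0 ** metric_mat L0 ** transpose (S.frame p0)"
    using gr unfolding R[symmetric] gram_eq by (simp add: matrix_transpose_mul matrix_mul_assoc)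
  then have "S' ** (S.frame p0 ** (R ** metric_mat L0 ** transpose R) ** transpose (S.frame p0)) ** transpose S'
      = S' ** (S.frame p0 ** metric_mat L0 ** transpose (S.frame p0)) ** transpose S'" by simp
  moreover have "S' ** (S.frame p0 ** Q ** transpose (S.frame p0)) ** transpose S' = Q" for Q
  proof -
    have "transpose (S.frame p0) ** transpose S' = mat 1"
      using S'(2) by (metis matrix_transpose_mul transpose_mat)
    moreover have "S' ** (S.frame p0 ** Q ** transpose (S.frame p0)) ** transpose S' =
        (S' ** S.frame p0) ** Q ** (transpose (S.frame p0) ** transpose S')"
      by (simp add: matrix_mul_assoc)
    ultimately show ?thesis by (simp add: S'(2))
  qed
  ultimately have "R ** metric_mat L0 ** transpose R = metric_mat L0" by simp
  then have "isometry_N L0 (\<lambda>x. x v* R)" by (rule isometry_vector_matrix)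
  moreover have "F' p = F p v* R" if "p \<in> D" for p
  proof -
    have "T.frame p $ 1 = (S.frame p ** R) $ 1" using eq[OF that] by simp
    also have "\<dots> = S.frame p $ 1 v* R"
      by (simp add: vec_eq_iff matrix_matrix_mult_def vector_matrix_mult_def mult.commute)
    finally show ?thesis by simp
  qed
  ultimately show ?thesis by blast
qed

end

section \<open>The correspondence between immersions and compatible data, in both directions\<close>

theorem theorem2p4:
  shows
  "(\<forall>(L0::real) (D::pt set) F lam N1 N2 ori.
      L0 \<noteq> 0 \<and> conf_frame L0 D F lam N1 N2 ori \<and> twistor_nondeg L0 D F lam N1 N2 \<longrightarrow>
      (let W = assocW L0 F N1 N2; X = assocX L0 F N1 N2;
           Y = assocY L0 F N1 N2; Z = assocZ L0 F N1 N2;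
           f = (\<lambda>p. L0 * exp (2 * lam p)) in
       \<forall>p\<in>D.
         (\<forall>s. Dl W X Y Z s p \<noteq> 0 \<and>
              Acoef W X Y Z s p = assocPhi L0 F lam N1 N2 s p \<and>
              Bcoef W X Y Z s p = assocPsi L0 F lam N1 N2 s p) \<and>
         pu f p = f p * (Acoef W X Y Z True p + Acoef W X Y Z False p) \<and>
         pv f p = f p * (Bcoef W X Y Z True p + Bcoef W X Y Z False p)))
   \<and>
   (\<forall>(L0::real) (D::pt set) (W::bool \<Rightarrow> pt \<Rightarrow> real) X Y Z.
      let A = Acoef W X Y Z; B = Bcoef W X Y Z;
          f = (\<lambda>p. Dl W X Y Z True p - pu (A True) p - pv (B False) p);
          lam = (\<lambda>p. ln (f p / L0) / 2);
          realizes = (\<lambda>F N1 N2 ori. conf_frame L0 D F lam N1 N2 ori \<and>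
             (\<forall>s. \<forall>p\<in>D. assocW L0 F N1 N2 s p = W s p \<and> assocX L0 F N1 N2 s p = X s p \<and>
                         assocY L0 F N1 N2 s p = Y s p \<and> assocZ L0 F N1 N2 s p = Z s p))
      in
      L0 \<noteq> 0 \<and> open D \<and> connected D \<and> simply_connected D \<and>
      (\<forall>s. smooth_on D (W s) \<and> smooth_on D (X s) \<and> smooth_on D (Y s) \<and> smooth_on D (Z s)) \<and>
      (\<forall>p\<in>D. W True p + W False p = X True p + X False p \<and>
              Y True p + Y False p = Z True p + Z False p \<and>
              (\<forall>s. Dl W X Y Z s p \<noteq> 0) \<and>
              Dl W X Y Z True p - Dl W X Y Z False p
                = pu (\<lambda>q. A True q - A False q) p - pv (\<lambda>q. B True q - B False q) p \<and>
              f p \<noteq> 0 \<and> f p / L0 > 0 \<and>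
              pu f p = f p * (A True p + A False p) \<and>
              pv f p = f p * (B True p + B False p))
      \<longrightarrow>
      (\<exists>F N1 N2 ori. realizes F N1 N2 ori \<and> twistor_nondeg L0 D F lam N1 N2) \<and>
      (\<forall>F N1 N2 ori F' N1' N2' ori'. realizes F N1 N2 ori \<and> realizes F' N1' N2' ori' \<longrightarrow>
         (\<exists>\<Phi>. isometry_N L0 \<Phi> \<and> (\<forall>p\<in>D. F' p = \<Phi> (F p)))))"
proof (rule conjI, goal_cases)
  case 1
  show ?case
    unfolding Let_def
  proof (intro allI impI ballI)
    fix L0 :: real and D :: "pt set" and F lam N1 N2 ori p
    assume h: "L0 \<noteq> 0 \<and> conf_frame L0 D F lam N1 N2 ori \<and> twistor_nondeg L0 D F lam N1 N2" and p: "p \<in> D"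
    interpret S: surface L0 D F N1 N2 lam ori by unfold_locales (use h in auto)
    let ?W = "assocW L0 F N1 N2" and ?X = "assocX L0 F N1 N2" and ?Y = "assocY L0 F N1 N2" and ?Z = "assocZ L0 F N1 N2"
    have Dl: "Dl ?W ?X ?Y ?Z s p \<noteq> 0" for s
      using h p S.twistor_nondeg_iff by blast
    have AB: "Acoef ?W ?X ?Y ?Z s p = pu lam p - sg s * S.m2 p" "Bcoef ?W ?X ?Y ?Z s p = pv lam p - sg s * S.m1 p" for s
      using S.Acoef_Bcoef[OF p, of ?W ?X ?Y ?Z s] Dl by simp_all
    have "pdir k (\<lambda>p. L0 * S.E p) p = L0 * (2 * pdir k lam p * S.E p)" for k
      using pdir_cmult[of S.E p k L0] smooth_on_differentiable[OF smooth_on_exp[OF smooth_on_cmult[OF S.smooth_lam]] p]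
      by (simp add: S.pdir_E[OF p])
    then show "(\<forall>s. Dl ?W ?X ?Y ?Z s p \<noteq> 0 \<and> Acoef ?W ?X ?Y ?Z s p = assocPhi L0 F lam N1 N2 s p \<and>
          Bcoef ?W ?X ?Y ?Z s p = assocPsi L0 F lam N1 N2 s p) \<and>
        pu (\<lambda>p. L0 * exp (2 * lam p)) p = L0 * exp (2 * lam p) * (Acoef ?W ?X ?Y ?Z True p + Acoef ?W ?X ?Y ?Z False p) \<and>
        pv (\<lambda>p. L0 * exp (2 * lam p)) p = L0 * exp (2 * lam p) * (Bcoef ?W ?X ?Y ?Z True p + Bcoef ?W ?X ?Y ?Z False p)"
      using Dl by (simp add: AB assocPhi_def assocPsi_def)
  qed
next
  case 2
  show ?case
    unfolding Let_def
  proof (intro allI impI, goal_cases)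
    case (1 L0 D W X Y Z)
    then interpret compatible_data L0 D W X Y Z by unfold_locales auto
    have "\<exists>F N1 N2 ori. conf_frame L0 D F lam N1 N2 ori \<and>
     (\<forall>s. \<forall>p\<in>D. assocW L0 F N1 N2 s p = W s p \<and> assocX L0 F N1 N2 s p = X s p \<and>
                 assocY L0 F N1 N2 s p = Y s p \<and> assocZ L0 F N1 N2 s p = Z s p) \<and>
     twistor_nondeg L0 D F lam N1 N2"
      by (rule immersion_exists) (use 1 in blast)+
    moreover have "\<exists>\<Phi>. isometry_N L0 \<Phi> \<and> (\<forall>p\<in>D. F' p = \<Phi> (F p))"
      if "conf_frame L0 D F lam N1 N2 ori \<and>
          (\<forall>s. \<forall>p\<in>D. assocW L0 F N1 N2 s p = W s p \<and> assocX L0 F N1 N2 s p = X s p \<and>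
                      assocY L0 F N1 N2 s p = Y s p \<and> assocZ L0 F N1 N2 s p = Z s p)"
        "conf_frame L0 D F' lam N1' N2' ori' \<and>
          (\<forall>s. \<forall>p\<in>D. assocW L0 F' N1' N2' s p = W s p \<and> assocX L0 F' N1' N2' s p = X s p \<and>
                      assocY L0 F' N1' N2' s p = Y s p \<and> assocZ L0 F' N1' N2' s p = Z s p)"
      for F N1 N2 ori F' N1' N2' ori'
      by (rule immersion_unique[of F lam N1 N2 ori F' N1' N2' ori']) (use that in blast)+
    ultimately show ?case by blast
  qed
qed

end
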